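(* Let $L$ be an (infinite dimensional) Lie group with Lie algebra $\mathcal L$ and a splitting $L_\pm$, and let $w$ be an integral $2$-cocycle on $\mathcal L$ compatible with the splitting. Let $B$ be the closed unit disk in $\mathbb R^2$, let $r>0$, let $h:(-r,r)\times B\to L$ be a smooth map, and set $h_\epsilon=h(\epsilon,\cdot)$. Then $$\frac{d}{d\epsilon}\int_B h_\epsilon^*w=\int_{\partial B} w\left(h^{-1}\partial_\epsilon h,\ h^{-1}\partial_s h\right)ds,$$ where $s$ is a positively oriented parameter on $\partial B$.
   Context: A splitting of $L$ is a pair of subgroups $L_\pm$ with Lie algebras $\mathcal L_\pm$ such that $L_+\cap L_-=\{e\}$ and $\mathcal L=\mathcal L_+\oplus\mathcal L_-$ as a direct sum of vector spaces. A $2$-cocycle on $\mathcal L$ is a skew-symmetric bilinear form $w$ with $w([\xi_1,\xi_2],\xi_3)+w([\xi_2,\xi_3],\xi_1)+w([\xi_3,\xi_1],\xi_2)=0$ for all $\xi_i\in\mathcal L$. The left invariant $2$-form on $L$ defined by $w$ is again denoted $w$, so that with coordinates $(x,y)$ on $B$, $\int_B h_\epsilon^*w=\int_B w(h^{-1}h_x,h^{-1}h_y)\,dx\,dy$. Integral means that the cohomology class of this form lies in $H^2(L,2\pi i\,\mathbb Z)$. The cocycle is compatible with the splitting if $w$ vanishes on $\mathcal L_+\times\mathcal L_+$ and on $\mathcal L_-\times\mathcal L_-$. *)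

theory Defs
  imports "HOL-Analysis.Analysis" "HOL-Algebra.Group" "HOL-Homology.Simplices"
begin

section \<open>Differential calculus in locally convex spaces\<close>

class locally_convex_space = real_vector + topological_group_add + t2_space +
  assumes tendsto_scaleR_nhds:
      "((\<lambda>(t, v). t *\<^sub>R v) \<longlongrightarrow> a *\<^sub>R x) (nhds a \<times>\<^sub>F nhds x)"
    and convex_neighbourhood:
      "open U \<Longrightarrow> x \<in> U \<Longrightarrow> \<exists>C. open C \<and> x \<in> C \<and> C \<subseteq> U \<and>
        (\<forall>y\<in>C. \<forall>z\<in>C. \<forall>s\<ge>0. \<forall>t\<ge>0. s + t = 1 \<longrightarrow> s *\<^sub>R y + t *\<^sub>R z \<in> C)"

text \<open>
  Smoothness in the sense of Michal--Bastiani (Hamilton, Milnor): all iterated directional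
  derivatives exist and are jointly continuous.  The value \<open>g k (x, v)\<close> is the \<open>k\<close>-th derivative
  \<open>D\<^sup>k f (x) (v 0, \<dots>, v (k - 1))\<close>; it depends on finitely many entries of the sequence \<open>v\<close> only, so
  that continuity for the product topology on sequences is joint continuity in \<open>x\<close> and these entries.
  The set \<open>S\<close> is meant to be contained in the closure of its interior (an open set, a closed disk, a
  simplex).  Derivatives are taken in the interior and required to extend continuously to \<open>S\<close>.
\<close>

definition smooth_on ::
  "'a::{real_vector,topological_space} set \<Rightarrow> ('a \<Rightarrow> 'b::locally_convex_space) \<Rightarrow> bool" where
  "smooth_on S f \<longleftrightarrow>
    (\<exists>g :: nat \<Rightarrow> 'a \<times> (nat \<Rightarrow> 'a) \<Rightarrow> 'b.
      (\<forall>x\<in>S. \<forall>v. g 0 (x, v) = f x) \<and>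
      (\<forall>k. continuous_on (S \<times> UNIV) (g k)) \<and>
      (\<forall>k. \<forall>x\<in>interior S. \<forall>v.
        ((\<lambda>t. (1 / t) *\<^sub>R (g k (x + t *\<^sub>R v k, v) - g k (x, v))) \<longlongrightarrow> g (Suc k) (x, v)) (at 0)))"

text \<open>
  The directional derivative at \<open>p\<close> along \<open>u\<close> of a map defined on \<open>D\<close>.  It is one-sided where the line
  \<open>p + t u\<close> enters or leaves \<open>D\<close>, and unspecified where \<open>p\<close> is isolated on that line.
\<close>

definition dir_deriv ::
  "'a::real_vector set \<Rightarrow> ('a \<Rightarrow> 'b::locally_convex_space) \<Rightarrow> 'a \<Rightarrow> 'a \<Rightarrow> 'b" where
  "dir_deriv D f p u =
    Lim (at 0 within {t. p + t *\<^sub>R u \<in> D}) (\<lambda>t. (1 / t) *\<^sub>R (f (p + t *\<^sub>R u) - f p))"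


section \<open>Lie groups modelled on locally convex spaces\<close>

text \<open>
  A chart is a pair of its domain and the coordinate map, only the values on the domain being
  relevant.  The chart \<open>unit_chart\<close> around the neutral element identifies the Lie algebra \<open>T\<^sub>e L\<close> with
  the model space.
\<close>

record ('l, 'e) lie_data = "'l monoid" +
  manifold_topology :: "'l topology"
  atlas :: "('l set \<times> ('l \<Rightarrow> 'e)) set"
  unit_chart :: "'l set \<times> ('l \<Rightarrow> 'e)"

definition smooth_into ::
  "('l, 'e::locally_convex_space, 'm) lie_data_scheme \<Rightarrow>
    'a::{real_vector,topological_space} set \<Rightarrow> ('a \<Rightarrow> 'l) \<Rightarrow> bool" where
  "smooth_into L S f \<longleftrightarrow>
    continuous_map (top_of_set S) (manifold_topology L) f \<and>
    (\<forall>(U, \<phi>)\<in>atlas L. smooth_on (S \<inter> f -` U) (\<phi> \<circ> f))"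

locale lie_group = group L
  for L :: "('l, 'e::locally_convex_space, 'm) lie_data_scheme" (structure) +
  assumes topspace_eq: "topspace (manifold_topology L) = carrier L"
    and hausdorff: "Hausdorff_space (manifold_topology L)"
    and chart_domain: "(U, \<phi>) \<in> atlas L \<Longrightarrow> openin (manifold_topology L) U"
    and chart_range: "(U, \<phi>) \<in> atlas L \<Longrightarrow> open (\<phi> ` U)"
    and chart_homeomorphic: "(U, \<phi>) \<in> atlas L \<Longrightarrow>
      homeomorphic_map (subtopology (manifold_topology L) U) (top_of_set (\<phi> ` U)) \<phi>"
    and charts_cover: "\<Union>(fst ` atlas L) = carrier L"
    and charts_compatible: "(U, \<phi>) \<in> atlas L \<Longrightarrow> smooth_into L (\<phi> ` U) (inv_into U \<phi>)"
    and unit_chart: "unit_chart L \<in> atlas L" "\<one> \<in> fst (unit_chart L)"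
    and smooth_mult: "(U, \<phi>) \<in> atlas L \<Longrightarrow> (V, \<psi>) \<in> atlas L \<Longrightarrow>
      smooth_into L (\<phi> ` U \<times> \<psi> ` V) (\<lambda>(x, y). inv_into U \<phi> x \<otimes> inv_into V \<psi> y)"
    and smooth_inverse: "(U, \<phi>) \<in> atlas L \<Longrightarrow>
      smooth_into L (\<phi> ` U) (\<lambda>x. inv (inv_into U \<phi> x))"

text \<open>
  The left logarithmic derivative \<open>f\<^sup>-\<^sup>1 \<partial>\<^sub>u f\<close> at \<open>p\<close>: the tangent vector at \<open>f p\<close> of the curve
  \<open>t \<mapsto> f (p + t u)\<close>, moved to \<open>T\<^sub>e L\<close> by left translation with \<open>(f p)\<^sup>-\<^sup>1\<close>.
\<close>

definition log_deriv ::
  "('l, 'e::locally_convex_space, 'm) lie_data_scheme \<Rightarrow>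
    'a::real_vector set \<Rightarrow> ('a \<Rightarrow> 'l) \<Rightarrow> 'a \<Rightarrow> 'a \<Rightarrow> 'e" where
  "log_deriv L D f p u = dir_deriv D (\<lambda>q. snd (unit_chart L) (inv\<^bsub>L\<^esub> f p \<otimes>\<^bsub>L\<^esub> f q)) p u"

text \<open>
  The left invariant vector field with value \<open>v\<close> at the neutral element, in the coordinates of
  \<open>unit_chart\<close>, and the value at the neutral element of the bracket
  \<open>[X, Y] = dY(X) - dX(Y)\<close> of two such fields.
\<close>

definition left_invariant_field ::
  "('l, 'e::locally_convex_space, 'm) lie_data_scheme \<Rightarrow> 'e \<Rightarrow> 'e \<Rightarrow> 'e" where
  "left_invariant_field L v x =
    (let (U, \<phi>) = unit_chart L in
      dir_deriv (\<phi> ` U) (\<lambda>y. \<phi> (inv_into U \<phi> x \<otimes>\<^bsub>L\<^esub> inv_into U \<phi> y)) (\<phi> \<one>\<^bsub>L\<^esub>) v)"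

definition lie_bracket ::
  "('l, 'e::locally_convex_space, 'm) lie_data_scheme \<Rightarrow> 'e \<Rightarrow> 'e \<Rightarrow> 'e" where
  "lie_bracket L v w =
    (let (U, \<phi>) = unit_chart L in
      dir_deriv (\<phi> ` U) (left_invariant_field L w) (\<phi> \<one>\<^bsub>L\<^esub>) v -
      dir_deriv (\<phi> ` U) (left_invariant_field L v) (\<phi> \<one>\<^bsub>L\<^esub>) w)"


section \<open>Splittings\<close>

definition subgroup_lie_algebra ::
  "('l, 'e::locally_convex_space, 'm) lie_data_scheme \<Rightarrow> 'l set \<Rightarrow> 'e set" where
  "subgroup_lie_algebra L H =
    {log_deriv L UNIV c (0::real) 1 | c.
      smooth_into L UNIV c \<and> c 0 = \<one>\<^bsub>L\<^esub> \<and> range c \<subseteq> H}"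

definition lie_subalgebra ::
  "('l, 'e::locally_convex_space, 'm) lie_data_scheme \<Rightarrow> 'e set \<Rightarrow> bool" where
  "lie_subalgebra L A \<longleftrightarrow> subspace A \<and> (\<forall>v\<in>A. \<forall>w\<in>A. lie_bracket L v w \<in> A)"

definition splitting ::
  "('l, 'e::locally_convex_space, 'm) lie_data_scheme \<Rightarrow> 'l set \<Rightarrow> 'l set \<Rightarrow> bool" where
  "splitting L Lp Lm \<longleftrightarrow>
    subgroup Lp L \<and> subgroup Lm L \<and> Lp \<inter> Lm = {\<one>\<^bsub>L\<^esub>} \<and>
    lie_subalgebra L (subgroup_lie_algebra L Lp) \<and>
    lie_subalgebra L (subgroup_lie_algebra L Lm) \<and>
    subgroup_lie_algebra L Lp \<inter> subgroup_lie_algebra L Lm = {0} \<and>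
    {v + w | v w. v \<in> subgroup_lie_algebra L Lp \<and> w \<in> subgroup_lie_algebra L Lm} = UNIV"


section \<open>Cocycles\<close>

text \<open>Continuity of \<open>w\<close> expresses that the left invariant form defined by \<open>w\<close> is smooth.\<close>

definition two_cocycle ::
  "('l, 'e::locally_convex_space, 'm) lie_data_scheme \<Rightarrow> ('e \<Rightarrow> 'e \<Rightarrow> complex) \<Rightarrow> bool" where
  "two_cocycle L w \<longleftrightarrow>
    bilinear w \<and> continuous_on UNIV (\<lambda>(\<xi>, \<eta>). w \<xi> \<eta>) \<and>
    (\<forall>\<xi> \<eta>. w \<xi> \<eta> = - w \<eta> \<xi>) \<and>
    (\<forall>\<xi>\<^sub>1 \<xi>\<^sub>2 \<xi>\<^sub>3. w (lie_bracket L \<xi>\<^sub>1 \<xi>\<^sub>2) \<xi>\<^sub>3 + w (lie_bracket L \<xi>\<^sub>2 \<xi>\<^sub>3) \<xi>\<^sub>1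
      + w (lie_bracket L \<xi>\<^sub>3 \<xi>\<^sub>1) \<xi>\<^sub>2 = 0)"

definition compatible ::
  "('l, 'e::locally_convex_space, 'm) lie_data_scheme \<Rightarrow> ('e \<Rightarrow> 'e \<Rightarrow> complex) \<Rightarrow>
    'l set \<Rightarrow> 'l set \<Rightarrow> bool" where
  "compatible L w Lp Lm \<longleftrightarrow>
    (\<forall>\<xi>\<in>subgroup_lie_algebra L Lp. \<forall>\<eta>\<in>subgroup_lie_algebra L Lp. w \<xi> \<eta> = 0) \<and>
    (\<forall>\<xi>\<in>subgroup_lie_algebra L Lm. \<forall>\<eta>\<in>subgroup_lie_algebra L Lm. w \<xi> \<eta> = 0)"

text \<open>
  The coefficient of \<open>dx dy\<close> in the pullback under \<open>f\<close> of the left invariant form defined by \<open>w\<close>.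
\<close>

definition pullback_form ::
  "('l, 'e::locally_convex_space, 'm) lie_data_scheme \<Rightarrow> ('e \<Rightarrow> 'e \<Rightarrow> complex) \<Rightarrow>
    (real \<times> real) set \<Rightarrow> (real \<times> real \<Rightarrow> 'l) \<Rightarrow> real \<times> real \<Rightarrow> complex" where
  "pullback_form L w D f p = w (log_deriv L D f p (1, 0)) (log_deriv L D f p (0, 1))"

text \<open>
  The disk and the triangle have only finitely many boundary points at which a partial derivative
  along the set is unspecified; they do not affect the integral.
\<close>

definition integral_pullback ::
  "('l, 'e::locally_convex_space, 'm) lie_data_scheme \<Rightarrow> ('e \<Rightarrow> 'e \<Rightarrow> complex) \<Rightarrow>
    (real \<times> real) set \<Rightarrow> (real \<times> real \<Rightarrow> 'l) \<Rightarrow> complex" where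
  "integral_pullback L w D f = integral D (pullback_form L w D f)"

definition triangle :: "(real \<times> real) set" where
  "triangle = {(x, y). 0 \<le> x \<and> 0 \<le> y \<and> x + y \<le> 1}"

definition barycentric :: "real \<times> real \<Rightarrow> nat \<Rightarrow> real" where
  "barycentric p = (\<lambda>i. if i = 0 then 1 - fst p - snd p
    else if i = 1 then fst p else if i = 2 then snd p else 0)"

definition smooth_singular_2_simplex ::
  "('l, 'e::locally_convex_space, 'm) lie_data_scheme \<Rightarrow> ((nat \<Rightarrow> real) \<Rightarrow> 'l) \<Rightarrow> bool" where
  "smooth_singular_2_simplex L \<sigma> \<longleftrightarrow>
    singular_simplex 2 (manifold_topology L) \<sigma> \<and> smooth_into L triangle (\<sigma> \<circ> barycentric)"

text \<open>
  The de Rham class of the left invariant form lies in (the image of) \<open>H\<^sup>2(L, 2\<pi>i\<int>)\<close>: on smooth singular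
  simplices, integration of the form differs from a singular cocycle \<open>c\<close> with values in \<open>2\<pi>i\<int>\<close> by the
  coboundary of a complex cochain \<open>b\<close>.
\<close>

definition integral_cocycle ::
  "('l, 'e::locally_convex_space, 'm) lie_data_scheme \<Rightarrow> ('e \<Rightarrow> 'e \<Rightarrow> complex) \<Rightarrow> bool" where
  "integral_cocycle L w \<longleftrightarrow>
    (\<exists>c b :: ((nat \<Rightarrow> real) \<Rightarrow> 'l) \<Rightarrow> complex.
      (\<forall>\<sigma>. singular_simplex 2 (manifold_topology L) \<sigma> \<longrightarrow>
        (\<exists>n::int. c \<sigma> = 2 * of_real pi * \<i> * of_int n)) \<and>
      (\<forall>\<tau>. singular_simplex 3 (manifold_topology L) \<tau> \<longrightarrow>
        (\<Sum>k\<le>3. (- 1) ^ k * c (singular_face 3 k \<tau>)) = 0) \<and>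
      (\<forall>\<sigma>. smooth_singular_2_simplex L \<sigma> \<longrightarrow>
        integral_pullback L w triangle (\<sigma> \<circ> barycentric) =
          c \<sigma> + (\<Sum>k\<le>2. (- 1) ^ k * b (singular_face 2 k \<sigma>))))"


section \<open>The boundary circle\<close>

definition positive_circle_param :: "real \<Rightarrow> real \<Rightarrow> (real \<Rightarrow> real \<times> real) \<Rightarrow> bool" where
  "positive_circle_param a b \<gamma> \<longleftrightarrow> a < b \<and>
    (\<exists>\<theta> \<theta>'. (\<forall>s\<in>{a..b}. (\<theta> has_real_derivative \<theta>' s) (at s within {a..b}) \<and> \<theta>' s > 0) \<and>
      continuous_on {a..b} \<theta>' \<and> \<theta> b = \<theta> a + 2 * pi \<and>
      (\<forall>s\<in>{a..b}. \<gamma> s = (cos (\<theta> s), sin (\<theta> s))))"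

end

(*
  With X_i = h^-1 (d_i h), the coefficients W_ij = w(X_i, X_j) of the pulled back form satisfy
  d_e W_12 = d_x W_02 - d_y W_01: this is the Maurer-Cartan equation d_i X_j - d_j X_i = -[X_i, X_j]
  combined with the cocycle identity.  Green's theorem on the disks of radius less than 1 and a limit
  give the formula.
  Calculus in the model space rests on a mean value theorem in convex sets: a map with jointly
  continuous directional derivatives has a derivative in the strict sense, where base point and
  direction may vary, and this notion obeys the chain rule up to the boundary of a convex set.
*)

theory Submission
  imports Defs
begin

section \<open>Locally convex spaces\<close>

text \<open>The model space has no norm and need not be complete, so membership in convex
  neighbourhoods takes the place of norm estimates. Smoothness on a set with boundary supplies
  difference quotients at interior points only; at boundary points it gives just continuity of the
  derivatives. The right-hand side, however, differentiates along the circle, and tangent lines of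
  the circle leave the disk at once. A strict derivative, whose base point and direction move within
  the set, is what identifies the derivative along the circle with the continuous extension from the
  interior. A second obstacle is that \<open>log_deriv\<close> reads everything in
  \<open>unit_chart\<close> after left translation, while h moves through many charts. Near each
  point p the map is therefore replaced by q \<mapsto> h(p)^-1 h(q), which sits at the neutral
  element for q = p. The differential of the Maurer-Cartan form then has to be known at the neutral
  element only, where it is the bracket. Since every interior point can serve as its own centre,
  this gives the equation throughout the interior.\<close>

instance prod :: (topological_monoid_add, topological_monoid_add) topological_monoid_add
proof
  fix a b :: "'a \<times> 'b"
  have "((\<lambda>z::('a \<times> 'b) \<times> ('a \<times> 'b). (fst (fst z) + fst (snd z), snd (fst z) + snd (snd z)))
      \<longlongrightarrow> (fst a + fst b, snd a + snd b)) (nhds a \<times>\<^sub>F nhds b)"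
    by (intro tendsto_Pair tendsto_add tendsto_fst tendsto_snd filterlim_fst filterlim_snd)
  then show "((\<lambda>z. fst z + snd z) \<longlongrightarrow> a + b) (nhds a \<times>\<^sub>F nhds b)"
    by (simp add: plus_prod_def)
qed

instance prod :: (topological_group_add, topological_group_add) topological_group_add
proof
  fix a :: "'a \<times> 'b"
  have "((\<lambda>z::'a \<times> 'b. (- fst z, - snd z)) \<longlongrightarrow> (- fst a, - snd a)) (nhds a)"
    by (intro tendsto_Pair tendsto_minus tendsto_fst tendsto_snd filterlim_ident)
  then show "(uminus \<longlongrightarrow> - a) (nhds a)"
    by (simp add: uminus_prod_def[abs_def])
qed

text \<open>Needed for tangent pairs \<open>(x, v)\<close>, on which second derivatives become first
  derivatives, and for the parameter space of the triples \<open>(e, x, y)\<close>.\<close>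

instance prod :: (locally_convex_space, locally_convex_space) locally_convex_space
proof
  fix a :: real and x :: "'a \<times> 'b"
  have fst: "((\<lambda>z::real \<times> 'a \<times> 'b. (fst z, fst (snd z))) \<longlongrightarrow> (a, fst x)) (nhds a \<times>\<^sub>F nhds x)"
    and snd: "((\<lambda>z::real \<times> 'a \<times> 'b. (fst z, snd (snd z))) \<longlongrightarrow> (a, snd x)) (nhds a \<times>\<^sub>F nhds x)"
    by (intro tendsto_Pair tendsto_fst tendsto_snd filterlim_fst filterlim_snd)+
  have "((\<lambda>z::real \<times> 'a \<times> 'b. (fst z *\<^sub>R fst (snd z), fst z *\<^sub>R snd (snd z)))
      \<longlongrightarrow> (a *\<^sub>R fst x, a *\<^sub>R snd x)) (nhds a \<times>\<^sub>F nhds x)"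
    using filterlim_compose[OF tendsto_scaleR_nhds fst[unfolded nhds_prod]]
      filterlim_compose[OF tendsto_scaleR_nhds snd[unfolded nhds_prod]]
    by (intro tendsto_Pair) simp_all
  then show "((\<lambda>(t, v). t *\<^sub>R v) \<longlongrightarrow> a *\<^sub>R x) (nhds a \<times>\<^sub>F nhds x)"
    by (simp add: scaleR_prod_def case_prod_unfold)
next
  fix U :: "('a \<times> 'b) set" and x
  assume "open U" "x \<in> U"
  then obtain A B where AB: "open A" "open B" "fst x \<in> A" "snd x \<in> B" "A \<times> B \<subseteq> U"
    by (metis open_prod_elim mem_Times_iff)
  obtain A' where A': "open A'" "fst x \<in> A'" "A' \<subseteq> A"
    "\<forall>y\<in>A'. \<forall>z\<in>A'. \<forall>s\<ge>0. \<forall>t\<ge>0. s + t = 1 \<longrightarrow> s *\<^sub>R y + t *\<^sub>R z \<in> A'"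
    using convex_neighbourhood[OF AB(1,3)] by blast
  obtain B' where B': "open B'" "snd x \<in> B'" "B' \<subseteq> B"
    "\<forall>y\<in>B'. \<forall>z\<in>B'. \<forall>s\<ge>0. \<forall>t\<ge>0. s + t = 1 \<longrightarrow> s *\<^sub>R y + t *\<^sub>R z \<in> B'"
    using convex_neighbourhood[OF AB(2,4)] by blast
  show "\<exists>C. open C \<and> x \<in> C \<and> C \<subseteq> U \<and>
      (\<forall>y\<in>C. \<forall>z\<in>C. \<forall>s\<ge>0. \<forall>t\<ge>0. s + t = 1 \<longrightarrow> s *\<^sub>R y + t *\<^sub>R z \<in> C)"
    using A' B' AB by (intro exI[of _ "A' \<times> B'"]) (auto simp: open_Times mem_Times_iff)
qed

instance real :: locally_convex_space
proof
  fix a x :: real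
  have "((\<lambda>z::real \<times> real. fst z * snd z) \<longlongrightarrow> a * x) (nhds a \<times>\<^sub>F nhds x)"
    by (intro tendsto_mult filterlim_fst filterlim_snd)
  then show "((\<lambda>(t, v). t *\<^sub>R v) \<longlongrightarrow> a *\<^sub>R x) (nhds a \<times>\<^sub>F nhds x)"
    by (simp add: case_prod_unfold)
next
  fix U :: "real set" and x
  assume "open U" "x \<in> U"
  then obtain e where "e > 0" "ball x e \<subseteq> U"
    using open_contains_ball by blast
  then show "\<exists>C. open C \<and> x \<in> C \<and> C \<subseteq> U \<and>
      (\<forall>y\<in>C. \<forall>z\<in>C. \<forall>s\<ge>0. \<forall>t\<ge>0. s + t = 1 \<longrightarrow> s *\<^sub>R y + t *\<^sub>R z \<in> C)"
    using convex_ball[of x e] by (intro exI[of _ "ball x e"]) (simp add: convex_def)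
qed

lemma tendsto_scaleR_lcs [tendsto_intros]:
  fixes g :: "'c \<Rightarrow> 'b::locally_convex_space"
  assumes "(f \<longlongrightarrow> a) F" "(g \<longlongrightarrow> x) F"
  shows "((\<lambda>z. f z *\<^sub>R g z) \<longlongrightarrow> a *\<^sub>R x) F"
  using filterlim_compose[OF tendsto_scaleR_nhds filterlim_Pair[OF assms]] by simp

lemma continuous_on_scaleR_lcs [continuous_intros]:
  fixes g :: "'c::topological_space \<Rightarrow> 'b::locally_convex_space"
  assumes "continuous_on S f" "continuous_on S g"
  shows "continuous_on S (\<lambda>z. f z *\<^sub>R g z)"
  using assms by (auto simp: continuous_on_def intro: tendsto_scaleR_lcs)

lemma continuous_on_add_tma:
  fixes g :: "'c::topological_space \<Rightarrow> 'b::topological_monoid_add"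
  assumes "continuous_on S f" "continuous_on S g"
  shows "continuous_on S (\<lambda>z. f z + g z)"
  using assms by (auto simp: continuous_on_def intro: tendsto_add)

lemma continuous_on_diff_tga:
  fixes g :: "'c::topological_space \<Rightarrow> 'b::topological_group_add"
  assumes "continuous_on S f" "continuous_on S g"
  shows "continuous_on S (\<lambda>z. f z - g z)"
  using assms by (auto simp: continuous_on_def intro: tendsto_diff)

lemma convex_open_neighbourhood:
  fixes x :: "'b::locally_convex_space"
  assumes "open U" "x \<in> U"
  obtains C where "open C" "convex C" "x \<in> C" "C \<subseteq> U"
proof -
  obtain C where "open C" "x \<in> C" "C \<subseteq> U"
    and "\<forall>y\<in>C. \<forall>z\<in>C. \<forall>s\<ge>0. \<forall>t\<ge>0. s + t = 1 \<longrightarrow> s *\<^sub>R y + t *\<^sub>R z \<in> C"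
    using convex_neighbourhood[OF assms] by blast
  then show ?thesis
    by (intro that[of C]) (simp_all add: convex_def)
qed

text \<open>If \<open>x + N - N\<close> lies in \<open>U\<close> and \<open>C - x\<close> in
  \<open>N\<close>, then a point y of the closure has some z in \<open>C\<close> with
  \<open>z - y\<close> in \<open>N\<close>, and y = x + (z - x) - (z - y). Mean value estimates
  reach only the closure of a convex set, so neighbourhoods of this kind are needed.\<close>

lemma convex_closed_neighbourhood:
  fixes x :: "'b::locally_convex_space"
  assumes "open U" "x \<in> U"
  obtains C where "open C" "convex C" "x \<in> C" "closure C \<subseteq> U"
proof -
  have "((\<lambda>z::'b \<times> 'b. x + fst z - snd z) \<longlongrightarrow> x + 0 - 0) (nhds (0, 0))"
    unfolding nhds_prod by (intro tendsto_intros filterlim_fst filterlim_snd)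
  then have "\<forall>\<^sub>F z in nhds (0::'b, 0::'b). x + fst z - snd z \<in> U"
    by (rule topological_tendstoD) (use assms in simp_all)
  then obtain G where G: "open G" "(0, 0) \<in> G" "\<And>z. z \<in> G \<Longrightarrow> x + fst z - snd z \<in> U"
    unfolding eventually_nhds by blast
  obtain A B where AB: "open A" "open B" "(0::'b) \<in> A" "0 \<in> B" "A \<times> B \<subseteq> G"
    using G(1,2) by (metis open_prod_elim mem_Sigma_iff)
  define N where "N = A \<inter> B"
  have N: "open N" "0 \<in> N" "\<And>y z. y \<in> N \<Longrightarrow> z \<in> N \<Longrightarrow> x + y - z \<in> U"
    using AB G by (auto simp: N_def)
  have "((\<lambda>y. y - x) \<longlongrightarrow> x - x) (nhds x)"
    by (intro tendsto_intros filterlim_ident)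
  then have "\<forall>\<^sub>F y in nhds x. y - x \<in> N"
    by (rule topological_tendstoD) (use N in simp_all)
  then obtain M where M: "open M" "x \<in> M" "\<And>y. y \<in> M \<Longrightarrow> y - x \<in> N"
    unfolding eventually_nhds by blast
  obtain C where C: "open C" "convex C" "x \<in> C" "C \<subseteq> M"
    using convex_open_neighbourhood[OF M(1,2)] by metis
  have "closure C \<subseteq> U"
  proof
    fix y assume y: "y \<in> closure C"
    have "((\<lambda>z. z - y) \<longlongrightarrow> y - y) (nhds y)"
      by (intro tendsto_intros filterlim_ident)
    then have "\<forall>\<^sub>F z in nhds y. z - y \<in> N"
      by (rule topological_tendstoD) (use N in simp_all)
    then obtain V where V: "open V" "y \<in> V" "\<And>z. z \<in> V \<Longrightarrow> z - y \<in> N"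
      unfolding eventually_nhds by blast
    then obtain z where z: "z \<in> C" "z \<in> V"
      using y by (meson closure_iff_nhds_not_empty disjoint_iff subset_refl)
    have "x + (z - x) - (z - y) \<in> U"
      using z V C M by (intro N(3)) auto
    then show "y \<in> U"
      by (simp add: algebra_simps)
  qed
  then show ?thesis
    using C that by blast
qed

text \<open>The affine map u \<mapsto> (1 - e) x + e u carries a neighbourhood of \<open>c\<close>
  inside \<open>S\<close> to a neighbourhood of the new point, again inside \<open>S\<close>.
  Boundary points are approached from the interior in this way.\<close>

lemma convex_shrink_interior:
  fixes S :: "'a::locally_convex_space set"
  assumes "convex S" "x \<in> S" "c \<in> interior S" "0 < e" "e \<le> 1"
  shows "(1 - e) *\<^sub>R x + e *\<^sub>R c \<in> interior S"
proof -
  obtain U where U: "open U" "c \<in> U" "U \<subseteq> S"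
    using assms(3) by (meson interior_subset open_interior)
  define V where "V = (\<lambda>y. (1 / e) *\<^sub>R (y - (1 - e) *\<^sub>R x)) -` U"
  have "open V"
  proof -
    have "continuous_on UNIV (\<lambda>y. (1 / e) *\<^sub>R (y - (1 - e) *\<^sub>R x))"
      by (auto simp: continuous_on_def intro!: tendsto_intros)
    then show ?thesis
      unfolding V_def using U(1) by (simp add: open_vimage)
  qed
  moreover have "(1 - e) *\<^sub>R x + e *\<^sub>R c \<in> V"
    using U(2) \<open>0 < e\<close> by (simp add: V_def)
  moreover have "V \<subseteq> S"
  proof
    fix y assume "y \<in> V"
    then have "(1 / e) *\<^sub>R (y - (1 - e) *\<^sub>R x) \<in> S"
      using U(3) by (auto simp: V_def)
    then have "(1 - e) *\<^sub>R x + e *\<^sub>R ((1 / e) *\<^sub>R (y - (1 - e) *\<^sub>R x)) \<in> S"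
      using assms by (intro convexD) auto
    then show "y \<in> S"
      using \<open>0 < e\<close> by simp
  qed
  ultimately show ?thesis
    by (meson interiorI)
qed

section \<open>Mean values in convex sets\<close>

lemma convex_combination:
  assumes "convex C" "k \<in> C" "l \<in> C" "0 \<le> s" "0 \<le> t"
  shows "\<exists>m\<in>C. s *\<^sub>R k + t *\<^sub>R l = (s + t) *\<^sub>R m"
proof (cases "s + t = 0")
  case True
  then have "s = 0" "t = 0"
    using assms by linarith+
  then show ?thesis
    using assms by auto
next
  case False
  then have "s + t > 0"
    using assms by linarith
  then have "(s / (s + t)) *\<^sub>R k + (t / (s + t)) *\<^sub>R l \<in> C"
    using assms by (intro convexD) (auto simp: add_divide_distrib[symmetric])
  then show ?thesis
    using False by (intro bexI) (auto simp: scaleR_right_distrib)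
qed

text \<open>Neither an integral of the derivative nor a separating functional is used. Increments of
  the form (v - u) times an element of \<open>C\<close> add up over adjacent intervals because
  \<open>C\<close> is convex, and exist near every point because \<open>C\<close> is open; bisection
  spreads them over compact subintervals.\<close>

lemma mean_value_convex:
  fixes c :: "real \<Rightarrow> 'b::locally_convex_space"
  assumes "a < b" and cont: "continuous_on {a..b} c"
    and deriv: "\<And>t. a < t \<Longrightarrow> t < b \<Longrightarrow> ((\<lambda>h. (1 / h) *\<^sub>R (c (t + h) - c t)) \<longlongrightarrow> c' t) (at 0)"
    and in_C: "\<And>t. a < t \<Longrightarrow> t < b \<Longrightarrow> c' t \<in> C"
    and C: "open C" "convex C"
  shows "(1 / (b - a)) *\<^sub>R (c b - c a) \<in> closure C"
proof -
  define P where "P u v \<longleftrightarrow> (\<exists>k\<in>C. c v - c u = (v - u) *\<^sub>R k)" for u v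
  have step: "P u v" if uv: "a < u" "u \<le> v" "v < b" for u v
    using uv(2)
  proof (rule Bolzano[where P = P])
    fix x y z :: real
    assume "P x y" "P y z" and le: "x \<le> y" "y \<le> z"
    then obtain k l where k: "k \<in> C" "c y - c x = (y - x) *\<^sub>R k"
      and l: "l \<in> C" "c z - c y = (z - y) *\<^sub>R l"
      by (auto simp: P_def)
    have "c z - c x = (y - x) *\<^sub>R k + (z - y) *\<^sub>R l"
      using k(2) l(2) by (metis add.commute diff_add_cancel diff_add_eq)
    then show "P x z"
      using convex_combination[OF C(2) k(1) l(1), of "y - x" "z - y"] le by (auto simp: P_def)
  next
    fix x assume "u \<le> x" "x \<le> v"
    then have x: "a < x" "x < b"
      using uv by auto
    have "\<forall>\<^sub>F h in at 0. (1 / h) *\<^sub>R (c (x + h) - c x) \<in> C"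
      using deriv[OF x] C(1) in_C[OF x] by (rule topological_tendstoD)
    then obtain d where d: "d > 0"
      "\<And>h. h \<noteq> 0 \<Longrightarrow> \<bar>h\<bar> < d \<Longrightarrow> (1 / h) *\<^sub>R (c (x + h) - c x) \<in> C"
      unfolding eventually_at by (auto simp: dist_real_def)
    have near: "\<exists>k\<in>C. c (x + h) - c x = h *\<^sub>R k" if "\<bar>h\<bar> < d" for h
    proof (cases "h = 0")
      case True
      then show ?thesis
        using in_C[OF x] by auto
    next
      case False
      then show ?thesis
        using d(2)[OF False that] by (intro bexI[of _ "(1 / h) *\<^sub>R (c (x + h) - c x)"]) auto
    qed
    \<comment> \<open>The interval is cut at \<open>x\<close>: on each side the increment from
      \<open>x\<close> is the signed length times an element of \<open>C\<close>.\<close>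
    have "P p q" if pq: "p \<le> x \<and> x \<le> q \<and> q - p < d" for p q
    proof -
      obtain k where k: "k \<in> C" "c q - c x = (q - x) *\<^sub>R k"
        using near[of "q - x"] pq by auto
      obtain l where l: "l \<in> C" "c p - c x = (p - x) *\<^sub>R l"
        using near[of "p - x"] pq by auto
      have "c q - c p = (c q - c x) - (c p - c x)"
        by simp
      also have "\<dots> = (x - p) *\<^sub>R l + (q - x) *\<^sub>R k"
        unfolding k(2) l(2) by (simp add: algebra_simps)
      finally show ?thesis
        using convex_combination[OF C(2) l(1) k(1), of "x - p" "q - x"] pq by (auto simp: P_def)
    qed
    then show "\<exists>d>0. \<forall>p q. p \<le> x \<and> x \<le> q \<and> q - p < d \<longrightarrow> P p q"
      using d(1) by blast
  qed
  \<comment> \<open>At the end points only continuity is known. They are reached as \<open>e\<close>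
    tends to 0, which costs the passage from \<open>C\<close> to its closure.\<close>
  define Q where "Q e = (1 / (b - e - (a + e))) *\<^sub>R (c (b - e) - c (a + e))" for e
  have small: "\<forall>\<^sub>F e in at_right 0. 0 < e \<and> e < (b - a) / 2"
    using \<open>a < b\<close> unfolding eventually_at_right_field by (intro exI[of _ "(b - a) / 2"]) auto
  have "\<forall>\<^sub>F e in at_right 0. Q e \<in> closure C"
    using small
  proof eventually_elim
    case (elim e)
    then have "P (a + e) (b - e)"
      by (intro step) (auto simp: field_simps)
    moreover have "b - e - (a + e) \<noteq> 0"
      using elim by (auto simp: field_simps)
    ultimately have "Q e \<in> C"
      by (auto simp: P_def Q_def)
    then show ?case
      using closure_subset by blast
  qed
  moreover have "(Q \<longlongrightarrow> (1 / (b - 0 - (a + 0))) *\<^sub>R (c b - c a)) (at_right 0)"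
    unfolding Q_def
  proof (intro tendsto_scaleR_lcs tendsto_diff)
    show "((\<lambda>e. 1 / (b - e - (a + e))) \<longlongrightarrow> 1 / (b - 0 - (a + 0))) (at_right 0)"
      using \<open>a < b\<close> by (intro tendsto_intros) auto
    have "((\<lambda>e. b - e) \<longlongrightarrow> b - 0) (at_right (0::real))" "((\<lambda>e. a + e) \<longlongrightarrow> a + 0) (at_right (0::real))"
      by (intro tendsto_intros)+
    then show "((\<lambda>e. c (b - e)) \<longlongrightarrow> c b) (at_right 0)" "((\<lambda>e. c (a + e)) \<longlongrightarrow> c a) (at_right 0)"
      using \<open>a < b\<close> eventually_mono[OF small, of "\<lambda>e. b - e \<in> {a..b}"]
        eventually_mono[OF small, of "\<lambda>e. a + e \<in> {a..b}"]
      by (auto intro!: continuous_on_tendsto_compose[OF cont])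
  qed
  ultimately show ?thesis
    using Lim_in_closed_set[of "closure C" Q "at_right 0"] by simp
qed

section \<open>Continuously differentiable maps\<close>

text \<open>Base point y, direction u and step t move together, subject only to both ends of the
  segment lying in \<open>S\<close>. Since neither y nor u is frozen, limits along this filter make
  sense at boundary points and are stable under composition.\<close>

definition quotient_filter ::
  "'a::{real_vector,topological_space} set \<Rightarrow> 'a \<Rightarrow> 'a \<Rightarrow> ('a \<times> 'a \<times> real) filter" where
  "quotient_filter S x v =
    inf (nhds x \<times>\<^sub>F nhds v \<times>\<^sub>F at 0) (principal {(y, u, t). y \<in> S \<and> y + t *\<^sub>R u \<in> S})"

definition strict_deriv ::
  "('a::{real_vector,topological_space} \<Rightarrow> 'b::locally_convex_space) \<Rightarrow> 'a set \<Rightarrow> 'a \<Rightarrow> 'a \<Rightarrow> 'b \<Rightarrow> bool"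
  where
  "strict_deriv f S x v d \<longleftrightarrow>
    ((\<lambda>(y, u, t). (1 / t) *\<^sub>R (f (y + t *\<^sub>R u) - f y)) \<longlongrightarrow> d) (quotient_filter S x v)"

text \<open>The Michal-Bastiani notion of C1. At a boundary point \<open>f'\<close> is tied to
  \<open>f\<close> only through continuity; that it still acts as a derivative there is a theorem
  about convex sets.\<close>

definition C1_on ::
  "'a::{real_vector,topological_space} set \<Rightarrow> ('a \<Rightarrow> 'b::locally_convex_space) \<Rightarrow> ('a \<Rightarrow> 'a \<Rightarrow> 'b) \<Rightarrow> bool"
  where
  "C1_on S f f' \<longleftrightarrow> continuous_on S f \<and> continuous_on (S \<times> UNIV) (\<lambda>(x, v). f' x v) \<and>
    (\<forall>x\<in>interior S. \<forall>v. ((\<lambda>t. (1 / t) *\<^sub>R (f (x + t *\<^sub>R v) - f x)) \<longlongrightarrow> f' x v) (at 0))"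

lemma C1_onD:
  assumes "C1_on S f f'"
  shows "continuous_on S f" "continuous_on (S \<times> UNIV) (\<lambda>(x, v). f' x v)"
    "x \<in> interior S \<Longrightarrow> ((\<lambda>t. (1 / t) *\<^sub>R (f (x + t *\<^sub>R v) - f x)) \<longlongrightarrow> f' x v) (at 0)"
  using assms by (auto simp: C1_on_def)

lemma C1_on_subset: "C1_on S f f' \<Longrightarrow> T \<subseteq> S \<Longrightarrow> C1_on T f f'"
  unfolding C1_on_def using interior_mono[of T S]
  by (auto intro: continuous_on_subset[of "S \<times> UNIV"] continuous_on_subset[of S])

lemma filterlim_quotient_filter:
  assumes "(f \<longlongrightarrow> x) F" "(g \<longlongrightarrow> v) F" "filterlim k (at 0) F"
    "\<forall>\<^sub>F z in F. f z \<in> S \<and> f z + k z *\<^sub>R g z \<in> S"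
  shows "filterlim (\<lambda>z. (f z, g z, k z)) (quotient_filter S x v) F"
  unfolding quotient_filter_def using assms
  by (auto simp: filterlim_inf filterlim_principal intro!: filterlim_Pair)

text \<open>Strict derivatives are mostly used through such substitutions, with a fixed direction, a
  chord of a curve, or a difference quotient in the role of \<open>g\<close>.\<close>

lemma strict_deriv_compose:
  assumes "strict_deriv f S x v d" "(y \<longlongrightarrow> x) F" "(g \<longlongrightarrow> v) F" "filterlim k (at 0) F"
    "\<forall>\<^sub>F z in F. y z \<in> S \<and> y z + k z *\<^sub>R g z \<in> S"
  shows "((\<lambda>z. (1 / k z) *\<^sub>R (f (y z + k z *\<^sub>R g z) - f (y z))) \<longlongrightarrow> d) F"
  using filterlim_compose[OF assms(1)[unfolded strict_deriv_def] filterlim_quotient_filter[OF assms(2-5)]]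
  by simp

lemma quotient_filter_mono: "S \<subseteq> T \<Longrightarrow> quotient_filter S x v \<le> quotient_filter T x v"
  unfolding quotient_filter_def by (intro inf_mono) auto

lemma strict_deriv_subset: "strict_deriv f T x v d \<Longrightarrow> S \<subseteq> T \<Longrightarrow> strict_deriv f S x v d"
  unfolding strict_deriv_def using quotient_filter_mono tendsto_mono by blast

lemma tendsto_quotient_filter:
  shows "(fst \<longlongrightarrow> x) (quotient_filter S x v)"
    and "((\<lambda>z. fst (snd z)) \<longlongrightarrow> v) (quotient_filter S x v)"
    and "filterlim (\<lambda>z. snd (snd z)) (at 0) (quotient_filter S x v)"
    and "\<forall>\<^sub>F z in quotient_filter S x v. fst z \<in> S \<and> fst z + snd (snd z) *\<^sub>R fst (snd z) \<in> S"
proof -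
  have le: "quotient_filter S x v \<le> nhds x \<times>\<^sub>F nhds v \<times>\<^sub>F at 0"
    by (simp add: quotient_filter_def)
  show "(fst \<longlongrightarrow> x) (quotient_filter S x v)"
    by (rule tendsto_mono[OF le filterlim_fst])
  show "((\<lambda>z. fst (snd z)) \<longlongrightarrow> v) (quotient_filter S x v)"
    by (rule tendsto_mono[OF le filterlim_compose[OF filterlim_fst filterlim_snd]])
  show "filterlim (\<lambda>z. snd (snd z)) (at 0) (quotient_filter S x v)"
    by (rule filterlim_mono[OF filterlim_compose[OF filterlim_snd filterlim_snd] order_refl le])
  show "\<forall>\<^sub>F z in quotient_filter S x v. fst z \<in> S \<and> fst z + snd (snd z) *\<^sub>R fst (snd z) \<in> S"
    by (auto simp: quotient_filter_def eventually_inf_principal case_prod_unfold)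
qed

lemma tendsto_quotient_filter_point:
  fixes S :: "'a::locally_convex_space set"
  shows "((\<lambda>z. fst z + snd (snd z) *\<^sub>R fst (snd z)) \<longlongrightarrow> x) (quotient_filter S x v)"
proof -
  note lim = tendsto_quotient_filter[where x = x and S = S and v = v]
  have "((\<lambda>z. fst z + snd (snd z) *\<^sub>R fst (snd z)) \<longlongrightarrow> x + 0 *\<^sub>R v) (quotient_filter S x v)"
    using lim(3) by (intro tendsto_add tendsto_scaleR_lcs lim) (auto simp: filterlim_at)
  then show ?thesis by simp
qed

text \<open>Contract the segment from y to y + t u slightly toward an interior point. The contracted
  segment runs in the interior, where the derivative exists and, by joint continuity, stays in a
  small convex \<open>C\<close>. The mean value theorem then controls the quotient, and continuity
  of \<open>f\<close> up to the boundary allows the contraction to be undone.\<close>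

lemma C1_on_strict_convex:
  fixes f :: "'a::locally_convex_space \<Rightarrow> 'b::locally_convex_space"
  assumes C1: "C1_on S f f'" and S: "convex S" "interior S \<noteq> {}" and x: "x \<in> S"
  shows "strict_deriv f S x v (f' x v)"
  unfolding strict_deriv_def
proof (rule topological_tendstoI)
  fix W assume W: "open W" "f' x v \<in> W"
  obtain C where C: "open C" "convex C" "f' x v \<in> C" "closure C \<subseteq> W"
    using convex_closed_neighbourhood[OF W] by metis
  obtain z where z: "z \<in> interior S"
    using S by blast
  have "((\<lambda>(x, v). f' x v) \<longlongrightarrow> f' x v) (at (x, v) within S \<times> UNIV)"
    using C1_onD(2)[OF C1] x by (auto simp: continuous_on_def)
  then have "\<forall>\<^sub>F p in at (x, v) within S \<times> UNIV. (\<lambda>(x, v). f' x v) p \<in> C"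
    by (rule topological_tendstoD) (use C in auto)
  then obtain G where G: "open G" "(x, v) \<in> G"
    "\<And>y u. (y, u) \<in> G \<Longrightarrow> y \<in> S \<Longrightarrow> f' y u \<in> C"
    unfolding eventually_at_topological using C(3)
    by (metis (no_types, lifting) UNIV_I case_prod_conv mem_Sigma_iff)
  obtain A B where AB: "open A" "open B" "x \<in> A" "v \<in> B" "A \<times> B \<subseteq> G"
    using G(1,2) by (metis open_prod_elim mem_Sigma_iff)
  have lim: "((\<lambda>p::('a \<times> 'a) \<times> real. fst (fst p) + snd p *\<^sub>R snd (fst p)) \<longlongrightarrow> x + 0 *\<^sub>R v)
      ((nhds x \<times>\<^sub>F nhds v) \<times>\<^sub>F nhds 0)"
    by (intro tendsto_intros filterlim_compose[OF filterlim_fst filterlim_fst]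
        filterlim_compose[OF filterlim_snd filterlim_fst] filterlim_snd)
  have "\<forall>\<^sub>F p in (nhds x \<times>\<^sub>F nhds v) \<times>\<^sub>F nhds 0. fst (fst p) + snd p *\<^sub>R snd (fst p) \<in> A"
    by (rule topological_tendstoD[OF lim]) (use AB in auto)
  then obtain P Q where PQ: "eventually P (nhds x \<times>\<^sub>F nhds v)" "eventually Q (nhds (0::real))"
    "\<And>p t. P p \<Longrightarrow> Q t \<Longrightarrow> fst p + t *\<^sub>R snd p \<in> A"
    unfolding eventually_prod_filter[of _ "nhds x \<times>\<^sub>F nhds v"] fst_conv snd_conv by blast
  obtain r where r: "r > 0" "\<And>t. \<bar>t\<bar> < r \<Longrightarrow> Q t"
    using PQ(2) unfolding eventually_nhds_metric by (auto simp: dist_real_def)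
  have B: "\<forall>\<^sub>F p in nhds x \<times>\<^sub>F nhds v. snd p \<in> B"
    using topological_tendstoD[OF filterlim_snd[of "nhds v" "nhds x"] AB(2,4)] by simp
  \<comment> \<open>The condition is asked in a whole neighbourhood of \<open>(y, u)\<close>, so
    that it survives the replacement by the contracted pair.\<close>
  have main: "(1 / t) *\<^sub>R (f (y + t *\<^sub>R u) - f y) \<in> closure C"
    if yu: "\<forall>\<^sub>F p in nhds (y, u). P p \<and> snd p \<in> B" and t: "t \<noteq> 0" "\<bar>t\<bar> < r"
      and yS: "y \<in> S" "y + t *\<^sub>R u \<in> S" for y u t
  proof -
    \<comment> \<open>Contracting both ends of the segment toward \<open>z\<close> scales the
      direction by \<open>1 - e\<close> and leaves the step \<open>t\<close> unchanged.\<close>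
    define ye where "ye e = (1 - e) *\<^sub>R y + e *\<^sub>R z" for e
    define ue where "ue e = (1 - e) *\<^sub>R u" for e
    define q where "q e = (1 / t) *\<^sub>R (f (ye e + t *\<^sub>R ue e) - f (ye e))" for e
    have end_eq: "ye e + t *\<^sub>R ue e = (1 - e) *\<^sub>R (y + t *\<^sub>R u) + e *\<^sub>R z" for e
      by (simp add: ye_def ue_def algebra_simps)
    have lim_ye: "(ye \<longlongrightarrow> (1 - 0) *\<^sub>R y + 0 *\<^sub>R z) (at_right 0)"
      unfolding ye_def by (intro tendsto_intros)
    have lim_ue: "(ue \<longlongrightarrow> (1 - 0) *\<^sub>R u) (at_right 0)"
      unfolding ue_def by (intro tendsto_intros)
    have lim_end: "((\<lambda>e. ye e + t *\<^sub>R ue e) \<longlongrightarrow> (1 - 0) *\<^sub>R (y + t *\<^sub>R u) + 0 *\<^sub>R z) (at_right 0)"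
      unfolding end_eq by (intro tendsto_intros)
    have small: "\<forall>\<^sub>F e in at_right (0::real). 0 < e \<and> e < 1"
      unfolding eventually_at_right_field by (intro exI[of _ 1]) auto
    have int: "ye e \<in> interior S" "ye e + t *\<^sub>R ue e \<in> interior S" if "0 < e \<and> e < 1" for e
      unfolding end_eq using that convex_shrink_interior[OF S(1) _ z] yS by (auto simp: ye_def)
    have good: "\<forall>\<^sub>F e in at_right 0. P (ye e, ue e) \<and> ue e \<in> B"
    proof -
      have "((\<lambda>e. (ye e, ue e)) \<longlongrightarrow> (y, u)) (at_right 0)"
        using lim_ye lim_ue by (intro tendsto_Pair) simp_all
      from filterlim_iff[THEN iffD1, OF this, rule_format, OF yu] show ?thesis
        by simp
    qed
    have "\<forall>\<^sub>F e in at_right 0. q e \<in> closure C"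
      using small good
    proof eventually_elim
      case (elim e)
      define c where "c s = f (ye e + s *\<^sub>R ue e)" for s
      have seg: "ye e + s *\<^sub>R ue e \<in> interior S" if s: "s \<in> closed_segment 0 t" for s
      proof -
        obtain l where l: "0 \<le> l" "l \<le> 1" "s = l * t"
          using s by (auto simp: in_segment)
        have "(1 - l) *\<^sub>R ye e + l *\<^sub>R (ye e + t *\<^sub>R ue e) \<in> interior S"
        proof (cases "l = 0")
          case True
          then show ?thesis using int elim by auto
        next
          case False
          have "ye e \<in> S"
            using int(1) elim interior_subset by blast
          then show ?thesis
            using False convex_shrink_interior[OF S(1) _ int(2), of "ye e" e l] elim l by auto
        qed
        then show ?thesis
          using l by (simp add: algebra_simps)
      qed
      have inC: "f' (ye e + s *\<^sub>R ue e) (ue e) \<in> C" if s: "s \<in> closed_segment 0 t" for s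
      proof -
        have "\<bar>s\<bar> \<le> \<bar>t\<bar>"
          using s by (auto simp: closed_segment_eq_real_ivl split: if_splits)
        then have "ye e + s *\<^sub>R ue e \<in> A"
          using PQ(3)[of "(ye e, ue e)" s] r(2)[of s] t elim by simp
        then show ?thesis
          using G(3) AB(5) elim seg[OF s] interior_subset by blast
      qed
      have deriv: "((\<lambda>h. (1 / h) *\<^sub>R (c (s + h) - c s)) \<longlongrightarrow> f' (ye e + s *\<^sub>R ue e) (ue e)) (at 0)"
        if s: "s \<in> closed_segment 0 t" for s
        using C1_onD(3)[OF C1 seg[OF s], of "ue e"] by (simp add: c_def algebra_simps)
      have cont: "continuous_on (closed_segment 0 t) c"
      proof -
        have "continuous_on (closed_segment 0 t) (\<lambda>s. ye e + s *\<^sub>R ue e)"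
          by (auto simp: continuous_on_def intro!: tendsto_intros)
        then show ?thesis
          unfolding c_def using seg interior_subset
          by (intro continuous_on_compose2[OF C1_onD(1)[OF C1]]) blast+
      qed
      show ?case
      \<comment> \<open>The step may be negative, whereas the mean value theorem wants an ordered
        interval.\<close>
      proof (cases "t > 0")
        case True
        have "(1 / (t - 0)) *\<^sub>R (c t - c 0) \<in> closure C"
          using True cont deriv inC C
          by (intro mean_value_convex[where c' = "\<lambda>s. f' (ye e + s *\<^sub>R ue e) (ue e)"])
            (auto simp: closed_segment_eq_real_ivl)
        then show ?thesis
          by (simp add: q_def c_def)
      next
        case False
        have "(1 / (0 - t)) *\<^sub>R (c 0 - c t) \<in> closure C"
          using False t cont deriv inC C
          by (intro mean_value_convex[where c' = "\<lambda>s. f' (ye e + s *\<^sub>R ue e) (ue e)"])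
            (auto simp: closed_segment_eq_real_ivl)
        moreover have "(1 / (0 - t)) *\<^sub>R (c 0 - c t) = (1 / t) *\<^sub>R (c t - c 0)"
          by (simp add: algebra_simps)
        ultimately show ?thesis
          by (simp add: q_def c_def)
      qed
    qed
    moreover have "(q \<longlongrightarrow> (1 / t) *\<^sub>R (f (y + t *\<^sub>R u) - f y)) (at_right 0)"
    proof -
      have "((\<lambda>e. f (ye e)) \<longlongrightarrow> f y) (at_right 0)"
        "((\<lambda>e. f (ye e + t *\<^sub>R ue e)) \<longlongrightarrow> f (y + t *\<^sub>R u)) (at_right 0)"
        using lim_ye lim_end yS eventually_mono[OF small, of "\<lambda>e. ye e \<in> S"]
          eventually_mono[OF small, of "\<lambda>e. ye e + t *\<^sub>R ue e \<in> S"] int interior_subset[of S]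
        by (auto intro!: continuous_on_tendsto_compose[OF C1_onD(1)[OF C1]])
      then show ?thesis
        unfolding q_def by (intro tendsto_intros)
    qed
    ultimately show ?thesis
      using Lim_in_closed_set[of "closure C" q "at_right 0"] by simp
  qed
  \<comment> \<open>What holds in a neighbourhood of \<open>(x, v)\<close> holds near each point
    sufficiently close to \<open>(x, v)\<close>; this supplies the hypothesis of
    \<open>main\<close>.\<close>
  have ev1: "\<forall>\<^sub>F p in nhds (x, v). \<forall>\<^sub>F p in nhds p. P p \<and> snd p \<in> B"
    using PQ(1) B unfolding nhds_prod[symmetric] eventually_eventually by (rule eventually_conj)
  have lim2: "((\<lambda>z. (fst z, fst (snd z))) \<longlongrightarrow> (x, v)) (quotient_filter S x v)"
    by (intro tendsto_Pair tendsto_quotient_filter)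
  have lim3: "((\<lambda>z. snd (snd z)) \<longlongrightarrow> 0) (quotient_filter S x v)"
    and ev4: "\<forall>\<^sub>F z in quotient_filter S x v. snd (snd z) \<noteq> 0"
    using tendsto_quotient_filter(3)[of S x v] by (auto simp: filterlim_at)
  have "\<forall>\<^sub>F z in quotient_filter S x v. \<bar>snd (snd z)\<bar> < r"
    using tendstoD[OF lim3 r(1)] by (simp add: dist_real_def)
  with ev4 tendsto_quotient_filter(4)[of S x v]
    filterlim_iff[THEN iffD1, OF lim2, rule_format, OF ev1]
  show "\<forall>\<^sub>F z in quotient_filter S x v.
      (case z of (y, u, t) \<Rightarrow> (1 / t) *\<^sub>R (f (y + t *\<^sub>R u) - f y)) \<in> W"
    by eventually_elim (use main C(4) in \<open>auto simp: case_prod_unfold\<close>)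
qed

text \<open>As the step tends to 0, both ends of the segment tend to \<open>x\<close>, so only the
  part of \<open>S\<close> near \<open>x\<close> matters.\<close>

lemma strict_deriv_neighbourhood:
  fixes f :: "'a::locally_convex_space \<Rightarrow> 'b::locally_convex_space"
  assumes "strict_deriv f (S \<inter> U) x v d" "open U" "x \<in> U"
  shows "strict_deriv f S x v d"
proof -
  have "\<forall>\<^sub>F z in quotient_filter S x v. fst z \<in> U"
    by (rule topological_tendstoD[OF tendsto_quotient_filter(1) assms(2,3)])
  moreover have "\<forall>\<^sub>F z in quotient_filter S x v. fst z + snd (snd z) *\<^sub>R fst (snd z) \<in> U"
    by (rule topological_tendstoD[OF tendsto_quotient_filter_point assms(2,3)])
  ultimately have "\<forall>\<^sub>F z in quotient_filter S x v.
      fst z \<in> S \<inter> U \<and> fst z + snd (snd z) *\<^sub>R fst (snd z) \<in> S \<inter> U"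
    using tendsto_quotient_filter(4)[of S x v] by eventually_elim auto
  then show ?thesis
    unfolding strict_deriv_def case_prod_unfold
    by (intro strict_deriv_compose[OF assms(1)] tendsto_quotient_filter)
qed

lemma C1_on_strict_open:
  fixes f :: "'a::locally_convex_space \<Rightarrow> 'b::locally_convex_space"
  assumes "C1_on S f f'" "x \<in> interior S"
  shows "strict_deriv f UNIV x v (f' x v)"
proof -
  obtain C where C: "open C" "convex C" "x \<in> C" "C \<subseteq> interior S"
    using convex_open_neighbourhood[OF open_interior assms(2)] by metis
  have "strict_deriv f C x v (f' x v)"
    using C interior_subset by (intro C1_on_strict_convex C1_on_subset[OF assms(1)]) (auto simp: interior_open)
  then show ?thesis
    using strict_deriv_neighbourhood[of f UNIV C x v] C by simp
qed

lemma strict_deriv_imp_directional: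
  assumes "strict_deriv f UNIV x v d"
  shows "((\<lambda>t. (1 / t) *\<^sub>R (f (x + t *\<^sub>R v) - f x)) \<longlongrightarrow> d) (at 0)"
  by (rule strict_deriv_compose[OF assms]) (auto simp: filterlim_ident)

text \<open>The difference quotient \<open>q\<close> of \<open>c\<close> serves as moving direction
  for \<open>f\<close>: for nonzero t, the value of \<open>c\<close> at the end of the segment is
  exactly c y + t q. With a fixed direction an error term would remain.\<close>

lemma strict_deriv_chain:
  fixes c :: "'a::locally_convex_space \<Rightarrow> 'b::locally_convex_space" and f :: "'b \<Rightarrow> 'c::locally_convex_space"
  assumes c: "strict_deriv c S x v d" and f: "strict_deriv f T (c x) d d'"
    and cont: "continuous_on S c" "x \<in> S" and "c ` S \<subseteq> T"
  shows "strict_deriv (f \<circ> c) S x v d'"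
proof -
  let ?F = "quotient_filter S x v"
  define q where "q = (\<lambda>z. (1 / snd (snd z)) *\<^sub>R (c (fst z + snd (snd z) *\<^sub>R fst (snd z)) - c (fst z)))"
  have inS: "\<forall>\<^sub>F z in ?F. fst z \<in> S \<and> fst z + snd (snd z) *\<^sub>R fst (snd z) \<in> S"
    by (rule tendsto_quotient_filter)
  have nz: "\<forall>\<^sub>F z in ?F. snd (snd z) \<noteq> 0"
    using tendsto_quotient_filter(3)[of S x v] by (auto simp: filterlim_at)
  have eq: "\<forall>\<^sub>F z in ?F. c (fst z) + snd (snd z) *\<^sub>R q z = c (fst z + snd (snd z) *\<^sub>R fst (snd z))"
    using nz by eventually_elim (simp add: q_def)
  have "((\<lambda>z. (1 / snd (snd z)) *\<^sub>R (f (c (fst z) + snd (snd z) *\<^sub>R q z) - f (c (fst z)))) \<longlongrightarrow> d') ?F"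
  proof (rule strict_deriv_compose[OF f])
    show "((\<lambda>z. c (fst z)) \<longlongrightarrow> c x) ?F"
      using inS by (intro continuous_on_tendsto_compose[OF cont(1) tendsto_quotient_filter(1) cont(2)])
        (auto elim: eventually_mono)
    show "(q \<longlongrightarrow> d) ?F"
      using c by (simp add: strict_deriv_def q_def case_prod_unfold)
    show "filterlim (\<lambda>z. snd (snd z)) (at 0) ?F"
      by (rule tendsto_quotient_filter)
    show "\<forall>\<^sub>F z in ?F. c (fst z) \<in> T \<and> c (fst z) + snd (snd z) *\<^sub>R q z \<in> T"
      using inS eq by eventually_elim (use \<open>c ` S \<subseteq> T\<close> in auto)
  qed
  then show ?thesis
    unfolding strict_deriv_def case_prod_unfold o_def
    by (rule Lim_transform_eventually) (use eq in \<open>auto elim: eventually_mono\<close>)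
qed

text \<open>Some y of the interior lies near \<open>x\<close>, and with u = v every small t is
  admissible. This is what makes limits at boundary points unique.\<close>

lemma quotient_filter_nontrivial:
  fixes S :: "'a::locally_convex_space set"
  assumes "x \<in> closure (interior S)"
  shows "quotient_filter S x v \<noteq> bot"
proof
  assume "quotient_filter S x v = bot"
  then have "\<forall>\<^sub>F z in nhds x \<times>\<^sub>F nhds v \<times>\<^sub>F at 0. \<not> (fst z \<in> S \<and> fst z + snd (snd z) *\<^sub>R fst (snd z) \<in> S)"
    by (auto simp: quotient_filter_def eventually_inf_principal trivial_limit_def case_prod_unfold)
  then obtain P Q where P: "eventually P (nhds x)" "eventually Q (nhds v \<times>\<^sub>F at 0)"
    "\<And>y z. P y \<Longrightarrow> Q z \<Longrightarrow> \<not> (y \<in> S \<and> y + snd z *\<^sub>R fst z \<in> S)"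
    unfolding eventually_prod_filter[of _ "nhds x"] fst_conv snd_conv by blast
  obtain R T where R: "eventually R (nhds v)" "eventually T (at (0::real))"
    "\<And>u t. R u \<Longrightarrow> T t \<Longrightarrow> Q (u, t)"
    using P(2) unfolding eventually_prod_filter by auto
  obtain U where U: "open U" "x \<in> U" "\<And>y. y \<in> U \<Longrightarrow> P y"
    using P(1) unfolding eventually_nhds by blast
  obtain y where y: "y \<in> U" "y \<in> interior S"
    using assms U(1,2) by (meson closure_iff_nhds_not_empty disjoint_iff subset_refl)
  have "((\<lambda>t. y + t *\<^sub>R v) \<longlongrightarrow> y + 0 *\<^sub>R v) (at 0)"
    by (intro tendsto_intros)
  then have "\<forall>\<^sub>F t in at 0. y + t *\<^sub>R v \<in> interior S"
    by (rule topological_tendstoD) (use y in auto)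
  with R(2) have "\<forall>\<^sub>F t in at (0::real). T t \<and> y + t *\<^sub>R v \<in> interior S"
    by (rule eventually_conj)
  then obtain t where "T t" "y + t *\<^sub>R v \<in> interior S"
    by (metis (mono_tags, lifting) at_neq_bot eventually_happens')
  then show False
    using P(3)[OF U(3)[OF y(1)] R(3)[OF eventually_nhds_x_imp_x[OF R(1)]]] y interior_subset by auto
qed

lemma strict_deriv_unique:
  fixes f :: "'a::locally_convex_space \<Rightarrow> 'b::locally_convex_space"
  assumes "x \<in> closure (interior S)" "strict_deriv f S x v d" "strict_deriv f S x v d'"
  shows "d = d'"
  using tendsto_unique[OF quotient_filter_nontrivial[OF assms(1)]] assms(2,3)
  unfolding strict_deriv_def by blast

text \<open>Go first along \<open>v\<close>, then along \<open>u\<close> from the displaced point x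
  + t v; strictness allows the second base point to depend on t.\<close>

lemma strict_deriv_additive:
  fixes f :: "'a::locally_convex_space \<Rightarrow> 'b::locally_convex_space"
  assumes "strict_deriv f UNIV x v d" "strict_deriv f UNIV x u d'" "strict_deriv f UNIV x (v + u) d''"
  shows "d'' = d + d'"
proof -
  have l: "((\<lambda>t. x + t *\<^sub>R v) \<longlongrightarrow> x + 0 *\<^sub>R v) (at 0)"
    by (intro tendsto_intros)
  have "((\<lambda>t. (1 / t) *\<^sub>R (f ((x + t *\<^sub>R v) + t *\<^sub>R u) - f (x + t *\<^sub>R v))) \<longlongrightarrow> d') (at 0)"
    using l by (intro strict_deriv_compose[OF assms(2)]) (auto simp: filterlim_ident)
  from tendsto_add[OF strict_deriv_imp_directional[OF assms(1)] this]
  have "((\<lambda>t. (1 / t) *\<^sub>R (f (x + t *\<^sub>R (v + u)) - f x)) \<longlongrightarrow> d + d') (at 0)"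
    by (simp add: scaleR_right_distrib[symmetric] add.assoc)
  with strict_deriv_imp_directional[OF assms(3)] show ?thesis
    using tendsto_unique[OF at_neq_bot] by blast
qed

lemma strict_deriv_scaleR:
  fixes f :: "'a::locally_convex_space \<Rightarrow> 'b::locally_convex_space"
  assumes "strict_deriv f UNIV x v d" "strict_deriv f UNIV x (k *\<^sub>R v) d'"
  shows "d' = k *\<^sub>R d"
proof (cases "k = 0")
  case True
  have "((\<lambda>t. (1 / t) *\<^sub>R (f (x + t *\<^sub>R (k *\<^sub>R v)) - f x)) \<longlongrightarrow> 0) (at 0)"
    using True by simp
  then show ?thesis
    using tendsto_unique[OF at_neq_bot strict_deriv_imp_directional[OF assms(2)]] True by simp
next
  case False
  have "((\<lambda>t. t * k) \<longlongrightarrow> 0 * k) (at 0)"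
    by (intro tendsto_intros)
  then have "filterlim (\<lambda>t. t * k) (at 0) (at 0)"
    using False by (auto simp: filterlim_at eventually_at_filter)
  then have "((\<lambda>t. (1 / (t * k)) *\<^sub>R (f (x + (t * k) *\<^sub>R v) - f x)) \<longlongrightarrow> d) (at 0)"
    by (intro strict_deriv_compose[OF assms(1)]) auto
  then have "((\<lambda>t. k *\<^sub>R (1 / (t * k)) *\<^sub>R (f (x + (t * k) *\<^sub>R v) - f x)) \<longlongrightarrow> k *\<^sub>R d) (at 0)"
    by (intro tendsto_intros)
  then have "((\<lambda>t. (1 / t) *\<^sub>R (f (x + t *\<^sub>R (k *\<^sub>R v)) - f x)) \<longlongrightarrow> k *\<^sub>R d) (at 0)"
    using False by simp
  then show ?thesis
    using tendsto_unique[OF at_neq_bot strict_deriv_imp_directional[OF assms(2)]] by blast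
qed

lemma C1_on_linear:
  fixes f :: "'a::locally_convex_space \<Rightarrow> 'b::locally_convex_space"
  assumes "C1_on S f f'" "x \<in> interior S"
  shows "linear (f' x)"
  using C1_on_strict_open[OF assms] strict_deriv_additive strict_deriv_scaleR
  by (intro linearI) blast+

text \<open>The outer set is open so that \<open>f\<close> has an unconstrained strict derivative at
  \<open>c x\<close>; \<open>S\<close> can be arbitrary because quotients are demanded in its
  interior only.\<close>

lemma C1_on_compose:
  fixes c :: "'a::locally_convex_space \<Rightarrow> 'b::locally_convex_space" and f :: "'b \<Rightarrow> 'c::locally_convex_space"
  assumes c: "C1_on S c c'" and f: "C1_on T f f'" and T: "open T" "c ` S \<subseteq> T"
  shows "C1_on S (\<lambda>x. f (c x)) (\<lambda>x v. f' (c x) (c' x v))"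
  unfolding C1_on_def
proof (intro conjI ballI allI)
  show "continuous_on S (\<lambda>x. f (c x))"
    by (rule continuous_on_compose2[OF C1_onD(1)[OF f] C1_onD(1)[OF c] T(2)])
  have "continuous_on (S \<times> UNIV) (\<lambda>z. (\<lambda>(x, v). f' x v) (c (fst z), (\<lambda>(x, v). c' x v) z))"
    using T(2)
    by (intro continuous_on_compose2[OF C1_onD(2)[OF f]] continuous_on_Pair C1_onD(2)[OF c]
        continuous_on_compose2[OF C1_onD(1)[OF c]] continuous_intros) auto
  then show "continuous_on (S \<times> UNIV) (\<lambda>(x, v). f' (c x) (c' x v))"
    by (simp add: case_prod_unfold)
next
  fix x v assume x: "x \<in> interior S"
  have x': "x \<in> S"
    using x interior_subset by blast
  have "strict_deriv (f \<circ> c) (interior S) x v (f' (c x) (c' x v))"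
  proof (rule strict_deriv_chain)
    show "strict_deriv c (interior S) x v (c' x v)"
      using strict_deriv_subset[OF C1_on_strict_open[OF c x]] by blast
    show "strict_deriv f UNIV (c x) (c' x v) (f' (c x) (c' x v))"
      using T x' by (intro C1_on_strict_open[OF f]) (auto simp: interior_open)
    show "continuous_on (interior S) c"
      using C1_onD(1)[OF c] interior_subset continuous_on_subset by blast
  qed (use x in auto)
  then have "strict_deriv (f \<circ> c) UNIV x v (f' (c x) (c' x v))"
    using strict_deriv_neighbourhood[of "f \<circ> c" UNIV "interior S"] x by simp
  then show "((\<lambda>t. (1 / t) *\<^sub>R (f (c (x + t *\<^sub>R v)) - f (c x))) \<longlongrightarrow> f' (c x) (c' x v)) (at 0)"
    using strict_deriv_imp_directional by fastforce
qed

lemma C1_on_Pair: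
  fixes f :: "'a::locally_convex_space \<Rightarrow> 'b::locally_convex_space" and g :: "'a \<Rightarrow> 'c::locally_convex_space"
  assumes f: "C1_on S f f'" and g: "C1_on S g g'"
  shows "C1_on S (\<lambda>x. (f x, g x)) (\<lambda>x v. (f' x v, g' x v))"
  unfolding C1_on_def
proof (intro conjI ballI allI)
  show "continuous_on S (\<lambda>x. (f x, g x))"
    using C1_onD(1)[OF f] C1_onD(1)[OF g] by (rule continuous_on_Pair)
  show "continuous_on (S \<times> UNIV) (\<lambda>(x, v). (f' x v, g' x v))"
    using continuous_on_Pair[OF C1_onD(2)[OF f] C1_onD(2)[OF g]] by (simp add: case_prod_unfold)
next
  fix x v assume x: "x \<in> interior S"
  show "((\<lambda>t. (1 / t) *\<^sub>R ((f (x + t *\<^sub>R v), g (x + t *\<^sub>R v)) - (f x, g x))) \<longlongrightarrow> (f' x v, g' x v)) (at 0)"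
    using tendsto_Pair[OF C1_onD(3)[OF f x] C1_onD(3)[OF g x]] by simp
qed

lemma C1_on_linear_map:
  fixes f :: "'a::locally_convex_space \<Rightarrow> 'b::locally_convex_space"
  assumes "linear f" "continuous_on UNIV f"
  shows "C1_on S f (\<lambda>x v. f v)"
  unfolding C1_on_def
proof (intro conjI ballI allI)
  show "continuous_on S f"
    using assms(2) continuous_on_subset by blast
  show "continuous_on (S \<times> UNIV) (\<lambda>(x, v). f v)"
    unfolding case_prod_unfold by (intro continuous_on_compose2[OF assms(2)] continuous_intros) auto
next
  fix x v
  have "(1 / t) *\<^sub>R (f (x + t *\<^sub>R v) - f x) = f v" if "t \<noteq> 0" for t
    using that by (simp add: linear_add[OF assms(1)] linear_scale[OF assms(1)])
  then show "((\<lambda>t. (1 / t) *\<^sub>R (f (x + t *\<^sub>R v) - f x)) \<longlongrightarrow> f v) (at 0)"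
    by (intro tendsto_eventually) (auto simp: eventually_at_filter)
qed

lemma C1_on_const:
  fixes k :: "'b::locally_convex_space"
  shows "C1_on S (\<lambda>x::'a::locally_convex_space. k) (\<lambda>x v. 0)"
  by (auto simp: C1_on_def)

lemma C1_on_fst:
  fixes S :: "('a::locally_convex_space \<times> 'b::locally_convex_space) set"
  shows "C1_on S fst (\<lambda>x. fst)"
  by (rule C1_on_linear_map) (auto intro: linearI continuous_intros)

lemma C1_on_snd:
  fixes S :: "('a::locally_convex_space \<times> 'b::locally_convex_space) set"
  shows "C1_on S snd (\<lambda>x. snd)"
  by (rule C1_on_linear_map) (auto intro: linearI continuous_intros)

lemma C1_on_ident:
  fixes S :: "'a::locally_convex_space set"
  shows "C1_on S (\<lambda>x. x) (\<lambda>x v. v)"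
  by (rule C1_on_linear_map) (auto intro: linearI continuous_intros)

section \<open>Second derivatives and their symmetry\<close>

text \<open>
  The map \<open>f2\<close> is the derivative of \<open>(x, v) \<mapsto> Df(x) v\<close> in both arguments, so that
  \<open>f2 (x, v) (y, z) = D\<^sup>2f(x)(v, y) + Df(x) z\<close>.
\<close>

definition C2_on ::
  "'a::locally_convex_space set \<Rightarrow> ('a \<Rightarrow> 'b::locally_convex_space) \<Rightarrow> ('a \<Rightarrow> 'a \<Rightarrow> 'b) \<Rightarrow>
    ('a \<times> 'a \<Rightarrow> 'a \<times> 'a \<Rightarrow> 'b) \<Rightarrow> bool" where
  "C2_on S f f1 f2 \<longleftrightarrow> C1_on S f f1 \<and> C1_on (S \<times> UNIV) (\<lambda>(x, v). f1 x v) f2"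

lemma C2_onD:
  assumes "C2_on S f f1 f2"
  shows "C1_on S f f1" "C1_on (S \<times> UNIV) (\<lambda>(x, v). f1 x v) f2"
  using assms by (auto simp: C2_on_def)

lemma C2_on_subset: "C2_on S f f1 f2 \<Longrightarrow> T \<subseteq> S \<Longrightarrow> C2_on T f f1 f2"
  unfolding C2_on_def by (meson C1_on_subset Sigma_mono order_refl)

lemma interior_directional_eventually:
  fixes x :: "'a::locally_convex_space"
  assumes "x \<in> interior S"
  shows "\<forall>\<^sub>F t in at 0. x + t *\<^sub>R v \<in> interior S"
proof -
  have "((\<lambda>t. x + t *\<^sub>R v) \<longlongrightarrow> x + 0 *\<^sub>R v) (at 0)"
    by (intro tendsto_intros)
  then show ?thesis
    by (rule topological_tendstoD) (use assms in auto)
qed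

text \<open>The sequences in \<open>smooth_on\<close> list the directions of successive derivatives.
  A constant sequence yields the first derivative, and v, y, y, ... yields the second; the later
  entries are fillers.\<close>

lemma smooth_on_imp_C2_on:
  fixes f :: "'a::locally_convex_space \<Rightarrow> 'b::locally_convex_space"
  assumes "smooth_on S f"
  obtains f1 f2 where "C2_on S f f1 f2"
proof -
  obtain g :: "nat \<Rightarrow> 'a \<times> (nat \<Rightarrow> 'a) \<Rightarrow> 'b" where
    g0: "\<And>x v. x \<in> S \<Longrightarrow> g 0 (x, v) = f x" and
    cont: "\<And>k. continuous_on (S \<times> UNIV) (g k)" and
    deriv: "\<And>k x v. x \<in> interior S \<Longrightarrow>
        ((\<lambda>t. (1 / t) *\<^sub>R (g k (x + t *\<^sub>R v k, v) - g k (x, v))) \<longlongrightarrow> g (Suc k) (x, v)) (at 0)"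
    using assms unfolding smooth_on_def by blast
  define f1 where "f1 x v = g 1 (x, \<lambda>_. v)" for x v
  define f2 where "f2 = (\<lambda>(x, v) (y, z). g 2 (x, \<lambda>i. if i = 0 then v else y) + f1 x z)"
  have int: "x \<in> S" if "x \<in> interior S" for x
    using that interior_subset by blast
  have d1: "((\<lambda>t. (1 / t) *\<^sub>R (f (x + t *\<^sub>R s 0) - f x)) \<longlongrightarrow> g 1 (x, s)) (at 0)"
    if x: "x \<in> interior S" for x s
  proof (rule Lim_transform_eventually)
    show "((\<lambda>t. (1 / t) *\<^sub>R (g 0 (x + t *\<^sub>R s 0, s) - g 0 (x, s))) \<longlongrightarrow> g 1 (x, s)) (at 0)"
      using deriv[OF x, where k = 0] by simp
    show "\<forall>\<^sub>F t in at 0. (1 / t) *\<^sub>R (g 0 (x + t *\<^sub>R s 0, s) - g 0 (x, s)) =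
        (1 / t) *\<^sub>R (f (x + t *\<^sub>R s 0) - f x)"
      using interior_directional_eventually[OF x, of "s 0"]
      by eventually_elim (simp add: g0 int x)
  qed
  \<comment> \<open>\<open>smooth_on\<close> does not state that \<open>g 1\<close> depends on the
    first direction alone; in the interior, uniqueness of the limit forces it.\<close>
  have g1: "g 1 (x, s) = f1 x (s 0)" if "x \<in> interior S" for x s
    using tendsto_unique[OF at_neq_bot d1[OF that, of s] d1[OF that, of "\<lambda>_. s 0"]]
    by (simp add: f1_def)
  have C1: "C1_on S f f1"
    unfolding C1_on_def
  proof (intro conjI ballI allI)
    have "continuous_on S (\<lambda>x. g 0 (x, \<lambda>_. 0))"
      by (intro continuous_on_compose2[OF cont] continuous_intros) auto
    then show "continuous_on S f"
      by (simp add: g0 cong: continuous_on_cong)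
    have "continuous_on (S \<times> UNIV) (\<lambda>z::'a \<times> 'a. g 1 (fst z, \<lambda>_. snd z))"
      by (intro continuous_on_compose2[OF cont] continuous_intros
          continuous_on_coordinatewise_then_product) auto
    then show "continuous_on (S \<times> UNIV) (\<lambda>(x, v). f1 x v)"
      by (simp add: f1_def case_prod_unfold)
  next
    fix x v assume "x \<in> interior S"
    from d1[OF this, of "\<lambda>_. v"]
    show "((\<lambda>t. (1 / t) *\<^sub>R (f (x + t *\<^sub>R v) - f x)) \<longlongrightarrow> f1 x v) (at 0)"
      by (simp add: f1_def)
  qed
  have "C1_on (S \<times> UNIV) (\<lambda>(x, v). f1 x v) f2"
    unfolding C1_on_def
  proof (intro conjI ballI allI)
    show "continuous_on (S \<times> UNIV) (\<lambda>(x, v). f1 x v)"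
      by (rule C1_onD[OF C1])
    have "continuous_on ((S \<times> UNIV) \<times> UNIV)
        (\<lambda>z::('a \<times> 'a) \<times> 'a \<times> 'a. g 2 (fst (fst z), \<lambda>i. if i = 0 then snd (fst z) else fst (snd z)))"
    proof (intro continuous_on_compose2[OF cont] continuous_on_Pair
          continuous_on_coordinatewise_then_product)
      fix i :: nat
      show "continuous_on ((S \<times> UNIV) \<times> UNIV)
        (\<lambda>z::('a \<times> 'a) \<times> 'a \<times> 'a. if i = 0 then snd (fst z) else fst (snd z))"
        by (cases "i = 0") (auto intro!: continuous_intros)
    qed (auto intro!: continuous_intros)
    moreover have "continuous_on ((S \<times> UNIV) \<times> UNIV)
        (\<lambda>z::('a \<times> 'a) \<times> 'a \<times> 'a. (\<lambda>(x, v). f1 x v) (fst (fst z), snd (snd z)))"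
      by (intro continuous_on_compose2[OF C1_onD(2)[OF C1]] continuous_intros) auto
    ultimately show "continuous_on ((S \<times> UNIV) \<times> UNIV) (\<lambda>(p, q). f2 p q)"
      using continuous_on_add_tma by (fastforce simp: f2_def case_prod_unfold)
  next
    fix p q :: "'a \<times> 'a"
    obtain x v y z where pq: "p = (x, v)" "q = (y, z)"
      by fastforce
    assume "p \<in> interior (S \<times> UNIV)"
    then have x: "x \<in> interior S"
      by (simp add: pq interior_Times)
    define s :: "nat \<Rightarrow> 'a" where "s = (\<lambda>i. if i = 0 then v else y)"
    have ev: "\<forall>\<^sub>F t in at 0. x + t *\<^sub>R y \<in> interior S"
      by (rule interior_directional_eventually[OF x])
    have "((\<lambda>t. (1 / t) *\<^sub>R (g 1 (x + t *\<^sub>R y, s) - g 1 (x, s))) \<longlongrightarrow> g 2 (x, s)) (at 0)"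
      using deriv[OF x, where k = 1 and v = s] by (simp add: s_def numeral_2_eq_2)
    moreover have "((\<lambda>t. f1 (x + t *\<^sub>R y) z) \<longlongrightarrow> f1 x z) (at 0)"
    proof -
      have "((\<lambda>t. (x + t *\<^sub>R y, z)) \<longlongrightarrow> (x + 0 *\<^sub>R y, z)) (at 0)"
        by (intro tendsto_intros)
      then have "((\<lambda>t. (\<lambda>(x, v). f1 x v) (x + t *\<^sub>R y, z)) \<longlongrightarrow> (\<lambda>(x, v). f1 x v) (x, z)) (at 0)"
        using ev x int
        by (intro continuous_on_tendsto_compose[OF C1_onD(2)[OF C1]]) (auto elim: eventually_mono)
      then show ?thesis
        by simp
    qed
    ultimately have "((\<lambda>t. (1 / t) *\<^sub>R (g 1 (x + t *\<^sub>R y, s) - g 1 (x, s)) + f1 (x + t *\<^sub>R y) z)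
        \<longlongrightarrow> f2 p q) (at 0)"
      unfolding f2_def pq by (auto simp: s_def intro: tendsto_add)
    then show "((\<lambda>t. (1 / t) *\<^sub>R ((case p + t *\<^sub>R q of (x, v) \<Rightarrow> f1 x v) - (case p of (x, v) \<Rightarrow> f1 x v)))
        \<longlongrightarrow> f2 p q) (at 0)"
    proof (rule Lim_transform_eventually)
      have "\<forall>\<^sub>F t in at (0::real). t \<noteq> 0"
        by (auto simp: eventually_at_filter)
      with ev show "\<forall>\<^sub>F t in at 0. (1 / t) *\<^sub>R (g 1 (x + t *\<^sub>R y, s) - g 1 (x, s)) + f1 (x + t *\<^sub>R y) z =
          (1 / t) *\<^sub>R ((case p + t *\<^sub>R q of (x, v) \<Rightarrow> f1 x v) - (case p of (x, v) \<Rightarrow> f1 x v))"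
      proof eventually_elim
        case (elim t)
        \<comment> \<open>Linearity splits f1 (x + t y) (v + t z) into the value at v and t times
          the value at z; the latter produces the summand \<open>f1 x z\<close> of
          \<open>f2\<close>.\<close>
        interpret linear "f1 (x + t *\<^sub>R y)"
          by (rule C1_on_linear[OF C1 elim(1)])
        show ?case
          using elim x by (simp add: g1[unfolded One_nat_def] pq s_def add scaleR scaleR_right_diff_distrib scaleR_right_distrib)
      qed
    qed
  qed
  with C1 show ?thesis
    by (intro that) (auto simp: C2_on_def)
qed

text \<open>Not an instance of \<open>C1_on_compose\<close>, which wants an open outer set: here
  \<open>S\<close> may have boundary points.\<close>

lemma C1_on_compose_fst:
  fixes f :: "'a::locally_convex_space \<Rightarrow> 'b::locally_convex_space"
  assumes f: "C1_on S f f'"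
  shows "C1_on (S \<times> (UNIV :: 'c::locally_convex_space set)) (\<lambda>z. f (fst z)) (\<lambda>z w. f' (fst z) (fst w))"
  unfolding C1_on_def
proof (intro conjI ballI allI)
  show "continuous_on (S \<times> (UNIV :: 'c set)) (\<lambda>z. f (fst z))"
    by (intro continuous_on_compose2[OF C1_onD(1)[OF f]] continuous_intros) auto
  have "continuous_on ((S \<times> (UNIV :: 'c set)) \<times> UNIV)
      (\<lambda>z::('a \<times> 'c) \<times> 'a \<times> 'c. (\<lambda>(x, v). f' x v) (fst (fst z), fst (snd z)))"
    by (intro continuous_on_compose2[OF C1_onD(2)[OF f]] continuous_intros) auto
  then show "continuous_on ((S \<times> (UNIV :: 'c set)) \<times> UNIV) (\<lambda>(z::'a \<times> 'c, w::'a \<times> 'c). f' (fst z) (fst w))"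
    by (simp add: case_prod_unfold)
next
  fix z w :: "'a \<times> 'c" assume "z \<in> interior (S \<times> UNIV)"
  then show "((\<lambda>t. (1 / t) *\<^sub>R (f (fst (z + t *\<^sub>R w)) - f (fst z))) \<longlongrightarrow> f' (fst z) (fst w)) (at 0)"
    using C1_onD(3)[OF f, of "fst z" "fst w"] by (auto simp: interior_Times mem_Times_iff)
qed

text \<open>This is the first-order chain rule for the tangent map (x, v) \<mapsto> (c x, c1 x v)
  followed by (x, v) \<mapsto> f1 x v.\<close>

lemma C2_on_compose:
  fixes c :: "'a::locally_convex_space \<Rightarrow> 'b::locally_convex_space" and f :: "'b \<Rightarrow> 'c::locally_convex_space"
  assumes c: "C2_on S c c1 c2" and f: "C2_on T f f1 f2" and T: "open T" "c ` S \<subseteq> T"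
  shows "C2_on S (\<lambda>x. f (c x)) (\<lambda>x v. f1 (c x) (c1 x v))
    (\<lambda>p q. f2 (c (fst p), c1 (fst p) (snd p)) (c1 (fst p) (fst q), c2 p q))"
  unfolding C2_on_def
proof
  show "C1_on S (\<lambda>x. f (c x)) (\<lambda>x v. f1 (c x) (c1 x v))"
    by (rule C1_on_compose[OF C2_onD(1)[OF c] C2_onD(1)[OF f] T])
  have "C1_on (S \<times> UNIV) (\<lambda>p::'a \<times> 'a. (c (fst p), (\<lambda>(x, v). c1 x v) p)) (\<lambda>p q. (c1 (fst p) (fst q), c2 p q))"
    by (intro C1_on_Pair C1_on_compose_fst C2_onD[OF c])
  moreover have "(\<lambda>p. (c (fst p), (\<lambda>(x, v). c1 x v) p)) ` (S \<times> UNIV) \<subseteq> T \<times> UNIV"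
    using T(2) by auto
  ultimately have "C1_on (S \<times> UNIV) (\<lambda>p. (\<lambda>(x, v). f1 x v) (c (fst p), (\<lambda>(x, v). c1 x v) p))
      (\<lambda>p q. f2 (c (fst p), (\<lambda>(x, v). c1 x v) p) (c1 (fst p) (fst q), c2 p q))"
    by (rule C1_on_compose[OF _ C2_onD(2)[OF f] open_Times[OF T(1) open_UNIV]])
  then show "C1_on (S \<times> UNIV) (\<lambda>(x, v). f1 (c x) (c1 x v))
      (\<lambda>p q. f2 (c (fst p), c1 (fst p) (snd p)) (c1 (fst p) (fst q), c2 p q))"
    by (simp add: case_prod_unfold)
qed

text \<open>One half of Schwarz's theorem. As a function of s along \<open>u\<close>, the quotient
  of \<open>f\<close> in direction \<open>v\<close> has as its derivative the quotient of
  \<open>f1\<close> at the vector \<open>u\<close> in direction \<open>v\<close>. The latter lies in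
  \<open>C\<close> along the whole short segment, because the derivative of \<open>f1\<close> is
  strict, and the mean value theorem applies.\<close>

lemma C2_on_second_difference:
  fixes f :: "'a::locally_convex_space \<Rightarrow> 'b::locally_convex_space"
  assumes f: "C2_on S f f1 f2" and x: "x \<in> interior S"
  shows "((\<lambda>t. (1 / t) *\<^sub>R (1 / t) *\<^sub>R
      (f (x + t *\<^sub>R u + t *\<^sub>R v) - f (x + t *\<^sub>R u) - f (x + t *\<^sub>R v) + f x)) \<longlongrightarrow> f2 (x, u) (v, 0)) (at_right 0)"
proof (rule topological_tendstoI)
  fix W assume W: "open W" "f2 (x, u) (v, 0) \<in> W"
  obtain C where C: "open C" "convex C" "f2 (x, u) (v, 0) \<in> C" "closure C \<subseteq> W"
    using convex_closed_neighbourhood[OF W] by metis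
  have "strict_deriv (\<lambda>(x, v). f1 x v) UNIV (x, u) (v, 0) (f2 (x, u) (v, 0))"
    using x by (intro C1_on_strict_open[OF C2_onD(2)[OF f]]) (auto simp: interior_Times)
  from topological_tendstoD[OF this[unfolded strict_deriv_def] C(1,3)]
  have "\<forall>\<^sub>F z in nhds (x, u) \<times>\<^sub>F nhds (v, 0) \<times>\<^sub>F at 0.
      (1 / snd (snd z)) *\<^sub>R ((\<lambda>(x, v). f1 x v) (fst z + snd (snd z) *\<^sub>R fst (snd z)) - (\<lambda>(x, v). f1 x v) (fst z)) \<in> C"
    by (simp add: quotient_filter_def eventually_inf_principal case_prod_unfold)
  then obtain P Q where P: "eventually P (nhds (x, u))" "eventually Q (nhds (v, 0) \<times>\<^sub>F at 0)"
    "\<And>y z. P y \<Longrightarrow> Q z \<Longrightarrow>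
      (1 / snd z) *\<^sub>R ((\<lambda>(x, v). f1 x v) (y + snd z *\<^sub>R fst z) - (\<lambda>(x, v). f1 x v) y) \<in> C"
    unfolding eventually_prod_filter[of _ "nhds (x, u)"] fst_conv snd_conv by blast
  obtain R T where R: "eventually R (nhds (v, 0::'a))" "eventually T (at (0::real))"
    "\<And>u t. R u \<Longrightarrow> T t \<Longrightarrow> Q (u, t)"
    using P(2) unfolding eventually_prod_filter by auto
  have inC: "(1 / t) *\<^sub>R (f1 (y + t *\<^sub>R v) u - f1 y u) \<in> C" if "P (y, u)" "T t" for y t
    using P(3)[OF that(1) R(3)[OF eventually_nhds_x_imp_x[OF R(1)] that(2)]] by simp
  have lim: "((\<lambda>z::real \<times> real. x + fst z *\<^sub>R u + snd z *\<^sub>R v) \<longlongrightarrow> x + 0 *\<^sub>R u + 0 *\<^sub>R v) (nhds 0 \<times>\<^sub>F nhds 0)"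
    by (intro tendsto_intros filterlim_fst filterlim_snd)
  have "\<forall>\<^sub>F z in nhds 0 \<times>\<^sub>F nhds (0::real). x + fst z *\<^sub>R u + snd z *\<^sub>R v \<in> interior S"
    by (rule topological_tendstoD[OF lim]) (use x in auto)
  then obtain A B where A: "eventually A (nhds 0)" "eventually B (nhds (0::real))"
    "\<And>s t. A s \<Longrightarrow> B t \<Longrightarrow> x + s *\<^sub>R u + t *\<^sub>R v \<in> interior S"
    unfolding eventually_prod_filter by auto
  obtain a where a: "a > 0" "\<And>t. \<bar>t\<bar> < a \<Longrightarrow> A t"
    using A(1) unfolding eventually_nhds_metric by (auto simp: dist_real_def)
  obtain b where b: "b > 0" "\<And>t. \<bar>t\<bar> < b \<Longrightarrow> B t"
    using A(2) unfolding eventually_nhds_metric by (auto simp: dist_real_def)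
  have lim2: "((\<lambda>s. (x + s *\<^sub>R u, u)) \<longlongrightarrow> (x + 0 *\<^sub>R u, u)) (nhds 0)"
    by (intro tendsto_intros filterlim_ident)
  then have "\<forall>\<^sub>F s in nhds 0. P (x + s *\<^sub>R u, u)"
    using P(1) by (simp add: filterlim_iff)
  then obtain d where d: "d > 0" "\<And>s. \<bar>s\<bar> < d \<Longrightarrow> P (x + s *\<^sub>R u, u)"
    unfolding eventually_nhds_metric by (auto simp: dist_real_def)
  have "eventually T (at_right 0)"
    using R(2) by (simp add: eventually_at_split)
  moreover have "\<forall>\<^sub>F t in at_right (0::real). 0 < t \<and> t < Min {a, b, d}"
    using a b d unfolding eventually_at_right_field by (intro exI[of _ "Min {a, b, d}"]) auto
  ultimately show "\<forall>\<^sub>F t in at_right 0. (1 / t) *\<^sub>R (1 / t) *\<^sub>R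
      (f (x + t *\<^sub>R u + t *\<^sub>R v) - f (x + t *\<^sub>R u) - f (x + t *\<^sub>R v) + f x) \<in> W"
  proof eventually_elim
    case (elim t)
    then have t: "0 < t" "t < a" "t < b" "t < d" "T t"
      by auto
    define c where "c s = (1 / t) *\<^sub>R (f (x + t *\<^sub>R v + s *\<^sub>R u) - f (x + s *\<^sub>R u))" for s
    have int1: "x + t *\<^sub>R v + s *\<^sub>R u \<in> interior S" and int2: "x + s *\<^sub>R u \<in> interior S"
      if "0 \<le> s" "s \<le> t" for s
      using A(3)[of s t] A(3)[of s 0] a(2)[of s] b(2)[of t] b(2)[of 0] b(1) that t
      by (simp_all add: algebra_simps)
    have "(1 / (t - 0)) *\<^sub>R (c t - c 0) \<in> closure C"
    proof (rule mean_value_convex)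
      show "continuous_on {0..t} c"
        unfolding c_def
        by (intro continuous_intros continuous_on_compose2[OF C1_onD(1)[OF C2_onD(1)[OF f]]] continuous_on_add_tma continuous_on_diff_tga)
          (use subsetD[OF interior_subset int1] subsetD[OF interior_subset int2] in auto)
      fix s assume s: "0 < s" "s < t"
      have "((\<lambda>h. (1 / t) *\<^sub>R
          ((1 / h) *\<^sub>R (f (x + t *\<^sub>R v + s *\<^sub>R u + h *\<^sub>R u) - f (x + t *\<^sub>R v + s *\<^sub>R u)) -
           (1 / h) *\<^sub>R (f (x + s *\<^sub>R u + h *\<^sub>R u) - f (x + s *\<^sub>R u))))
          \<longlongrightarrow> (1 / t) *\<^sub>R (f1 (x + t *\<^sub>R v + s *\<^sub>R u) u - f1 (x + s *\<^sub>R u) u)) (at 0)"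
        using s int1[of s] int2[of s]
        by (intro tendsto_intros C1_onD(3)[OF C2_onD(1)[OF f]]) auto
      then show "((\<lambda>h. (1 / h) *\<^sub>R (c (s + h) - c s)) \<longlongrightarrow>
          (1 / t) *\<^sub>R (f1 (x + s *\<^sub>R u + t *\<^sub>R v) u - f1 (x + s *\<^sub>R u) u)) (at 0)"
        by (simp add: c_def algebra_simps)
      show "(1 / t) *\<^sub>R (f1 (x + s *\<^sub>R u + t *\<^sub>R v) u - f1 (x + s *\<^sub>R u) u) \<in> C"
        using s t by (intro inC d) auto
    qed (use t C in auto)
    then show ?case
      using C(4) by (auto simp: c_def algebra_simps)
  qed
qed

text \<open>The second difference does not change when \<open>u\<close> and \<open>v\<close> are
  exchanged, so both values are limits of the same expression.\<close>

lemma C2_on_symmetric: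
  fixes f :: "'a::locally_convex_space \<Rightarrow> 'b::locally_convex_space"
  assumes f: "C2_on S f f1 f2" and x: "x \<in> interior S"
  shows "f2 (x, u) (v, 0) = f2 (x, v) (u, 0)"
proof (rule tendsto_unique)
  show "((\<lambda>t. (1 / t) *\<^sub>R (1 / t) *\<^sub>R
      (f (x + t *\<^sub>R u + t *\<^sub>R v) - f (x + t *\<^sub>R u) - f (x + t *\<^sub>R v) + f x)) \<longlongrightarrow> f2 (x, u) (v, 0)) (at_right 0)"
    by (rule C2_on_second_difference[OF f x])
  show "((\<lambda>t. (1 / t) *\<^sub>R (1 / t) *\<^sub>R
      (f (x + t *\<^sub>R u + t *\<^sub>R v) - f (x + t *\<^sub>R u) - f (x + t *\<^sub>R v) + f x)) \<longlongrightarrow> f2 (x, v) (u, 0)) (at_right 0)"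
    using C2_on_second_difference[OF f x, of v u]
    by (simp add: algebra_simps)
qed simp

section \<open>Uniqueness and locality of derivatives\<close>

lemma C1_on_unique:
  fixes f :: "'a::locally_convex_space \<Rightarrow> 'b::locally_convex_space"
  assumes f: "C1_on S f f'" and g: "C1_on T g g'" and U: "open U" "U \<subseteq> S" "U \<subseteq> T" "x \<in> U"
    and eq: "\<And>y. y \<in> U \<Longrightarrow> f y = g y"
  shows "f' x v = g' x v"
proof (rule tendsto_unique[OF at_neq_bot])
  show "((\<lambda>t. (1 / t) *\<^sub>R (f (x + t *\<^sub>R v) - f x)) \<longlongrightarrow> f' x v) (at 0)"
    using U by (intro C1_onD(3)[OF f]) (auto intro: interiorI)
  have "((\<lambda>t. (1 / t) *\<^sub>R (g (x + t *\<^sub>R v) - g x)) \<longlongrightarrow> g' x v) (at 0)"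
    using U by (intro C1_onD(3)[OF g]) (auto intro: interiorI)
  then show "((\<lambda>t. (1 / t) *\<^sub>R (f (x + t *\<^sub>R v) - f x)) \<longlongrightarrow> g' x v) (at 0)"
  proof (rule Lim_transform_eventually)
    show "\<forall>\<^sub>F t in at 0. (1 / t) *\<^sub>R (g (x + t *\<^sub>R v) - g x) = (1 / t) *\<^sub>R (f (x + t *\<^sub>R v) - f x)"
      using interior_directional_eventually[of x U v] U eq
      by (auto simp: interior_open elim: eventually_mono)
  qed
qed

lemma C1_on_cong:
  assumes "C1_on S f f'" "\<And>x. x \<in> S \<Longrightarrow> f x = g x"
  shows "C1_on S (g :: 'a::locally_convex_space \<Rightarrow> 'b::locally_convex_space) f'"
  unfolding C1_on_def
proof (intro conjI ballI allI)
  show "continuous_on S g"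
    using C1_onD(1)[OF assms(1)] assms(2) by (simp cong: continuous_on_cong)
  show "continuous_on (S \<times> UNIV) (\<lambda>(x, v). f' x v)"
    by (rule C1_onD[OF assms(1)])
  fix x v assume x: "x \<in> interior S"
  show "((\<lambda>t. (1 / t) *\<^sub>R (g (x + t *\<^sub>R v) - g x)) \<longlongrightarrow> f' x v) (at 0)"
  proof (rule Lim_transform_eventually[OF C1_onD(3)[OF assms(1) x, of v]])
    show "\<forall>\<^sub>F t in at 0. (1 / t) *\<^sub>R (f (x + t *\<^sub>R v) - f x) = (1 / t) *\<^sub>R (g (x + t *\<^sub>R v) - g x)"
      using interior_directional_eventually[OF x, of v]
      by eventually_elim (simp add: assms(2) subsetD[OF interior_subset] x)
  qed
qed

lemma C1_on_cong_deriv: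
  assumes "C1_on S f f'" "\<And>x v. x \<in> S \<Longrightarrow> f' x v = g' x v"
  shows "C1_on S f g'"
  unfolding C1_on_def
proof (intro conjI ballI allI)
  show "continuous_on S f"
    by (rule C1_onD[OF assms(1)])
  show "continuous_on (S \<times> UNIV) (\<lambda>(x, v). g' x v)"
    by (rule continuous_on_cong[THEN iffD1, OF refl _ C1_onD(2)[OF assms(1)]]) (use assms(2) in auto)
  fix x v assume x: "x \<in> interior S"
  then show "((\<lambda>t. (1 / t) *\<^sub>R (f (x + t *\<^sub>R v) - f x)) \<longlongrightarrow> g' x v) (at 0)"
    using C1_onD(3)[OF assms(1) x, of v] assms(2)[OF subsetD[OF interior_subset x]] by simp
qed

lemma continuous_on_locally:
  assumes "\<And>x. x \<in> S \<Longrightarrow> \<exists>U. open U \<and> x \<in> U \<and> continuous_on (S \<inter> U) f"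
  shows "continuous_on S f"
  unfolding continuous_on_def
proof
  fix x assume x: "x \<in> S"
  obtain U where U: "open U" "x \<in> U" "continuous_on (S \<inter> U) f"
    using assms[OF x] by blast
  have "at x within S = at x within S \<inter> U"
    using U by (intro at_within_nhd[of x U]) auto
  then show "(f \<longlongrightarrow> f x) (at x within S)"
    using U x by (auto simp: continuous_on_def)
qed

lemma C1_on_locally:
  fixes f :: "'a::locally_convex_space \<Rightarrow> 'b::locally_convex_space"
  assumes loc: "\<And>x. x \<in> S \<Longrightarrow> \<exists>U. open U \<and> x \<in> U \<and> C1_on (S \<inter> U) f f'"
  shows "C1_on S f f'"
  unfolding C1_on_def
proof (intro conjI ballI allI)
  show "continuous_on S f"
    using loc C1_onD(1) by (intro continuous_on_locally) blast
  show "continuous_on (S \<times> UNIV) (\<lambda>(x, v). f' x v)"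
  proof (rule continuous_on_locally)
    fix z :: "'a \<times> 'a" assume "z \<in> S \<times> UNIV"
    then obtain U where U: "open U" "fst z \<in> U" "C1_on (S \<inter> U) f f'"
      using loc[of "fst z"] by auto
    have "S \<times> UNIV \<inter> U \<times> UNIV = (S \<inter> U) \<times> (UNIV :: 'a set)"
      by auto
    then show "\<exists>U. open U \<and> z \<in> U \<and> continuous_on (S \<times> UNIV \<inter> U) (\<lambda>(x, v). f' x v)"
      using U C1_onD(2)[OF U(3)]
      by (intro exI[of _ "U \<times> UNIV"]) (auto simp: open_Times mem_Times_iff)
  qed
next
  fix x v assume x: "x \<in> interior S"
  obtain U where U: "open U" "x \<in> U" "C1_on (S \<inter> U) f f'"
    using loc[OF subsetD[OF interior_subset x]] by blast
  then show "((\<lambda>t. (1 / t) *\<^sub>R (f (x + t *\<^sub>R v) - f x)) \<longlongrightarrow> f' x v) (at 0)"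
    using x by (intro C1_onD(3)[OF U(3)]) (auto simp: interior_open)
qed

lemma strict_deriv_cong:
  fixes f :: "'a::locally_convex_space \<Rightarrow> 'b::locally_convex_space"
  assumes "strict_deriv f S x v d" "\<And>y. y \<in> S \<Longrightarrow> f y = g y"
  shows "strict_deriv g S x v d"
  unfolding strict_deriv_def case_prod_unfold
proof (rule Lim_transform_eventually)
  show "((\<lambda>z. (1 / snd (snd z)) *\<^sub>R (f (fst z + snd (snd z) *\<^sub>R fst (snd z)) - f (fst z))) \<longlongrightarrow> d)
      (quotient_filter S x v)"
    using assms(1) by (simp add: strict_deriv_def case_prod_unfold)
  show "\<forall>\<^sub>F z in quotient_filter S x v.
      (1 / snd (snd z)) *\<^sub>R (f (fst z + snd (snd z) *\<^sub>R fst (snd z)) - f (fst z)) =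
      (1 / snd (snd z)) *\<^sub>R (g (fst z + snd (snd z) *\<^sub>R fst (snd z)) - g (fst z))"
    using tendsto_quotient_filter(4)[of S x v] by eventually_elim (simp add: assms(2))
qed

text \<open>Combined with \<open>quotient_filter_nontrivial\<close>, this makes strict derivatives
  unique at all points of a convex set with interior, its boundary points included.\<close>

lemma convex_subset_closure_interior:
  fixes S :: "'a::locally_convex_space set"
  assumes "convex S" "interior S \<noteq> {}"
  shows "S \<subseteq> closure (interior S)"
proof
  fix x assume x: "x \<in> S"
  obtain z where z: "z \<in> interior S"
    using assms by blast
  show "x \<in> closure (interior S)"
  proof (rule Lim_in_closed_set)
    have "((\<lambda>e. (1 - e) *\<^sub>R x + e *\<^sub>R z) \<longlongrightarrow> (1 - 0) *\<^sub>R x + 0 *\<^sub>R z) (at_right 0)"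
      by (intro tendsto_intros)
    then show "((\<lambda>e. (1 - e) *\<^sub>R x + e *\<^sub>R z) \<longlongrightarrow> x) (at_right 0)"
      by simp
    have "\<forall>\<^sub>F e in at_right (0::real). 0 < e \<and> e < 1"
      unfolding eventually_at_right_field by (intro exI[of _ 1]) auto
    then show "\<forall>\<^sub>F e in at_right 0. (1 - e) *\<^sub>R x + e *\<^sub>R z \<in> closure (interior S)"
      by eventually_elim
        (use convex_shrink_interior[OF assms(1) x z] closure_subset in \<open>auto intro: less_imp_le\<close>)
  qed auto
qed

text \<open>At an interior point the admissible steps fill a neighbourhood of 0, so the restricted
  filter in \<open>dir_deriv\<close> is the full \<open>at 0\<close> and its \<open>Lim\<close> is a
  genuine limit.\<close>

lemma dir_deriv_eqI:
  fixes f :: "'a::locally_convex_space \<Rightarrow> 'b::locally_convex_space"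
  assumes "((\<lambda>t. (1 / t) *\<^sub>R (f (p + t *\<^sub>R u) - f p)) \<longlongrightarrow> d) (at 0)" "p \<in> interior D"
  shows "dir_deriv D f p u = d"
proof -
  have "open {t. p + t *\<^sub>R u \<in> interior D}"
  proof -
    have "continuous_on UNIV (\<lambda>t. p + t *\<^sub>R u)"
      by (auto simp: continuous_on_def intro!: tendsto_intros)
    from open_vimage[OF open_interior this] show ?thesis
      by (simp add: vimage_def)
  qed
  then have "0 \<in> interior {t. p + t *\<^sub>R u \<in> D}"
    using assms(2) interior_subset by (intro interiorI[of "{t. p + t *\<^sub>R u \<in> interior D}"]) auto
  then have "at 0 within {t. p + t *\<^sub>R u \<in> D} = at 0"
    by (rule at_within_interior)
  then show ?thesis
    unfolding dir_deriv_def by (simp add: tendsto_Lim[OF at_neq_bot assms(1)])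
qed

section \<open>The Maurer--Cartan equation\<close>

context lie_group
begin

section \<open>The group operations in the unit chart\<close>

definition "udom = fst (unit_chart L)"
definition "uchart = snd (unit_chart L)"
definition "uinv = inv_into udom uchart"
definition "origin = uchart \<one>"

lemma unit_in_atlas: "(udom, uchart) \<in> atlas L"
  using unit_chart(1) by (simp add: udom_def uchart_def)

lemma chart_inj: "(V, \<psi>) \<in> atlas L \<Longrightarrow> inj_on \<psi> V"
  using homeomorphic_imp_injective_map[OF chart_homeomorphic]
  by (simp add: topspace_subtopology Int_absorb1 openin_subset[OF chart_domain])

lemma chart_subset: "(V, \<psi>) \<in> atlas L \<Longrightarrow> V \<subseteq> carrier L"
  using openin_subset[OF chart_domain] by (simp add: topspace_eq)

lemma chart_at:
  assumes "x \<in> carrier L"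
  obtains V \<psi> where "(V, \<psi>) \<in> atlas L" "x \<in> V"
proof -
  have "x \<in> \<Union>(fst ` atlas L)"
    using assms by (simp only: charts_cover)
  then obtain p where "p \<in> atlas L" "x \<in> fst p"
    by blast
  then show ?thesis
    using that[of "fst p" "snd p"] by simp
qed

lemma smooth_into_carrier: "smooth_into L S f \<Longrightarrow> x \<in> S \<Longrightarrow> f x \<in> carrier L"
  using continuous_map_image_subset_topspace[of "top_of_set S" "manifold_topology L" f]
  by (auto simp: smooth_into_def topspace_eq)

lemma smooth_into_preimage:
  assumes "smooth_into L S f" "openin (manifold_topology L) V"
  shows "openin (top_of_set S) (S \<inter> f -` V)"
proof -
  have "openin (top_of_set S) {x \<in> topspace (top_of_set S). f x \<in> V}"
    using assms openin_continuous_map_preimage unfolding smooth_into_def by blast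
  moreover have "{x \<in> topspace (top_of_set S). f x \<in> V} = S \<inter> f -` V"
    by auto
  ultimately show ?thesis by simp
qed

lemma smooth_into_C2:
  fixes S :: "'a::locally_convex_space set"
  assumes "smooth_into L S f" "(V, \<psi>) \<in> atlas L"
  obtains f1 f2 where "C2_on (S \<inter> f -` V) (\<lambda>x. \<psi> (f x)) f1 f2"
proof -
  have "smooth_on (S \<inter> f -` V) (\<psi> \<circ> f)"
    using assms by (auto simp: smooth_into_def)
  then obtain f1 f2 where "C2_on (S \<inter> f -` V) (\<psi> \<circ> f) f1 f2"
    by (rule smooth_on_imp_C2_on)
  then show ?thesis
    by (intro that) (simp add: comp_def)
qed

definition "mult_dom = (uchart ` udom \<times> uchart ` udom) \<inter> (\<lambda>(x, y). uinv x \<otimes> uinv y) -` udom"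
definition "chart_mult = (\<lambda>p. uchart (uinv (fst p) \<otimes> uinv (snd p)))"
definition "inv_dom = uchart ` udom \<inter> (\<lambda>x. inv uinv x) -` udom"
definition "chart_inv = (\<lambda>x. uchart (inv uinv x))"

lemma uinv_in: "x \<in> uchart ` udom \<Longrightarrow> uinv x \<in> udom"
  by (simp add: uinv_def inv_into_into)

lemma uchart_uinv: "x \<in> uchart ` udom \<Longrightarrow> uchart (uinv x) = x"
  by (simp add: uinv_def f_inv_into_f)

lemma uinv_uchart: "g \<in> udom \<Longrightarrow> uinv (uchart g) = g"
  using chart_inj[OF unit_in_atlas] by (simp add: uinv_def)

lemma udom_carrier: "g \<in> udom \<Longrightarrow> g \<in> carrier L"
  using chart_subset[OF unit_in_atlas] by blast

lemma uinv_carrier: "x \<in> uchart ` udom \<Longrightarrow> uinv x \<in> carrier L"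
  using uinv_in udom_carrier by blast

lemma one_udom: "\<one> \<in> udom"
  using unit_chart(2) by (simp add: udom_def)

lemma origin_in: "origin \<in> uchart ` udom"
  using one_udom by (auto simp: origin_def)

lemma uinv_origin: "uinv origin = \<one>"
  using uinv_uchart[OF one_udom] by (simp add: origin_def)

lemma open_uchart: "open (uchart ` udom)"
  by (rule chart_range[OF unit_in_atlas])

lemma open_mult_dom: "open mult_dom"
proof -
  have "smooth_into L (uchart ` udom \<times> uchart ` udom) (\<lambda>(x, y). uinv x \<otimes> uinv y)"
    using smooth_mult[OF unit_in_atlas unit_in_atlas] by (simp add: uinv_def)
  from smooth_into_preimage[OF this chart_domain[OF unit_in_atlas]] show ?thesis
    using open_uchart by (metis mult_dom_def open_Times openin_open_trans)
qed

lemma open_inv_dom: "open inv_dom"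
proof -
  have "smooth_into L (uchart ` udom) (\<lambda>x. inv uinv x)"
    using smooth_inverse[OF unit_in_atlas] by (simp add: uinv_def)
  from smooth_into_preimage[OF this chart_domain[OF unit_in_atlas]] show ?thesis
    using open_uchart by (metis inv_dom_def openin_open_trans)
qed

lemma chart_mult_C2:
  obtains m1 m2 where "C2_on mult_dom chart_mult m1 m2"
proof -
  have "smooth_into L (uchart ` udom \<times> uchart ` udom) (\<lambda>(x, y). uinv x \<otimes> uinv y)"
    using smooth_mult[OF unit_in_atlas unit_in_atlas] by (simp add: uinv_def)
  from smooth_into_C2[OF this unit_in_atlas] obtain m1 m2 where
    "C2_on ((uchart ` udom \<times> uchart ` udom) \<inter> (\<lambda>(x, y). uinv x \<otimes> uinv y) -` udom)
      (\<lambda>p. uchart ((\<lambda>(x, y). uinv x \<otimes> uinv y) p)) m1 m2" .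
  then show ?thesis
    by (intro that) (simp add: mult_dom_def chart_mult_def case_prod_unfold)
qed

lemma chart_inv_C1:
  obtains i1 where "C1_on inv_dom chart_inv i1"
proof -
  have "smooth_into L (uchart ` udom) (\<lambda>x. inv uinv x)"
    using smooth_inverse[OF unit_in_atlas] by (simp add: uinv_def)
  from smooth_into_C2[OF this unit_in_atlas] obtain i1 i2 where
    "C2_on (uchart ` udom \<inter> (\<lambda>x. inv uinv x) -` udom) (\<lambda>x. uchart (inv uinv x)) i1 i2" .
  then show ?thesis
    by (intro that[of i1]) (simp add: inv_dom_def chart_inv_def C2_on_def)
qed

lemma mult_dom_origin_left: "y \<in> uchart ` udom \<Longrightarrow> (origin, y) \<in> mult_dom \<and> chart_mult (origin, y) = y"
  using origin_in by (simp add: mult_dom_def chart_mult_def uinv_origin uinv_carrier uinv_in uchart_uinv)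

lemma mult_dom_origin_right: "x \<in> uchart ` udom \<Longrightarrow> (x, origin) \<in> mult_dom \<and> chart_mult (x, origin) = x"
  using origin_in by (simp add: mult_dom_def chart_mult_def uinv_origin uinv_carrier uinv_in uchart_uinv)

lemma inv_dom_in: "x \<in> inv_dom \<Longrightarrow> x \<in> uchart ` udom"
  by (simp add: inv_dom_def)

lemma chart_inv_in: "x \<in> inv_dom \<Longrightarrow> chart_inv x \<in> uchart ` udom \<and> uinv (chart_inv x) = inv uinv x"
  by (simp add: inv_dom_def chart_inv_def uinv_uchart)

lemma inv_mult_dom: "x \<in> inv_dom \<Longrightarrow> (chart_inv x, x) \<in> mult_dom"
  using one_udom by (simp add: mult_dom_def chart_inv_in inv_dom_in uinv_carrier)

lemma origin_inv_dom: "origin \<in> inv_dom \<and> chart_inv origin = origin"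
  using origin_in one_udom by (simp add: inv_dom_def chart_inv_def uinv_origin) (simp add: origin_def)

text \<open>This is g^-1 (g k) = k in coordinates; the product on the left stays in the chart
  because the result is the coordinate \<open>y\<close> again.\<close>

lemma chart_inv_mult:
  assumes "x \<in> inv_dom" "(x, y) \<in> mult_dom"
  shows "(chart_inv x, chart_mult (x, y)) \<in> mult_dom \<and> chart_mult (chart_inv x, chart_mult (x, y)) = y"
proof -
  have xy: "x \<in> uchart ` udom" "y \<in> uchart ` udom" "uinv x \<otimes> uinv y \<in> udom"
    using assms by (auto simp: mult_dom_def)
  have "inv uinv x \<otimes> (uinv x \<otimes> uinv y) = uinv y"
    using xy by (simp add: inv_solve_left' uinv_carrier)
  then show ?thesis
    using xy chart_inv_in[OF assms(1)]
    by (simp add: mult_dom_def chart_mult_def uinv_uchart uinv_in uchart_uinv)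
qed

text \<open>In coordinates the left invariant field of u is x \<mapsto> m1 (x, origin) (0, u): only
  the right factor moves. Differentiating it in x moves the left factor, so the bracket is the
  antisymmetrised mixed second derivative of the multiplication. The final 0 in the second argument
  of \<open>m2\<close> says that the direction (0, u) is held fixed.\<close>

lemma lie_bracket_chart:
  assumes m: "C2_on mult_dom chart_mult m1 m2"
  shows "lie_bracket L v w =
    m2 ((origin, origin), (0, w)) ((v, 0), 0) - m2 ((origin, origin), (0, v)) ((w, 0), 0)"
proof -
  have field: "left_invariant_field L u x = m1 (x, origin) (0, u)" if x: "x \<in> uchart ` udom" for u x
  proof -
    have "((\<lambda>t. (1 / t) *\<^sub>R (chart_mult ((x, origin) + t *\<^sub>R (0, u)) - chart_mult (x, origin)))
        \<longlongrightarrow> m1 (x, origin) (0, u)) (at 0)"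
      using mult_dom_origin_right[OF x] open_mult_dom
      by (intro C1_onD(3)[OF C2_onD(1)[OF m]]) (simp add: interior_open)
    then have "((\<lambda>t. (1 / t) *\<^sub>R (uchart (uinv x \<otimes> uinv (origin + t *\<^sub>R u)) - uchart (uinv x \<otimes> uinv origin)))
        \<longlongrightarrow> m1 (x, origin) (0, u)) (at 0)"
      by (simp add: chart_mult_def)
    from dir_deriv_eqI[where D = "uchart ` udom", OF this] show ?thesis
      using origin_in open_uchart
      by (simp add: left_invariant_field_def split_beta udom_def[symmetric] uchart_def[symmetric]
          uinv_def[symmetric] origin_def[symmetric] interior_open)
  qed
  have "dir_deriv (uchart ` udom) (left_invariant_field L u) origin z =
      m2 ((origin, origin), (0, u)) ((z, 0), 0)" for u z
  proof (rule dir_deriv_eqI)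
    have in_dom: "(origin, origin) \<in> mult_dom"
      using mult_dom_origin_right[OF origin_in] by simp
    have "((\<lambda>t. (1 / t) *\<^sub>R
        ((\<lambda>(p, q). m1 p q) (((origin, origin), (0, u)) + t *\<^sub>R ((z, 0), 0)) - (\<lambda>(p, q). m1 p q) ((origin, origin), (0, u))))
        \<longlongrightarrow> m2 ((origin, origin), (0, u)) ((z, 0), 0)) (at 0)"
      using in_dom open_mult_dom
      by (intro C1_onD(3)[OF C2_onD(2)[OF m]]) (simp add: interior_Times interior_open)
    then show "((\<lambda>t. (1 / t) *\<^sub>R (left_invariant_field L u (origin + t *\<^sub>R z) - left_invariant_field L u origin))
        \<longlongrightarrow> m2 ((origin, origin), (0, u)) ((z, 0), 0)) (at 0)"
    proof (rule Lim_transform_eventually)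
      have "\<forall>\<^sub>F t in at 0. origin + t *\<^sub>R z \<in> uchart ` udom"
        using interior_directional_eventually[of origin "uchart ` udom" z] origin_in open_uchart
        by (simp add: interior_open)
      then show "\<forall>\<^sub>F t in at 0. (1 / t) *\<^sub>R
        ((\<lambda>(p, q). m1 p q) (((origin, origin), (0, u)) + t *\<^sub>R ((z, 0), 0)) - (\<lambda>(p, q). m1 p q) ((origin, origin), (0, u))) =
        (1 / t) *\<^sub>R (left_invariant_field L u (origin + t *\<^sub>R z) - left_invariant_field L u origin)"
        by eventually_elim (simp add: field origin_in zero_prod_def)
    qed
    show "origin \<in> interior (uchart ` udom)"
      using origin_in open_uchart by (simp add: interior_open)
  qed
  then show ?thesis
    by (simp add: lie_bracket_def split_beta udom_def[symmetric] uchart_def[symmetric] origin_def[symmetric])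
qed

section \<open>The Maurer-Cartan form in coordinates\<close>

text \<open>
  \<open>m1 (chart_inv x, x) (0, v)\<close> is the Maurer--Cartan form at \<open>x\<close>.  It inverts the left invariant fields
  \<open>v \<mapsto> m1 (x, origin) (0, v)\<close>; differentiating this relation at the origin expresses its differential
  by the bracket.
\<close>

lemma maurer_cartan_form:
  assumes m: "C2_on mult_dom chart_mult m1 m2"
  obtains A' where "C1_on (inv_dom \<times> UNIV) (\<lambda>(x, v). m1 (chart_inv x, x) (0, v)) A'"
    and "\<forall>v. m1 (chart_inv origin, origin) (0, v) = v"
    and "\<forall>v w. A' (origin, v) (w, 0) - A' (origin, w) (v, 0) = - lie_bracket L w v"
    and "\<forall>v z. A' (origin, v) (0, z) = z"
proof -
  obtain i1 where i: "C1_on inv_dom chart_inv i1"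
    by (rule chart_inv_C1)
  note m1 = C2_onD(1)[OF m] and m2 = C2_onD(2)[OF m]
  \<comment> \<open>Chain rule: \<open>chart_inv x\<close> and \<open>x\<close> both move when x
    moves along y, while z changes the vector.\<close>
  define A' where "A' = (\<lambda>(x, v) (y, z). m2 ((chart_inv x, x), (0, v)) ((i1 x y, y), (0, z)))"
  have A: "C1_on (inv_dom \<times> UNIV) (\<lambda>(x, v). m1 (chart_inv x, x) (0, v)) A'"
  proof -
    have "C1_on (inv_dom \<times> (UNIV :: 'e set)) (\<lambda>p. ((chart_inv (fst p), fst p), (0, snd p)))
        (\<lambda>p q. ((i1 (fst p) (fst q), fst q), (0, snd q)))"
      by (intro C1_on_Pair C1_on_compose_fst[OF i] C1_on_fst C1_on_snd C1_on_const)
    moreover have "(\<lambda>p::'e \<times> 'e. ((chart_inv (fst p), fst p), (0::'e, snd p))) ` (inv_dom \<times> UNIV) \<subseteq> mult_dom \<times> UNIV"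
      using inv_mult_dom by auto
    ultimately have "C1_on (inv_dom \<times> UNIV)
       (\<lambda>p. (\<lambda>(p, q). m1 p q) ((chart_inv (fst p), fst p), (0, snd p)))
       (\<lambda>p q. m2 ((chart_inv (fst p), fst p), (0, snd p)) ((i1 (fst p) (fst q), fst q), (0, snd q)))"
      by (rule C1_on_compose[OF _ m2 open_Times[OF open_mult_dom open_UNIV]])
    then show ?thesis
      by (simp add: A'_def case_prod_unfold)
  qed
  have slice: "C1_on {y. (x, y) \<in> mult_dom} (\<lambda>y. chart_mult (x, y)) (\<lambda>y v. m1 (x, y) (0, v))" for x
    by (intro C1_on_compose[OF C1_on_Pair[OF C1_on_const C1_on_ident] m1 open_mult_dom]) auto
  have slice_open: "open {y. (x, y) \<in> mult_dom}" for x
  proof -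
    have "continuous_on UNIV (\<lambda>y. (x, y))"
      by (intro continuous_intros)
    from open_vimage[OF open_mult_dom this] show ?thesis
      by (simp add: vimage_def)
  qed
  have id: "m1 (chart_inv origin, origin) (0, v) = v" for v
  proof -
    have "m1 (origin, origin) (0, v) = v"
      by (rule C1_on_unique[OF slice C1_on_ident[of "uchart ` udom"] open_uchart])
        (use mult_dom_origin_left origin_in in auto)
    then show ?thesis
      by (simp add: origin_inv_dom)
  qed
  \<comment> \<open>Differentiate x^-1 (x y) = y in y at the origin: the inner derivative is the
    left invariant field, the outer one is the form.\<close>
  have inverse: "m1 (chart_inv x, x) (0, m1 (x, origin) (0, v)) = v" if x: "x \<in> inv_dom" for x v
  proof -
    let ?T = "{y. (x, y) \<in> mult_dom}"
    have xo: "(x, origin) \<in> mult_dom" "chart_mult (x, origin) = x"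
      using mult_dom_origin_right[OF inv_dom_in[OF x]] by auto
    have "C1_on ?T (\<lambda>y. chart_mult (chart_inv x, chart_mult (x, y)))
        (\<lambda>y v. m1 (chart_inv x, chart_mult (x, y)) (0, m1 (x, y) (0, v)))"
      using chart_inv_mult[OF x] by (intro C1_on_compose[OF slice slice slice_open]) auto
    from C1_on_unique[OF this C1_on_ident[of ?T] slice_open]
    have "m1 (chart_inv x, chart_mult (x, origin)) (0, m1 (x, origin) (0, v)) = v"
      using chart_inv_mult[OF x] xo by blast
    then show ?thesis
      by (simp add: xo)
  qed
  have A_o: "A' (origin, v) (0, z) = z" for v z
  proof -
    have "C1_on UNIV (\<lambda>y. (\<lambda>(x, v). m1 (chart_inv x, x) (0, v)) (origin, y)) (\<lambda>y z. A' (origin, y) (0, z))"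
      using origin_inv_dom
      by (intro C1_on_compose[OF C1_on_Pair[OF C1_on_const C1_on_ident] A])
        (auto intro: open_Times open_inv_dom)
    from C1_on_unique[OF this C1_on_ident[of UNIV] open_UNIV, of v z] show ?thesis
      by (simp add: id)
  qed
  \<comment> \<open>The form applied to a left invariant field is the constant \<open>v\<close>, so
    its derivative at the origin along \<open>w\<close> vanishes. That derivative is the sum of the
    derivative of the form and, by \<open>A_o\<close>, the derivative of the field.\<close>
  have A_field: "A' (origin, v) (w, 0) = - m2 ((origin, origin), (0, v)) ((w, 0), 0)" for v w
  proof -
    have sub: "(\<lambda>x. ((x, origin), (0::'e, v))) ` inv_dom \<subseteq> mult_dom \<times> UNIV"
      using mult_dom_origin_right inv_dom_in by auto
    have "C1_on inv_dom (\<lambda>x. (\<lambda>(p, q). m1 p q) ((x, origin), (0, v)))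
        (\<lambda>x w. m2 ((x, origin), (0, v)) ((w, 0), (0, 0)))"
      by (intro C1_on_compose[OF _ m2 open_Times[OF open_mult_dom open_UNIV] sub]
          C1_on_Pair C1_on_ident C1_on_const)
    then have "C1_on inv_dom (\<lambda>x. (x, (\<lambda>(p, q). m1 p q) ((x, origin), (0, v))))
        (\<lambda>x w. (w, m2 ((x, origin), (0, v)) ((w, 0), (0, 0))))"
      by (intro C1_on_Pair C1_on_ident)
    from C1_on_compose[OF this A open_Times[OF open_inv_dom open_UNIV]]
    have "C1_on inv_dom (\<lambda>x. m1 (chart_inv x, x) (0, m1 (x, origin) (0, v)))
        (\<lambda>x w. A' (x, m1 (x, origin) (0, v)) (w, m2 ((x, origin), (0, v)) ((w, 0), (0, 0))))"
      by auto
    from C1_on_unique[OF this C1_on_const[of inv_dom v] open_inv_dom]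
    have "A' (origin, m1 (origin, origin) (0, v)) (w, m2 ((origin, origin), (0, v)) ((w, 0), (0, 0))) = 0"
      using origin_inv_dom inverse by auto
    moreover have "m1 (origin, origin) (0, v) = v"
      using id origin_inv_dom by simp
    moreover interpret linear "A' (origin, v)"
      using origin_inv_dom open_inv_dom
      by (intro C1_on_linear[OF A]) (simp add: interior_Times interior_open)
    have "A' (origin, v) (w, m2 ((origin, origin), (0, v)) ((w, 0), 0)) =
        A' (origin, v) (w, 0) + m2 ((origin, origin), (0, v)) ((w, 0), 0)"
      using add[of "(w, 0)" "(0, m2 ((origin, origin), (0, v)) ((w, 0), 0))"] A_o by simp
    ultimately show ?thesis
      by (simp add: zero_prod_def[symmetric] add_eq_0_iff)
  qed
  show ?thesis
    by (rule that[OF A]) (simp_all add: id A_o A_field lie_bracket_chart[OF m])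
qed

section \<open>Logarithmic derivatives of smooth maps\<close>

text \<open>The map q \<mapsto> h(p)^-1 h(q) takes \<open>p\<close> to the neutral element, so near
  \<open>p\<close> it can be read in \<open>unit_chart\<close>, whatever chart contains
  \<open>h p\<close>. Convexity of \<open>W\<close> keeps S \<inter> W convex when \<open>S\<close>
  is; values in \<open>inv_dom\<close> lie where the Maurer-Cartan form is available.\<close>

lemma local_translate:
  fixes S :: "'a::locally_convex_space set"
  assumes h: "smooth_into L S h" and p: "p \<in> S"
  obtains W f f1 f2 where "open W" "p \<in> W" "convex W" "C2_on (S \<inter> W) f f1 f2" "f p = origin"
    "\<And>q. q \<in> S \<inter> W \<Longrightarrow> f q \<in> inv_dom \<and> uinv (f q) = inv h p \<otimes> h q"
proof -
  note carrier = smooth_into_carrier[OF h]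
  obtain V \<psi> where V: "(V, \<psi>) \<in> atlas L" "h p \<in> V"
    using chart_at[OF carrier[OF p]] by metis
  obtain Y \<kappa> where Y: "(Y, \<kappa>) \<in> atlas L" "inv h p \<in> Y"
    using chart_at[OF inv_closed[OF carrier[OF p]]] by metis
  obtain c1 c2 where c: "C2_on (S \<inter> h -` V) (\<lambda>q. \<psi> (h q)) c1 c2"
    by (rule smooth_into_C2[OF h V(1)])
  define mul where "mul = (\<lambda>(x, y). inv_into Y \<kappa> x \<otimes> inv_into V \<psi> y)"
  have mul: "smooth_into L (\<kappa> ` Y \<times> \<psi> ` V) mul"
    unfolding mul_def by (rule smooth_mult[OF Y(1) V(1)])
  obtain n1 n2 where n: "C2_on ((\<kappa> ` Y \<times> \<psi> ` V) \<inter> mul -` udom) (\<lambda>z. uchart (mul z)) n1 n2"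
    by (rule smooth_into_C2[OF mul unit_in_atlas])
  have n_open: "open ((\<kappa> ` Y \<times> \<psi> ` V) \<inter> mul -` udom)" (is "open ?M")
    using smooth_into_preimage[OF mul chart_domain[OF unit_in_atlas]]
      open_Times[OF chart_range[OF Y(1)] chart_range[OF V(1)]] openin_open_trans by blast
  \<comment> \<open>Left translation by the fixed element \<open>inv h p\<close> is the
    multiplication in the charts \<open>Y\<close> and \<open>V\<close> with its first argument
    frozen.\<close>
  define G where "G = {y. (\<kappa> (inv h p), y) \<in> ?M}"
  have cont: "continuous_on UNIV (\<lambda>y. (\<kappa> (inv h p), y))"
    by (intro continuous_intros)
  have G: "open G"
    using open_vimage[OF n_open cont] by (simp add: G_def vimage_def)
  have "C1_on (G \<times> UNIV) (\<lambda>p::'e \<times> 'e. (0::'e, snd p)) (\<lambda>p q. (0, snd q))"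
    by (intro C1_on_Pair C1_on_const C1_on_snd)
  then have "C2_on G (\<lambda>y. (\<kappa> (inv h p), y)) (\<lambda>y v. (0, v)) (\<lambda>p q. (0, snd q))"
    unfolding C2_on_def by (auto simp: case_prod_unfold intro: C1_on_Pair C1_on_const C1_on_ident)
  from C2_on_compose[OF this n n_open] obtain l1 l2
    where l: "C2_on G (\<lambda>y. uchart (mul (\<kappa> (inv h p), y))) l1 l2"
    by (auto simp: G_def)
  define G' where "G' = G \<inter> (\<lambda>y. uchart (mul (\<kappa> (inv h p), y))) -` inv_dom"
  have G': "open G'"
    unfolding G'_def
    by (rule continuous_open_preimage[OF C1_onD(1)[OF C2_onD(1)[OF l]] G open_inv_dom])
  \<comment> \<open>This set is open relative to \<open>S\<close> only, since \<open>S\<close> may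
    have boundary points; an open \<open>W'\<close> that cuts it out of \<open>S\<close> is
    extracted afterwards.\<close>
  define S' where "S' = S \<inter> h -` V \<inter> (\<lambda>q. \<psi> (h q)) -` G'"
  have "openin (top_of_set (S \<inter> h -` V)) S'"
    unfolding S'_def
    by (rule continuous_openin_preimage_gen[OF C1_onD(1)[OF C2_onD(1)[OF c]] G'])
  then have "openin (top_of_set S) S'"
    using smooth_into_preimage[OF h chart_domain[OF V(1)]] openin_trans by blast
  then obtain W' where W': "open W'" "S' = S \<inter> W'"
    by (auto simp: openin_open)
  have mul_h: "mul (\<kappa> (inv h p), \<psi> (h q)) = inv h p \<otimes> h q" if "h q \<in> V" for q
    using that Y V by (simp add: mul_def chart_inj)
  have "p \<in> S'"
    using p V Y mul_h[of p] carrier[OF p] one_udom origin_inv_dom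
    by (auto simp: S'_def G'_def G_def l_inv origin_def)
  then obtain W where W: "open W" "convex W" "p \<in> W" "W \<subseteq> W'"
    using convex_open_neighbourhood[OF W'(1), of p] W'(2) by blast
  have sub: "S \<inter> W \<subseteq> S'"
    using W W' by blast
  define f where "f q = uchart (mul (\<kappa> (inv h p), \<psi> (h q)))" for q
  have "C2_on (S \<inter> W) (\<lambda>q. \<psi> (h q)) c1 c2"
    using C2_on_subset[OF c] sub by (auto simp: S'_def)
  from C2_on_compose[OF this l G] obtain f1 f2 where f: "C2_on (S \<inter> W) f f1 f2"
    using sub unfolding f_def by (auto simp: S'_def G'_def)
  have props: "f q \<in> inv_dom \<and> uinv (f q) = inv h p \<otimes> h q" if "q \<in> S \<inter> W" for q
  proof -
    have q: "q \<in> S'"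
      using sub that by blast
    then have "mul (\<kappa> (inv h p), \<psi> (h q)) \<in> udom" "f q \<in> inv_dom" "h q \<in> V"
      by (auto simp: S'_def G'_def G_def f_def)
    then show ?thesis
      by (simp add: f_def uinv_uchart mul_h)
  qed
  have "f p = origin"
    using mul_h[OF V(2)] carrier[OF p] by (simp add: f_def origin_def l_inv)
  then show ?thesis
    using that[OF W(1,3,2) f _ props] by blast
qed

text \<open>\<open>\<theta>\<close> is the pullback of the Maurer-Cartan form under the translated
  map f. The translation drops out, since f(q)^-1 f(q') = h(q)^-1 h(q'). The bracket relation is
  claimed at the centre \<open>p\<close> only, where f takes the value \<open>origin\<close> and the
  differential of the form is known.\<close>

lemma log_deriv_local:
  fixes S :: "'a::locally_convex_space set"
  assumes h: "smooth_into L S h" and p: "p \<in> S" and S: "convex S" "interior S \<noteq> {}"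
  obtains W \<theta> \<theta>' where "open W" "p \<in> W" "C1_on ((S \<inter> W) \<times> UNIV) (\<lambda>(q, u). \<theta> q u) \<theta>'"
    "\<forall>q\<in>S \<inter> W. \<forall>u. strict_deriv (\<lambda>q'. uchart (inv h q \<otimes> h q')) S q u (\<theta> q u)"
    "p \<in> interior S \<longrightarrow> (\<forall>u v. \<theta>' (p, u) (v, 0) - \<theta>' (p, v) (u, 0) = - lie_bracket L (\<theta> p v) (\<theta> p u))"
proof -
  note carrier = smooth_into_carrier[OF h]
  obtain W f f1 f2 where W: "open W" "p \<in> W" "convex W" and f: "C2_on (S \<inter> W) f f1 f2" "f p = origin"
    and props: "\<And>q. q \<in> S \<inter> W \<Longrightarrow> f q \<in> inv_dom \<and> uinv (f q) = inv h p \<otimes> h q"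
    using local_translate[OF h p] by metis
  obtain m1 m2 where m: "C2_on mult_dom chart_mult m1 m2"
    by (rule chart_mult_C2)
  from maurer_cartan_form[OF m] obtain A' where A: "C1_on (inv_dom \<times> UNIV) (\<lambda>(x, v). m1 (chart_inv x, x) (0, v)) A'"
    and A_id: "\<forall>v. m1 (chart_inv origin, origin) (0, v) = v"
    and A_br: "\<forall>v w. A' (origin, v) (w, 0) - A' (origin, w) (v, 0) = - lie_bracket L w v"
    and A_o: "\<forall>v z. A' (origin, v) (0, z) = z" .
  define \<theta> where "\<theta> q u = m1 (chart_inv (f q), f q) (0, f1 q u)" for q u
  define \<theta>' where "\<theta>' p q = A' (f (fst p), f1 (fst p) (snd p)) (f1 (fst p) (fst q), f2 p q)" for p q
  note f1 = C2_onD(1)[OF f(1)] and f2 = C2_onD(2)[OF f(1)]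
  have C1: "C1_on ((S \<inter> W) \<times> UNIV) (\<lambda>(q, u). \<theta> q u) \<theta>'"
  proof -
    have "C1_on ((S \<inter> W) \<times> UNIV) (\<lambda>p::'a \<times> 'a. (f (fst p), (\<lambda>(x, v). f1 x v) p))
        (\<lambda>p q. (f1 (fst p) (fst q), f2 p q))"
      by (intro C1_on_Pair C1_on_compose_fst[OF f1] f2)
    moreover have "(\<lambda>p::'a \<times> 'a. (f (fst p), (\<lambda>(x, v). f1 x v) p)) ` ((S \<inter> W) \<times> UNIV) \<subseteq> inv_dom \<times> UNIV"
      using props by auto
    ultimately have "C1_on ((S \<inter> W) \<times> UNIV)
        (\<lambda>p. (\<lambda>(x, v). m1 (chart_inv x, x) (0, v)) (f (fst p), (\<lambda>(x, v). f1 x v) p))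
        (\<lambda>p q. A' (f (fst p), (\<lambda>(x, v). f1 x v) p) (f1 (fst p) (fst q), f2 p q))"
      by (rule C1_on_compose[OF _ A open_Times[OF open_inv_dom open_UNIV]])
    then show ?thesis
      by (simp add: \<theta>_def \<theta>'_def[abs_def] case_prod_unfold)
  qed
  \<comment> \<open>To get strict derivatives on S \<inter> W also at boundary points of
    \<open>S\<close>, this convex set must have interior points.\<close>
  have int: "interior (S \<inter> W) \<noteq> {}"
  proof -
    have "p \<in> closure (interior S)"
      using convex_subset_closure_interior[OF S] p by blast
    then have "interior S \<inter> W \<noteq> {}"
      using W by (metis closure_iff_nhds_not_empty inf.commute order_refl)
    then show ?thesis
      using W by (simp add: interior_open)
  qed
  have conv: "convex (S \<inter> W)"
    using S(1) W(3) by (rule convex_Int)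
  have strict: "strict_deriv (\<lambda>q'. uchart (inv h q \<otimes> h q')) S q u (\<theta> q u)" if q: "q \<in> S \<inter> W" for q u
  proof -
    have "strict_deriv (\<lambda>q'. (chart_inv (f q), f q')) (S \<inter> W) q u (0, f1 q u)"
      by (rule C1_on_strict_convex[OF C1_on_Pair[OF C1_on_const f1] conv int q])
    moreover have "(chart_inv (f q), f q) \<in> mult_dom"
      using props[OF q] inv_mult_dom by blast
    then have "strict_deriv chart_mult UNIV (chart_inv (f q), f q) (0, f1 q u) (\<theta> q u)"
      unfolding \<theta>_def using open_mult_dom
      by (intro C1_on_strict_open[OF C2_onD(1)[OF m]]) (simp add: interior_open)
    moreover have "continuous_on (S \<inter> W) (\<lambda>q'. (chart_inv (f q), f q'))"
      by (intro continuous_on_Pair continuous_on_const C1_onD(1)[OF f1])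
    ultimately have "strict_deriv (chart_mult \<circ> (\<lambda>q'. (chart_inv (f q), f q'))) (S \<inter> W) q u (\<theta> q u)"
      using q by (rule strict_deriv_chain) simp
    then have "strict_deriv (\<lambda>q'. uchart (inv h q \<otimes> h q')) (S \<inter> W) q u (\<theta> q u)"
    proof (rule strict_deriv_cong)
      fix q' assume q': "q' \<in> S \<inter> W"
      have "inv (inv h p \<otimes> h q) \<otimes> (inv h p \<otimes> h q') = inv h q \<otimes> h q'"
      proof -
        have "inv (inv h p \<otimes> h q) \<otimes> (inv h p \<otimes> h q') = inv h q \<otimes> (h p \<otimes> (inv h p \<otimes> h q'))"
          using q q' p carrier by (simp add: inv_mult_group m_assoc)
        also have "h p \<otimes> (inv h p \<otimes> h q') = h q'"
          using q' p carrier by (simp add: m_assoc[symmetric])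
        finally show ?thesis .
      qed
      then show "(chart_mult \<circ> (\<lambda>q'. (chart_inv (f q), f q'))) q' = uchart (inv h q \<otimes> h q')"
        using props[OF q] props[OF q'] chart_inv_in by (simp add: chart_mult_def)
    qed
    then show ?thesis
      using W(1) q by (intro strict_deriv_neighbourhood[of _ S W]) auto
  qed
  have "\<theta>' (p, u) (v, 0) - \<theta>' (p, v) (u, 0) = - lie_bracket L (\<theta> p v) (\<theta> p u)"
    if pi: "p \<in> interior S" for u v
  proof -
    have pi': "p \<in> interior (S \<inter> W)"
      using pi W by (simp add: interior_open)
    have split: "A' (origin, x) (y, z) = A' (origin, x) (y, 0) + z" for x y z
    proof -
      interpret linear "A' (origin, x)"
        using origin_inv_dom open_inv_dom
        by (intro C1_on_linear[OF A]) (simp add: interior_Times interior_open)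
      show ?thesis
        using add[of "(y, 0)" "(0, z)"] A_o by simp
    qed
    \<comment> \<open>The second derivative of \<open>f\<close> enters as a summand symmetric in
      \<open>u\<close> and \<open>v\<close>; it cancels in the difference and only the bracket is
      left.\<close>
    have "\<theta>' (p, u) (v, 0) = A' (origin, f1 p u) (f1 p v, 0) + f2 (p, u) (v, 0)" for u v
      by (simp add: \<theta>'_def f(2) split[of _ _ "f2 _ _"])
    moreover have "\<theta> p u = f1 p u" for u
      by (simp add: \<theta>_def f(2) A_id)
    ultimately show ?thesis
      using A_br C2_on_symmetric[OF f(1) pi', of u v] by simp
  qed
  then show ?thesis
    using strict by (intro that[OF W(1,2) C1]) blast+
qed

text \<open>Uniqueness of strict derivatives makes the local pieces \<open>\<theta>\<close> agree,
  even at boundary points. The local \<open>\<theta>'\<close> are compared on open subsets of the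
  interior, whence the smaller domain of the C1 statement. Every point is the centre of its own
  piece, so the relation at centres covers the interior.\<close>

lemma log_deriv_form:
  fixes S :: "'a::locally_convex_space set"
  assumes h: "smooth_into L S h" and S: "convex S" "interior S \<noteq> {}"
  obtains \<theta> \<theta>' where "continuous_on (S \<times> UNIV) (\<lambda>(q, u). \<theta> q u)"
    "C1_on (interior S \<times> UNIV) (\<lambda>(q, u). \<theta> q u) \<theta>'"
    "\<forall>q\<in>S. \<forall>u. strict_deriv (\<lambda>q'. uchart (inv h q \<otimes> h q')) S q u (\<theta> q u)"
    "\<forall>p\<in>interior S. \<forall>u v.
      \<theta>' (p, u) (v, 0) - \<theta>' (p, v) (u, 0) = - lie_bracket L (\<theta> p v) (\<theta> p u)"
proof -
  define good where "good p = (\<lambda>(W, \<theta>, \<theta>'). open W \<and> p \<in> W \<and>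
    C1_on ((S \<inter> W) \<times> UNIV) (\<lambda>(q, u). \<theta> q u) \<theta>' \<and>
    (\<forall>q\<in>S \<inter> W. \<forall>u. strict_deriv (\<lambda>q'. uchart (inv h q \<otimes> h q')) S q u (\<theta> q u)) \<and>
    (p \<in> interior S \<longrightarrow> (\<forall>u v. \<theta>' (p, u) (v, 0) - \<theta>' (p, v) (u, 0) = - lie_bracket L (\<theta> p v) (\<theta> p u))))"
    for p
  have "\<exists>z. good p z" if p: "p \<in> S" for p
    by (rule log_deriv_local[OF h p S], rule exI[of _ "(_, _, _)"]) (simp add: good_def)
  then obtain Z where Z: "\<And>p. p \<in> S \<Longrightarrow> good p (Z p)"
    by metis
  define W t t' where "W p = fst (Z p)" and "t p = fst (snd (Z p))" and "t' p = snd (snd (Z p))" for p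
  have W: "\<And>p. p \<in> S \<Longrightarrow> open (W p)" "\<And>p. p \<in> S \<Longrightarrow> p \<in> W p"
    and C1: "\<And>p. p \<in> S \<Longrightarrow> C1_on ((S \<inter> W p) \<times> UNIV) (\<lambda>(q, u). t p q u) (t' p)"
    and strict: "\<And>p q u. p \<in> S \<Longrightarrow> q \<in> S \<Longrightarrow> q \<in> W p \<Longrightarrow>
      strict_deriv (\<lambda>q'. uchart (inv h q \<otimes> h q')) S q u (t p q u)"
    and MC: "\<And>p u v. p \<in> interior S \<Longrightarrow>
      t' p (p, u) (v, 0) - t' p (p, v) (u, 0) = - lie_bracket L (t p p v) (t p p u)"
    using Z interior_subset[of S] by (auto simp: good_def split_beta W_def t_def t'_def)
  \<comment> \<open>Diagonal choice: the value at a point is taken from the piece centred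
    there.\<close>
  define \<theta> where "\<theta> p = t p p" for p
  define \<theta>' where "\<theta>' = (\<lambda>z. t' (fst z) z)"
  have \<theta>: "\<theta> q u = t p q u" if "p \<in> S" "q \<in> S" "q \<in> W p" for p q u
    using strict_deriv_unique[OF _ strict[OF that(2,2) W(2)[OF that(2)]] strict[OF that]]
      convex_subset_closure_interior[OF S] that by (auto simp: \<theta>_def)
  have \<theta>': "\<theta>' (q, u) z = t' p (q, u) z" if "p \<in> S" "q \<in> interior S" "q \<in> W p" for p q u z
  proof -
    have q: "q \<in> S"
      using that(2) interior_subset by blast
    have "t' q (q, u) z = t' p (q, u) z"
    proof (rule C1_on_unique[OF C1[OF q] C1[OF that(1)]])
      show "open ((interior S \<inter> W q \<inter> W p) \<times> (UNIV :: 'a set))"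
        using W(1)[OF q] W(1)[OF that(1)] by (auto intro: open_Times)
      show "(\<lambda>(q', u). t q q' u) y = (\<lambda>(q', u). t p q' u) y"
        if "y \<in> (interior S \<inter> W q \<inter> W p) \<times> UNIV" for y
        using that \<theta>[OF q, of "fst y" "snd y"] \<theta>[OF \<open>p \<in> S\<close>, of "fst y" "snd y"] interior_subset[of S]
        by (auto simp: case_prod_unfold)
    qed (use W(2)[OF q] that interior_subset[of S] in auto)
    then show ?thesis
      by (simp add: \<theta>'_def)
  qed
  have C1': "C1_on ((interior S \<inter> W p) \<times> UNIV) (\<lambda>(q, u). \<theta> q u) (t' p)" if "p \<in> S" for p
  proof (rule C1_on_cong)
    show "C1_on ((interior S \<inter> W p) \<times> UNIV) (\<lambda>(q, u). t p q u) (t' p)"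
      using C1[OF that] interior_subset[of S] by (rule_tac C1_on_subset) auto
    show "(\<lambda>(q, u). t p q u) x = (\<lambda>(q, u). \<theta> q u) x" if "x \<in> (interior S \<inter> W p) \<times> UNIV" for x
      using that \<theta>[OF \<open>p \<in> S\<close>] interior_subset[of S] by auto
  qed
  show ?thesis
  proof (rule that)
    show "continuous_on (S \<times> UNIV) (\<lambda>(q, u). \<theta> q u)"
    proof (rule continuous_on_locally)
      fix z :: "'a \<times> 'a" assume "z \<in> S \<times> UNIV"
      then have p: "fst z \<in> S" by auto
      have "continuous_on ((S \<inter> W (fst z)) \<times> UNIV) (\<lambda>(q, u). \<theta> q u)"
        by (rule continuous_on_cong[THEN iffD1, OF refl _ C1_onD(1)[OF C1[OF p]]]) (use \<theta>[OF p] in auto)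
      moreover have "(S \<inter> W (fst z)) \<times> UNIV = (S \<times> UNIV) \<inter> (W (fst z) \<times> (UNIV::'a set))"
        by auto
      ultimately show "\<exists>U. open U \<and> z \<in> U \<and> continuous_on (S \<times> UNIV \<inter> U) (\<lambda>(q, u). \<theta> q u)"
        using W[OF p] by (intro exI[of _ "W (fst z) \<times> UNIV"]) (auto simp: open_Times mem_Times_iff)
    qed
    show "C1_on (interior S \<times> UNIV) (\<lambda>(q, u). \<theta> q u) \<theta>'"
    proof (rule C1_on_locally)
      fix z :: "'a \<times> 'a" assume "z \<in> interior S \<times> UNIV"
      then have p: "fst z \<in> S"
        using interior_subset[of S] by auto
      have "C1_on ((interior S \<inter> W (fst z)) \<times> UNIV) (\<lambda>(q, u). \<theta> q u) \<theta>'"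
        by (rule C1_on_cong_deriv[OF C1'[OF p]]) (use \<theta>'[OF p] in auto)
      moreover have "(interior S \<inter> W (fst z)) \<times> UNIV = (interior S \<times> UNIV) \<inter> (W (fst z) \<times> (UNIV::'a set))"
        by auto
      ultimately show "\<exists>U. open U \<and> z \<in> U \<and> C1_on (interior S \<times> UNIV \<inter> U) (\<lambda>(q, u). \<theta> q u) \<theta>'"
        using W[OF p] by (intro exI[of _ "W (fst z) \<times> UNIV"]) (auto simp: open_Times mem_Times_iff)
    qed
    show "\<forall>q\<in>S. \<forall>u. strict_deriv (\<lambda>q'. uchart (inv h q \<otimes> h q')) S q u (\<theta> q u)"
      using strict W(2) by (simp add: \<theta>_def)
    show "\<forall>p\<in>interior S. \<forall>u v.
      \<theta>' (p, u) (v, 0) - \<theta>' (p, v) (u, 0) = - lie_bracket L (\<theta> p v) (\<theta> p u)"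
      using MC by (simp add: \<theta>'_def \<theta>_def)
  qed
qed

end

section \<open>Green's formula on disks\<close>

lemma compact_continuous_integrable_on:
  fixes f :: "'a::euclidean_space \<Rightarrow> 'b::euclidean_space"
  assumes "compact S" "continuous_on S f"
  shows "f integrable_on S"
  using borel_integrable_compact[OF assms] set_borel_integral_eq_integral(1)
  by (auto simp: set_integrable_def)

lemma compact_lborel_integral:
  fixes f :: "'a::euclidean_space \<Rightarrow> 'b::euclidean_space"
  assumes "compact S" "continuous_on S f"
  shows "(LINT x|lborel. indicator S x *\<^sub>R f x) = integral S f"
  using borel_integrable_compact[OF assms] set_borel_integral_eq_integral(2)[of S f]
  by (auto simp: set_integrable_def set_lebesgue_integral_def)

text \<open>Fubini for the Lebesgue integral of the function extended by zero off \<open>K\<close>;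
  slices of a compact set are compact, so each inner integral converts back.\<close>

lemma integral_iterated_compact:
  fixes f :: "real \<times> real \<Rightarrow> 'b::euclidean_space"
  assumes K: "compact K" and f: "continuous_on K f"
  shows "integral K f = integral UNIV (\<lambda>y. integral {x. (x, y) \<in> K} (\<lambda>x. f (x, y)))"
    and "integral K f = integral UNIV (\<lambda>x. integral {y. (x, y) \<in> K} (\<lambda>y. f (x, y)))"
proof -
  let ?F = "\<lambda>x y. indicator K (x, y) *\<^sub>R f (x, y)"
  have int: "integrable (lborel \<Otimes>\<^sub>M lborel) (\<lambda>(x, y). ?F x y)"
    using borel_integrable_compact[OF assms] by (simp add: lborel_prod case_prod_unfold)
  have eq: "integral K f = integral\<^sup>L (lborel \<Otimes>\<^sub>M lborel) (\<lambda>(x, y). ?F x y)"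
    using compact_lborel_integral[OF assms] by (simp add: lborel_prod case_prod_unfold)
  have fst: "(LINT x|lborel. ?F x y) = integral {x. (x, y) \<in> K} (\<lambda>x. f (x, y))" for y
  proof -
    have "{x. (x, y) \<in> K} = fst ` (K \<inter> UNIV \<times> {y})"
      by force
    then have "compact {x. (x, y) \<in> K}"
      by (simp add: compact_continuous_image closed_Times compact_Int_closed K continuous_on_fst)
    moreover have "continuous_on {x. (x, y) \<in> K} (\<lambda>x. f (x, y))"
      by (intro continuous_on_compose2[OF f] continuous_intros) auto
    ultimately show ?thesis
      by (simp add: compact_lborel_integral[symmetric] indicator_def)
  qed
  have snd: "(LINT y|lborel. ?F x y) = integral {y. (x, y) \<in> K} (\<lambda>y. f (x, y))" for x
  proof -
    have "{y. (x, y) \<in> K} = snd ` (K \<inter> {x} \<times> UNIV)"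
      by force
    then have "compact {y. (x, y) \<in> K}"
      by (simp add: compact_continuous_image closed_Times compact_Int_closed K continuous_on_snd)
    moreover have "continuous_on {y. (x, y) \<in> K} (\<lambda>y. f (x, y))"
      by (intro continuous_on_compose2[OF f] continuous_intros) auto
    ultimately show ?thesis
      by (simp add: compact_lborel_integral[symmetric] indicator_def)
  qed
  show "integral K f = integral UNIV (\<lambda>y. integral {x. (x, y) \<in> K} (\<lambda>x. f (x, y)))"
    using lborel_pair.integral_snd[OF int] integral_lborel[OF lborel_pair.integrable_snd[OF int]]
    by (simp add: eq fst)
  show "integral K f = integral UNIV (\<lambda>x. integral {y. (x, y) \<in> K} (\<lambda>y. f (x, y)))"
    using lborel_pair.integral_fst[OF int] integral_lborel[OF lborel_pair.integrable_fst[OF int]]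
    by (simp add: eq snd)
qed

lemma cball_slice:
  fixes \<rho> :: real
  assumes "\<rho> > 0"
  shows "(x, y) \<in> cball (0 :: real \<times> real) \<rho> \<longleftrightarrow>
    \<bar>y\<bar> \<le> \<rho> \<and> - sqrt (\<rho>\<^sup>2 - y\<^sup>2) \<le> x \<and> x \<le> sqrt (\<rho>\<^sup>2 - y\<^sup>2)"
proof -
  have "(x, y) \<in> cball (0 :: real \<times> real) \<rho> \<longleftrightarrow> x\<^sup>2 + y\<^sup>2 \<le> \<rho>\<^sup>2"
    using assms by (simp add: dist_norm norm_Pair real_sqrt_le_iff' real_le_lsqrt sqrt_le_D real_sqrt_le_iff)
  also have "\<dots> \<longleftrightarrow> \<bar>y\<bar> \<le> \<rho> \<and> \<bar>x\<bar> \<le> sqrt (\<rho>\<^sup>2 - y\<^sup>2)"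
  proof
    assume *: "x\<^sup>2 + y\<^sup>2 \<le> \<rho>\<^sup>2"
    then have "y\<^sup>2 \<le> \<rho>\<^sup>2"
      using zero_le_power2[of x] by linarith
    then have "\<bar>y\<bar> \<le> \<rho>"
      using assms by (simp add: abs_le_square_iff[symmetric])
    moreover have "sqrt (x\<^sup>2) \<le> sqrt (\<rho>\<^sup>2 - y\<^sup>2)"
      using * by (intro real_sqrt_le_mono) simp
    ultimately show "\<bar>y\<bar> \<le> \<rho> \<and> \<bar>x\<bar> \<le> sqrt (\<rho>\<^sup>2 - y\<^sup>2)"
      by simp
  next
    assume *: "\<bar>y\<bar> \<le> \<rho> \<and> \<bar>x\<bar> \<le> sqrt (\<rho>\<^sup>2 - y\<^sup>2)"
    then have "y\<^sup>2 \<le> \<rho>\<^sup>2"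
      using assms by (simp add: abs_le_square_iff[symmetric])
    then have "(sqrt (\<rho>\<^sup>2 - y\<^sup>2))\<^sup>2 = \<rho>\<^sup>2 - y\<^sup>2"
      by simp
    moreover have "\<bar>x\<bar>\<^sup>2 \<le> (sqrt (\<rho>\<^sup>2 - y\<^sup>2))\<^sup>2"
      using * by (intro power_mono) auto
    ultimately show "x\<^sup>2 + y\<^sup>2 \<le> \<rho>\<^sup>2"
      by simp
  qed
  also have "\<dots> \<longleftrightarrow> \<bar>y\<bar> \<le> \<rho> \<and> - sqrt (\<rho>\<^sup>2 - y\<^sup>2) \<le> x \<and> x \<le> sqrt (\<rho>\<^sup>2 - y\<^sup>2)"
    by (auto simp: abs_le_iff)
  finally show ?thesis .
qed

text \<open>For a \<le> b, cut the interval from a to b + T once at a + T and once at b; the pieces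
  of length b - a agree by periodicity.\<close>

lemma integral_periodic_shift:
  fixes f :: "real \<Rightarrow> 'b::euclidean_space"
  assumes cont: "continuous_on UNIV f" and period: "\<And>t. f (t + T) = f t" and "T \<ge> 0"
  shows "integral {a..a + T} f = integral {b..b + T} f"
proof -
  have *: "integral {a..a + T} f = integral {b..b + T} f" if "a \<le> b" for a b
  proof -
    have int: "f integrable_on {u..v}" for u v
      using cont by (intro integrable_continuous_interval) (auto intro: continuous_on_subset)
    have "integral {a + T..b + T} f = integral {a..b} (f \<circ> (\<lambda>t. t + T))"
      by (rule integral_shift[symmetric]) (use cont continuous_on_subset in blast)
    also have "\<dots> = integral {a..b} f"
      by (simp add: o_def period)
    finally have "integral {a..b + T} f = integral {a..a + T} f + integral {a..b} f"
      using Henstock_Kurzweil_Integration.integral_combine[where a = a and c = "a + T" and b = "b + T" and f = f] int that \<open>T \<ge> 0\<close> by simp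
    moreover have "integral {a..b + T} f = integral {a..b} f + integral {b..b + T} f"
      using Henstock_Kurzweil_Integration.integral_combine[where a = a and c = b and b = "b + T" and f = f] int that \<open>T \<ge> 0\<close> by simp
    ultimately show ?thesis by simp
  qed
  then show ?thesis
    by (cases "a \<le> b") (auto intro: *[symmetric])
qed

text \<open>The inner integral is the value of \<open>Q\<close> at the right end of the chord minus
  that at the left end. With y = \<rho> sin t for t in [-pi/2, pi/2], the right ends trace the right
  half of the circle. The left ends are the points at angle pi - t, and cos (pi - t) = - cos t
  absorbs the minus sign; they fill the angles [pi/2, 3 pi/2], which explains the range.\<close>

lemma green_disk_x:
  fixes Q Qx :: "real \<Rightarrow> real \<Rightarrow> 'b::euclidean_space"
  assumes \<rho>: "\<rho> > 0" and cont: "continuous_on (cball 0 \<rho>) (\<lambda>(x, y). Q x y)"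
    and deriv: "\<And>x y. (x, y) \<in> ball 0 \<rho> \<Longrightarrow> ((\<lambda>x. Q x y) has_vector_derivative Qx x y) (at x)"
  shows "integral UNIV (\<lambda>y. integral {x. (x, y) \<in> cball (0 :: real \<times> real) \<rho>} (\<lambda>x. Qx x y)) =
    integral {-(pi/2)..3 * pi / 2} (\<lambda>t. (\<rho> * cos t) *\<^sub>R Q (\<rho> * cos t) (\<rho> * sin t))"
proof -
  define s where "s y = sqrt (\<rho>\<^sup>2 - y\<^sup>2)" for y
  define g where "g y = Q (s y) y - Q (- s y) y" for y
  define E where "E t = (\<rho> * cos t) *\<^sub>R Q (\<rho> * cos t) (\<rho> * sin t)" for t
  have s_nonneg: "s y \<ge> 0" if "\<bar>y\<bar> \<le> \<rho>" for y
    using that \<rho> by (auto simp: s_def abs_le_square_iff[symmetric])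
  have in_cball: "(x, y) \<in> cball (0::real \<times> real) \<rho> \<longleftrightarrow> \<bar>y\<bar> \<le> \<rho> \<and> - s y \<le> x \<and> x \<le> s y" for x y
    using cball_slice[OF \<rho>] by (simp add: s_def)
  have in_ball: "(x, y) \<in> ball (0::real \<times> real) \<rho>" if "- s y < x" "x < s y" "\<bar>y\<bar> \<le> \<rho>" for x y
  proof -
    have "\<bar>x\<bar>\<^sup>2 < (s y)\<^sup>2"
      using that by (intro power_strict_mono) auto
    moreover have "(s y)\<^sup>2 = \<rho>\<^sup>2 - y\<^sup>2"
      using that \<rho> by (simp add: s_def abs_le_square_iff[symmetric])
    ultimately have "sqrt (x\<^sup>2 + y\<^sup>2) < sqrt (\<rho>\<^sup>2)"
      by (intro real_sqrt_less_mono) simp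
    then show ?thesis
      using \<rho> by (simp add: dist_norm norm_Pair)
  qed
  have slice: "integral {x. (x, y) \<in> cball (0 :: real \<times> real) \<rho>} (\<lambda>x. Qx x y) = (if y \<in> {-\<rho>..\<rho>} then g y else 0)" for y
  proof (cases "\<bar>y\<bar> \<le> \<rho>")
    case True
    have set: "{x. (x, y) \<in> cball (0 :: real \<times> real) \<rho>} = {- s y..s y}"
      using True by (auto simp: in_cball simp del: mem_cball mem_cball_0)
    have "((\<lambda>x. Qx x y) has_integral Q (s y) y - Q (- s y) y) {- s y..s y}"
    proof (rule fundamental_theorem_of_calculus_interior)
      show "- s y \<le> s y"
        using s_nonneg[OF True] by simp
      have "continuous_on {- s y..s y} (\<lambda>x. (\<lambda>(x, y). Q x y) (x, y))"
        using True by (intro continuous_on_compose2[OF cont] continuous_intros) (auto simp: in_cball simp del: mem_cball mem_cball_0)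
      then show "continuous_on {- s y..s y} (\<lambda>x. Q x y)"
        by simp
      show "((\<lambda>x. Q x y) has_vector_derivative Qx x y) (at x)" if "x \<in> {- s y<..<s y}" for x
        using that True by (intro deriv in_ball) auto
    qed
    then show ?thesis
      using True unfolding set by (auto simp: g_def integral_unique)
  next
    case False
    then have "{x. (x, y) \<in> cball (0 :: real \<times> real) \<rho>} = {}"
      by (auto simp: in_cball simp del: mem_cball mem_cball_0)
    then show ?thesis
      using False by auto
  qed
  have contE: "continuous_on UNIV E"
  proof -
    have "continuous_on UNIV (\<lambda>t. (\<lambda>(x, y). Q x y) (\<rho> * cos t, \<rho> * sin t))"
    proof (intro continuous_on_compose2[OF cont] continuous_intros)
      have "(\<rho> * cos t)\<^sup>2 + (\<rho> * sin t)\<^sup>2 = \<rho>\<^sup>2" for t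
        by (simp add: power_mult_distrib distrib_left[symmetric])
      then show "(\<lambda>t. (\<rho> * cos t, \<rho> * sin t)) ` UNIV \<subseteq> cball 0 \<rho>"
        using \<rho> by (auto simp: dist_norm norm_Pair)
    qed
    then show ?thesis
      unfolding E_def by (intro continuous_intros) simp
  qed
  have intE: "E integrable_on {u..v}" for u v
    using contE by (intro integrable_continuous_interval) (auto intro: continuous_on_subset)
  have cont_s: "continuous_on {-\<rho>..\<rho>} s"
    unfolding s_def by (intro continuous_intros)
  have contg: "continuous_on {-\<rho>..\<rho>} g"
  proof -
    have "continuous_on {-\<rho>..\<rho>} (\<lambda>y. (\<lambda>(x, y). Q x y) (s y, y))"
      "continuous_on {-\<rho>..\<rho>} (\<lambda>y. (\<lambda>(x, y). Q x y) (- s y, y))"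
      using s_nonneg
      by (intro continuous_on_compose2[OF cont] continuous_intros cont_s; force simp: in_cball simp del: mem_cball mem_cball_0)+
    then show ?thesis
      unfolding g_def by (intro continuous_intros) simp_all
  qed
  have "integral {-\<rho>..\<rho>} g = integral {-(pi/2)..pi/2} (\<lambda>t. (\<rho> * cos t) *\<^sub>R g (\<rho> * sin t))"
  proof -
    have "((\<lambda>t. (\<rho> * cos t) *\<^sub>R g (\<rho> * sin t)) has_integral
        integral {\<rho> * sin (-(pi/2))..\<rho> * sin (pi/2)} g) {-(pi/2)..pi/2}"
    proof (rule has_integral_substitution[OF _ _ _ contg])
      have "\<bar>\<rho> * sin t\<bar> \<le> \<rho>" for t
        using \<rho> abs_sin_le_one[of t] mult_left_le[of "\<bar>sin t\<bar>" \<rho>] by (simp add: abs_mult)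
      then show "(\<lambda>t. \<rho> * sin t) ` {-(pi/2)..pi/2} \<subseteq> {-\<rho>..\<rho>}"
        by (auto simp: abs_le_iff minus_le_iff)
    qed (use \<rho> in \<open>auto intro!: derivative_eq_intros\<close>)
    then show ?thesis
      by (simp add: integral_unique)
  qed
  also have "\<dots> = integral {-(pi/2)..pi/2} (\<lambda>t. E t + E (pi - t))"
  proof (rule integral_cong)
    fix t assume t: "t \<in> {-(pi/2)..pi/2}"
    \<comment> \<open>Nonnegativity of cos on this range selects the correct branch of the square
      root in \<open>s\<close>.\<close>
    then have "cos t \<ge> 0"
      by (intro cos_ge_zero) auto
    moreover have "\<rho>\<^sup>2 - (\<rho> * sin t)\<^sup>2 = (\<rho> * cos t)\<^sup>2"
      by (simp add: cos_squared_eq power_mult_distrib algebra_simps)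
    ultimately have "s (\<rho> * sin t) = \<rho> * cos t"
      using \<rho> by (simp add: s_def)
    then show "(\<rho> * cos t) *\<^sub>R g (\<rho> * sin t) = E t + E (pi - t)"
      by (simp add: g_def E_def algebra_simps)
  qed
  also have "\<dots> = integral {-(pi/2)..pi/2} E + integral {-(pi/2)..pi/2} (\<lambda>t. E (pi - t))"
    by (intro integral_add intE integrable_continuous_interval continuous_on_compose2[OF contE] continuous_intros) auto
  \<comment> \<open>The reflection t \<mapsto> -t and a shift by pi carry the left half to
    [pi/2, 3 pi/2].\<close>
  also have "integral {-(pi/2)..pi/2} (\<lambda>t. E (pi - t)) = integral {-(pi/2)..pi/2} (E \<circ> (\<lambda>t. t + pi))"
    using Henstock_Kurzweil_Integration.integral_reflect_real[of "pi/2" "-(pi/2)" "\<lambda>t. E (t + pi)"]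
    by (simp add: o_def)
  also have "\<dots> = integral {-(pi/2) + pi..pi/2 + pi} E"
    by (rule integral_shift) (use contE continuous_on_subset in blast)
  also have "integral {-(pi/2)..pi/2} E + \<dots> = integral {-(pi/2)..3 * pi / 2} E"
    using Henstock_Kurzweil_Integration.integral_combine[where a = "-(pi/2)" and c = "pi/2" and b = "3 * pi / 2" and f = E] intE by simp
  finally show ?thesis
    unfolding slice Henstock_Kurzweil_Integration.integral_restrict_UNIV by (simp add: E_def[abs_def])
qed

text \<open>Exchange the coordinates in the previous formula. The circle is then traversed clockwise
  as (\<rho> sin t, \<rho> cos t); substituting pi/2 - t restores the orientation and turns the
  range into [-pi, pi].\<close>

lemma green_disk_y:
  fixes P Py :: "real \<Rightarrow> real \<Rightarrow> 'b::euclidean_space"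
  assumes \<rho>: "\<rho> > 0" and cont: "continuous_on (cball 0 \<rho>) (\<lambda>(x, y). P x y)"
    and deriv: "\<And>x y. (x, y) \<in> ball 0 \<rho> \<Longrightarrow> ((\<lambda>y. P x y) has_vector_derivative Py x y) (at y)"
  shows "integral UNIV (\<lambda>x. integral {y. (x, y) \<in> cball (0 :: real \<times> real) \<rho>} (\<lambda>y. Py x y)) =
    integral {-pi..pi} (\<lambda>t. (\<rho> * sin t) *\<^sub>R P (\<rho> * cos t) (\<rho> * sin t))"
proof -
  have swap: "(x, y) \<in> cball (0::real \<times> real) \<rho> \<longleftrightarrow> (y, x) \<in> cball (0::real \<times> real) \<rho>"
    "(x, y) \<in> ball (0::real \<times> real) \<rho> \<longleftrightarrow> (y, x) \<in> ball (0::real \<times> real) \<rho>" for x y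
    by (simp_all add: dist_norm norm_Pair add.commute)
  define K where "K t = (\<rho> * sin t) *\<^sub>R P (\<rho> * cos t) (\<rho> * sin t)" for t
  have contK: "continuous_on UNIV K"
  proof -
    have "continuous_on UNIV (\<lambda>t. (\<lambda>(x, y). P x y) (\<rho> * cos t, \<rho> * sin t))"
    proof (intro continuous_on_compose2[OF cont] continuous_intros)
      have "(\<rho> * cos t)\<^sup>2 + (\<rho> * sin t)\<^sup>2 = \<rho>\<^sup>2" for t
        by (simp add: power_mult_distrib distrib_left[symmetric])
      then show "(\<lambda>t. (\<rho> * cos t, \<rho> * sin t)) ` UNIV \<subseteq> cball 0 \<rho>"
        using \<rho> by (auto simp: dist_norm norm_Pair)
    qed
    then show ?thesis
      unfolding K_def by (intro continuous_intros) simp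
  qed
  have "continuous_on (cball 0 \<rho>) (\<lambda>p. (\<lambda>(x, y). P x y) (snd p, fst p))"
    by (intro continuous_on_compose2[OF cont] continuous_intros) (auto simp: swap simp del: mem_cball mem_cball_0)
  then have "integral UNIV (\<lambda>x. integral {y. (y, x) \<in> cball (0 :: real \<times> real) \<rho>} (\<lambda>y. Py x y)) =
      integral {-(pi/2)..3 * pi / 2} (\<lambda>t. (\<rho> * cos t) *\<^sub>R P (\<rho> * sin t) (\<rho> * cos t))"
    using deriv swap
    by (intro green_disk_x[OF \<rho>, of "\<lambda>y x. P x y" "\<lambda>y x. Py x y"]) (auto simp: case_prod_unfold simp del: mem_ball mem_ball_0)
  also have "\<dots> = integral {-pi + pi/2..pi + pi/2} (\<lambda>t. K (pi/2 - t))"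
    by (simp add: K_def cos_diff sin_diff)
  also have "\<dots> = integral {-pi..pi} ((\<lambda>t. K (pi/2 - t)) \<circ> (\<lambda>t. t + pi/2))"
    by (rule integral_shift[symmetric]) (auto intro!: continuous_on_compose2[OF contK] continuous_intros)
  also have "\<dots> = integral {-pi..pi} K"
    using Henstock_Kurzweil_Integration.integral_reflect_real[of pi "-pi" K] by (simp add: o_def)
  finally show ?thesis
    using swap(1) by (simp add: K_def[abs_def] del: mem_cball mem_cball_0)
qed

text \<open>Continuity of \<open>Py\<close> and \<open>Qx\<close> on the closed disk serves Fubini;
  the two boundary integrals begin at different angles and are aligned by periodicity.\<close>

lemma green_disk:
  fixes P Q Py Qx :: "real \<Rightarrow> real \<Rightarrow> 'b::euclidean_space"
  assumes \<rho>: "\<rho> > 0"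
    and cont: "continuous_on (cball 0 \<rho>) (\<lambda>(x, y). P x y)" "continuous_on (cball 0 \<rho>) (\<lambda>(x, y). Q x y)"
      "continuous_on (cball 0 \<rho>) (\<lambda>(x, y). Py x y)" "continuous_on (cball 0 \<rho>) (\<lambda>(x, y). Qx x y)"
    and deriv: "\<And>x y. (x, y) \<in> ball 0 \<rho> \<Longrightarrow> ((\<lambda>x. Q x y) has_vector_derivative Qx x y) (at x)"
      "\<And>x y. (x, y) \<in> ball 0 \<rho> \<Longrightarrow> ((\<lambda>y. P x y) has_vector_derivative Py x y) (at y)"
  shows "integral (cball 0 \<rho>) (\<lambda>(x, y). Qx x y - Py x y) =
    integral {-pi..pi} (\<lambda>t. (\<rho> * cos t) *\<^sub>R Q (\<rho> * cos t) (\<rho> * sin t) - (\<rho> * sin t) *\<^sub>R P (\<rho> * cos t) (\<rho> * sin t))"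
proof -
  have circle: "continuous_on S (\<lambda>t. F (\<rho> * cos t) (\<rho> * sin t))"
    if F: "continuous_on (cball 0 \<rho>) (\<lambda>(x, y). F x y)" for F :: "real \<Rightarrow> real \<Rightarrow> 'b" and S
  proof -
    have "(\<rho> * cos t)\<^sup>2 + (\<rho> * sin t)\<^sup>2 = \<rho>\<^sup>2" for t
      by (simp add: power_mult_distrib distrib_left[symmetric])
    then have "continuous_on S (\<lambda>t. (\<lambda>(x, y). F x y) (\<rho> * cos t, \<rho> * sin t))"
      using \<rho> by (intro continuous_on_compose2[OF F] continuous_intros) (auto simp: dist_norm norm_Pair)
    then show ?thesis by simp
  qed
  have "integral (cball 0 \<rho>) (\<lambda>(x, y). Qx x y - Py x y) =
      integral (cball 0 \<rho>) (\<lambda>(x, y). Qx x y) - integral (cball 0 \<rho>) (\<lambda>(x, y). Py x y)"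
    using integral_diff[OF compact_continuous_integrable_on[OF compact_cball cont(4)]
        compact_continuous_integrable_on[OF compact_cball cont(3)]]
    by (simp add: case_prod_unfold)
  also have "integral (cball 0 \<rho>) (\<lambda>(x, y). Qx x y) =
      integral {-(pi/2)..-(pi/2) + 2 * pi} (\<lambda>t. (\<rho> * cos t) *\<^sub>R Q (\<rho> * cos t) (\<rho> * sin t))"
    using integral_iterated_compact(1)[OF compact_cball cont(4)] green_disk_x[OF \<rho> cont(2) deriv(1)]
    by simp
  also have "\<dots> = integral {-pi..-pi + 2 * pi} (\<lambda>t. (\<rho> * cos t) *\<^sub>R Q (\<rho> * cos t) (\<rho> * sin t))"
    by (rule integral_periodic_shift) (auto intro!: continuous_intros circle[OF cont(2)])
  also have "integral (cball 0 \<rho>) (\<lambda>(x, y). Py x y) =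
      integral {-pi..-pi + 2 * pi} (\<lambda>t. (\<rho> * sin t) *\<^sub>R P (\<rho> * cos t) (\<rho> * sin t))"
    using integral_iterated_compact(2)[OF compact_cball cont(3)] green_disk_y[OF \<rho> cont(1) deriv(2)]
    by simp
  finally show ?thesis
    by (subst integral_diff)
      (auto intro!: integrable_continuous_interval continuous_intros circle[OF cont(1)] circle[OF cont(2)])
qed


section \<open>Differentiation under the integral and exhaustion of the disk\<close>

text \<open>Uniform continuity of \<open>f'\<close> on a compact neighbourhood of \<open>e\<close>
  times \<open>K\<close> bounds the linearisation error of \<open>f t x\<close> by a small multiple
  of \<open>norm (t - e)\<close>, uniformly in \<open>x\<close>; this bound can be
  integrated.\<close>

lemma has_vector_derivative_integral_compact:
  fixes f f' :: "real \<Rightarrow> 'a::euclidean_space \<Rightarrow> 'b::euclidean_space"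
  assumes K: "compact K" and e: "e \<in> {a<..<b}"
    and cont: "\<And>t. t \<in> {a<..<b} \<Longrightarrow> continuous_on K (f t)"
      "continuous_on ({a<..<b} \<times> K) (\<lambda>(t, x). f' t x)"
    and deriv: "\<And>t x. t \<in> {a<..<b} \<Longrightarrow> x \<in> K \<Longrightarrow> ((\<lambda>t. f t x) has_vector_derivative f' t x) (at t)"
  shows "((\<lambda>t. integral K (f t)) has_vector_derivative integral K (f' e)) (at e)"
proof -
  define M where "M = integral K (\<lambda>_. 1 :: real)"
  have int1: "(\<lambda>_. c :: real) integrable_on K" for c
    by (rule compact_continuous_integrable_on[OF K]) simp
  have "M \<ge> 0"
    unfolding M_def by (rule Henstock_Kurzweil_Integration.integral_nonneg[OF int1]) simp
  obtain d where d: "d > 0" "cball e d \<subseteq> {a<..<b}"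
    using e open_contains_cball[of "{a<..<b}"] open_greaterThanLessThan by blast
  have cont': "continuous_on K (f' t)" if "t \<in> {a<..<b}" for t
  proof -
    have "continuous_on K (\<lambda>x. (\<lambda>(t, x). f' t x) (t, x))"
      using that by (intro continuous_on_compose2[OF cont(2)] continuous_intros) auto
    then show ?thesis by simp
  qed
  have "compact (cball e d \<times> K)"
    by (intro compact_Times compact_cball K)
  moreover have "continuous_on (cball e d \<times> K) (\<lambda>(t, x). f' t x)"
    by (rule continuous_on_subset[OF cont(2)]) (use d in blast)
  ultimately have unif: "uniformly_continuous_on (cball e d \<times> K) (\<lambda>(t, x). f' t x)"
    by (intro compact_uniformly_continuous)
  have "\<forall>\<eta>>0. \<exists>\<delta>>0. \<forall>t. norm (t - e) < \<delta> \<longrightarrow>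
      norm (integral K (f t) - integral K (f e) - (t - e) *\<^sub>R integral K (f' e)) \<le> \<eta> * norm (t - e)"
  proof (intro allI impI)
    fix \<eta> :: real assume "\<eta> > 0"
    \<comment> \<open>\<open>M\<close> is the volume of \<open>K\<close>; the added 1 keeps
      \<open>\<eta>'\<close> positive when \<open>K\<close> is a null set.\<close>
    define \<eta>' where "\<eta>' = \<eta> / (M + 1)"
    have \<eta>': "\<eta>' > 0" "\<eta>' * M \<le> \<eta>"
      using \<open>\<eta> > 0\<close> \<open>M \<ge> 0\<close> by (simp_all add: \<eta>'_def field_simps)
    obtain \<delta> where \<delta>: "\<delta> > 0" and close: "\<And>p q. p \<in> cball e d \<times> K \<Longrightarrow> q \<in> cball e d \<times> K \<Longrightarrow>
        dist q p < \<delta> \<Longrightarrow> dist ((\<lambda>(t, x). f' t x) q) ((\<lambda>(t, x). f' t x) p) < \<eta>'"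
      using unif \<eta>'(1) unfolding uniformly_continuous_on_def by metis
    have "norm (integral K (f t) - integral K (f e) - (t - e) *\<^sub>R integral K (f' e)) \<le> \<eta> * norm (t - e)"
      if t: "norm (t - e) < min d \<delta>" for t
    proof -
      define S where "S = cball e (norm (t - e))"
      have "S \<subseteq> cball e d"
        unfolding S_def using t by (intro subset_cball) simp
      then have S: "S \<subseteq> cball e d" "S \<subseteq> {a<..<b}" "t \<in> S" "e \<in> S"
        using d(2) by (auto simp: S_def dist_norm norm_minus_commute simp del: greaterThanLessThan_iff)
      have bound: "norm (f t x - f e x - (t - e) *\<^sub>R f' e x) \<le> norm (t - e) * \<eta>'" if x: "x \<in> K" for x
      proof (rule vector_differentiable_bound_linearization[where S = S and f = "\<lambda>t. f t x" and f' = "\<lambda>t. f' t x"])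
        show "((\<lambda>t. f t x) has_vector_derivative f' s x) (at s within S)" if "s \<in> S" for s
          by (rule has_vector_derivative_at_within[OF deriv[OF subsetD[OF S(2) that] x]])
        show "closed_segment e t \<subseteq> S"
          using S by (intro closed_segment_subset) (auto simp: S_def)
        show "norm (f' s x - f' e x) \<le> \<eta>'" if "s \<in> S" for s
        proof -
          have "dist (s, x) (e, x) < \<delta>"
            using that t by (auto simp: S_def dist_Pair_Pair dist_commute dist_real_def)
          then have "dist (f' s x) (f' e x) < \<eta>'"
            using close[of "(e, x)" "(s, x)"] subsetD[OF S(1) that] subsetD[OF S(1) S(4)] x by simp
          then show ?thesis
            by (simp add: dist_norm)
        qed
      qed (rule S(4))
      have te: "t \<in> {a<..<b}" "e \<in> {a<..<b}"
        using S(2-4) by blast+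
      have int: "f t integrable_on K" "f e integrable_on K" "f' e integrable_on K"
        using te by (auto intro!: compact_continuous_integrable_on[OF K] cont(1) cont')
      have "integral K (f t) - integral K (f e) - (t - e) *\<^sub>R integral K (f' e) =
          integral K (\<lambda>x. f t x - f e x - (t - e) *\<^sub>R f' e x)"
        using int by (simp add: Henstock_Kurzweil_Integration.integral_diff integrable_diff integrable_cmul)
      also have "norm \<dots> \<le> integral K (\<lambda>x. norm (t - e) * \<eta>')"
        by (intro Henstock_Kurzweil_Integration.integral_norm_bound_integral int1 bound
            integrable_diff integrable_cmul int)
      also have "\<dots> = norm (t - e) * \<eta>' * M"
        using integral_mult_right[of K "norm (t - e) * \<eta>'" "\<lambda>_. 1"] by (simp add: M_def)
      also have "\<dots> \<le> \<eta> * norm (t - e)"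
        using \<eta>'(2) mult_left_mono[OF \<eta>'(2), of "norm (t - e)"] by (simp add: algebra_simps)
      finally show ?thesis .
    qed
    then show "\<exists>\<delta>>0. \<forall>t. norm (t - e) < \<delta> \<longrightarrow>
      norm (integral K (f t) - integral K (f e) - (t - e) *\<^sub>R integral K (f' e)) \<le> \<eta> * norm (t - e)"
      using d(1) \<delta> by (intro exI[of _ "min d \<delta>"]) auto
  qed
  then show ?thesis
    unfolding has_vector_derivative_def has_derivative_at_alt
    by (auto intro: bounded_linear_scaleR_left)
qed

text \<open>Each point of the open ball lies in all but finitely many of the smaller balls, so
  dominated convergence applies there; the sphere is negligible.\<close>

lemma integral_cball_exhaustion:
  fixes f :: "'a::euclidean_space \<Rightarrow> 'b::euclidean_space"
  assumes f: "continuous_on (cball 0 1) f" and \<rho>: "\<And>n. \<rho> n < 1" "\<rho> \<longlonglongrightarrow> 1"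
  shows "(\<lambda>n. integral (cball 0 (\<rho> n)) f) \<longlonglongrightarrow> integral (cball 0 1) f"
proof -
  obtain B where B: "\<forall>x\<in>cball 0 1. norm (f x) \<le> B"
    using compact_imp_bounded[OF compact_continuous_image[OF f compact_cball]]
    unfolding bounded_iff by blast
  define g where "g n x = (if x \<in> cball 0 (\<rho> n) then f x else 0)" for n x
  have cball_sub: "cball 0 (\<rho> n) \<subseteq> ball (0::'a) 1" for n
    using \<rho>(1)[of n] by (auto simp: subset_iff)
  have int: "f integrable_on cball 0 (\<rho> n)" for n
    using cball_sub[of n] ball_subset_cball[of "0::'a" 1]
    by (intro compact_continuous_integrable_on continuous_on_subset[OF f]) auto
  have "(\<lambda>n. integral (ball 0 1) (g n)) \<longlonglongrightarrow> integral (ball 0 1) f"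
  proof (rule dominated_convergence(2))
    show "g n integrable_on ball 0 1" for n
      unfolding g_def Henstock_Kurzweil_Integration.integrable_restrict_Int
      using int[of n] cball_sub[of n] by (simp add: Int_absorb2)
    show "(\<lambda>_. \<bar>B\<bar>) integrable_on ball (0::'a) 1"
      by (rule integrable_on_const[OF lmeasurable_ball])
    show "norm (g n x) \<le> \<bar>B\<bar>" if "x \<in> ball 0 1" for n x
      using bspec[OF B, of x] that by (auto simp: g_def)
    show "(\<lambda>n. g n x) \<longlonglongrightarrow> f x" if "x \<in> ball 0 1" for x
    proof (rule tendsto_eventually)
      have "norm x < 1"
        using that by simp
      then have "\<forall>\<^sub>F n in sequentially. norm x < \<rho> n"
        using \<rho>(2) by (rule order_tendstoD(1)[rotated])
      then show "\<forall>\<^sub>F n in sequentially. g n x = f x"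
        by eventually_elim (simp add: g_def)
    qed
  qed
  moreover have "integral (ball 0 1) (g n) = integral (cball 0 (\<rho> n)) f" for n
    unfolding g_def Henstock_Kurzweil_Integration.integral_restrict_Int
    using cball_sub[of n] by (simp add: Int_absorb2)
  moreover have "integral (ball 0 1) f = integral (cball 0 1) f"
  proof (rule integral_spike_set)
    have "negligible (cball 0 1 - ball (0::'a) 1)"
      by (simp add: cball_diff_eq_sphere negligible_sphere)
    then show "negligible {x \<in> cball 0 1 - ball 0 1. f x \<noteq> 0}"
      by (rule negligible_subset) auto
    have "{x \<in> ball 0 1 - cball 0 1. f x \<noteq> 0} = {}"
      by auto
    then show "negligible {x \<in> ball 0 1 - cball 0 1. f x \<noteq> 0}"
      by (metis negligible_empty)
  qed
  ultimately show ?thesis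
    by simp
qed

text \<open>
  Only \<open>P\<close>, \<open>Q\<close> and \<open>R\<close> are controlled up to the boundary, so the identity is
  first obtained on the disks of radius \<open>\<rho> < 1\<close>.
\<close>

lemma closed_form_disk_derivative:
  fixes P Q R Py Qx :: "real \<Rightarrow> real \<Rightarrow> real \<Rightarrow> 'b::euclidean_space"
  assumes \<epsilon>: "\<epsilon> \<in> {-r<..<r}"
    and cont: "continuous_on ({-r<..<r} \<times> cball 0 1) (\<lambda>(e, x, y). P e x y)"
      "continuous_on ({-r<..<r} \<times> cball 0 1) (\<lambda>(e, x, y). Q e x y)"
      "continuous_on ({-r<..<r} \<times> cball 0 1) (\<lambda>(e, x, y). R e x y)"
    and cont': "continuous_on ({-r<..<r} \<times> ball 0 1) (\<lambda>(e, x, y). Py e x y)"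
      "continuous_on ({-r<..<r} \<times> ball 0 1) (\<lambda>(e, x, y). Qx e x y)"
    and deriv: "\<And>e x y. e \<in> {-r<..<r} \<Longrightarrow> (x, y) \<in> ball 0 1 \<Longrightarrow>
        ((\<lambda>y. P e x y) has_vector_derivative Py e x y) (at y)"
      "\<And>e x y. e \<in> {-r<..<r} \<Longrightarrow> (x, y) \<in> ball 0 1 \<Longrightarrow>
        ((\<lambda>x. Q e x y) has_vector_derivative Qx e x y) (at x)"
      "\<And>e x y. e \<in> {-r<..<r} \<Longrightarrow> (x, y) \<in> ball 0 1 \<Longrightarrow>
        ((\<lambda>e. R e x y) has_vector_derivative Qx e x y - Py e x y) (at e)"
  shows "((\<lambda>e. integral (cball 0 1) (\<lambda>(x, y). R e x y)) has_vector_derivative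
    integral {-pi..pi} (\<lambda>t. cos t *\<^sub>R Q \<epsilon> (cos t) (sin t) - sin t *\<^sub>R P \<epsilon> (cos t) (sin t))) (at \<epsilon>)"
proof -
  \<comment> \<open>The boundary integral over the circle of radius \<open>\<rho>\<close>. It
    involves \<open>P\<close> and \<open>Q\<close> alone, so it is continuous up to radius
    1.\<close>
  define J where "J e \<rho> = integral {-pi..pi} (\<lambda>t. (\<rho> * cos t) *\<^sub>R Q e (\<rho> * cos t) (\<rho> * sin t) -
    (\<rho> * sin t) *\<^sub>R P e (\<rho> * cos t) (\<rho> * sin t))" for e \<rho>
  define I where "I \<rho> e = integral (cball 0 \<rho>) (\<lambda>(x, y). R e x y)" for \<rho> e
  have slice: "continuous_on T (\<lambda>(x, y). F e x y)"
    if "continuous_on ({-r<..<r} \<times> S) (\<lambda>(e, x, y). F e x y)" "e \<in> {-r<..<r}" "T \<subseteq> S"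
    for F :: "real \<Rightarrow> real \<Rightarrow> real \<Rightarrow> 'b" and S T e
  proof -
    have "continuous_on T (\<lambda>p. (\<lambda>(e, x, y). F e x y) (e, p))"
      using that by (intro continuous_on_compose2[OF that(1)] continuous_intros) auto
    then show ?thesis
      by (simp add: case_prod_unfold)
  qed
  have deriv_I: "(I \<rho> has_vector_derivative J e \<rho>) (at e)" if e: "e \<in> {-r<..<r}" and \<rho>: "0 < \<rho>" "\<rho> < 1" for e \<rho>
  proof -
    have sub: "cball 0 \<rho> \<subseteq> ball (0 :: real \<times> real) 1" "cball 0 \<rho> \<subseteq> cball (0 :: real \<times> real) 1"
        "ball 0 \<rho> \<subseteq> ball (0 :: real \<times> real) 1"
      using \<rho> by (auto simp: subset_iff)
    have "(I \<rho> has_vector_derivative integral (cball 0 \<rho>) (\<lambda>(x, y). Qx e x y - Py e x y)) (at e)"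
      unfolding I_def
    proof (rule has_vector_derivative_integral_compact[OF compact_cball e])
      show "continuous_on (cball 0 \<rho>) (\<lambda>(x, y). R t x y)" if "t \<in> {-r<..<r}" for t
        by (rule slice[OF cont(3) that sub(2)])
      have "continuous_on ({-r<..<r} \<times> cball 0 \<rho>) (\<lambda>p. (\<lambda>(e, x, y). Qx e x y) p - (\<lambda>(e, x, y). Py e x y) p)"
        using sub(1) by (intro continuous_on_diff continuous_on_subset[OF cont'(1)] continuous_on_subset[OF cont'(2)]) auto
      then show "continuous_on ({-r<..<r} \<times> cball 0 \<rho>) (\<lambda>(t, x, y). Qx t x y - Py t x y)"
        by (simp add: case_prod_unfold)
      show "((\<lambda>t. case x of (x, y) \<Rightarrow> R t x y) has_vector_derivative (case x of (x, y) \<Rightarrow> Qx t x y - Py t x y)) (at t)"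
        if "t \<in> {-r<..<r}" "x \<in> cball 0 \<rho>" for t x
        using deriv(3)[of t "fst x" "snd x"] that sub(1) by (auto simp: case_prod_unfold)
    qed
    also have "integral (cball 0 \<rho>) (\<lambda>(x, y). Qx e x y - Py e x y) = J e \<rho>"
      unfolding J_def using e sub
      by (intro green_disk[OF \<rho>(1)] slice[OF cont(1)] slice[OF cont(2)] slice[OF cont'(1)] slice[OF cont'(2)] deriv) auto
    finally show ?thesis .
  qed
  obtain d where d: "d > 0" "cball \<epsilon> d \<subseteq> {-r<..<r}"
    using \<epsilon> open_contains_cball[of "{-r<..<r}"] open_greaterThanLessThan by blast
  \<comment> \<open>Joint continuity in parameter and radius on a compact set makes
    \<open>J e \<rho>\<close> tend to \<open>J e 1\<close> uniformly in \<open>e\<close>.\<close>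
  have "continuous_on (cball \<epsilon> d \<times> {0..1}) (\<lambda>p. integral (cbox (-pi) pi)
      ((\<lambda>p t. (snd p * cos t) *\<^sub>R Q (fst p) (snd p * cos t) (snd p * sin t) -
        (snd p * sin t) *\<^sub>R P (fst p) (snd p * cos t) (snd p * sin t)) p))"
  proof (rule integral_continuous_on_param)
    have "continuous_on ((cball \<epsilon> d \<times> {0..1}) \<times> cbox (-pi) pi)
        (\<lambda>z. (\<lambda>(e, x, y). F e x y) (fst (fst z), snd (fst z) * cos (snd z), snd (fst z) * sin (snd z)))"
      if "continuous_on ({-r<..<r} \<times> cball 0 1) (\<lambda>(e, x, y). F e x y)" for F :: "real \<Rightarrow> real \<Rightarrow> real \<Rightarrow> 'b"
    proof (intro continuous_on_compose2[OF that] continuous_intros)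
      have "(\<rho> * cos t)\<^sup>2 + (\<rho> * sin t)\<^sup>2 = \<rho>\<^sup>2" for t \<rho> :: real
        by (simp add: power_mult_distrib distrib_left[symmetric])
      then show "(\<lambda>z. (fst (fst z), snd (fst z) * cos (snd z), snd (fst z) * sin (snd z))) `
          ((cball \<epsilon> d \<times> {0..1}) \<times> cbox (-pi) pi) \<subseteq> {-r<..<r} \<times> cball 0 1"
        using d(2) by (auto simp: dist_norm norm_Pair simp del: greaterThanLessThan_iff)
    qed
    from this[OF cont(1)] this[OF cont(2)]
    show "continuous_on ((cball \<epsilon> d \<times> {0..1}) \<times> cbox (-pi) pi)
      (\<lambda>(p, t). (snd p * cos t) *\<^sub>R Q (fst p) (snd p * cos t) (snd p * sin t) -
        (snd p * sin t) *\<^sub>R P (fst p) (snd p * cos t) (snd p * sin t))"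
      unfolding case_prod_unfold by (intro continuous_intros) simp_all
  qed
  then have "continuous_on (cball \<epsilon> d \<times> {0..1}) (\<lambda>p. J (fst p) (snd p))"
    by (simp add: J_def)
  then have unif: "uniformly_continuous_on (cball \<epsilon> d \<times> {0..1}) (\<lambda>p. J (fst p) (snd p))"
    by (intro compact_uniformly_continuous compact_Times compact_cball compact_Icc)
  \<comment> \<open>The offset 2 keeps all radii strictly between 0 and 1, already for n =
    0.\<close>
  define \<rho> where "\<rho> n = 1 - 1 / (real n + 2)" for n
  have \<rho>: "0 < \<rho> n" "\<rho> n < 1" for n
    by (simp_all add: \<rho>_def field_simps)
  have \<rho>_lim: "\<rho> \<longlonglongrightarrow> 1"
  proof -
    have "(\<lambda>n. 1 / (real n + 2)) \<longlonglongrightarrow> 0"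
      using LIMSEQ_ignore_initial_segment[OF lim_1_over_n[where 'a = real], of 2] by (simp add: add.commute)
    then have "(\<lambda>n. 1 - 1 / (real n + 2)) \<longlonglongrightarrow> 1 - 0"
      by (intro tendsto_intros)
    then show ?thesis
      by (simp add: \<rho>_def[abs_def])
  qed
  have lim_I: "(\<lambda>n. I (\<rho> n) e) \<longlonglongrightarrow> I 1 e" if "e \<in> {-r<..<r}" for e
    unfolding I_def by (intro integral_cball_exhaustion slice[OF cont(3)] that \<rho> \<rho>_lim) auto
  \<comment> \<open>The integrals over the smaller disks converge and their derivatives converge
    uniformly near \<open>\<epsilon>\<close>, so the limit may be differentiated termwise.\<close>
  have "\<exists>g. \<forall>x\<in>ball \<epsilon> d. (\<lambda>n. I (\<rho> n) x) \<longlonglongrightarrow> g x \<and> (g has_derivative (\<lambda>h. h *\<^sub>R J x 1)) (at x within ball \<epsilon> d)"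
  proof (rule has_derivative_sequence[where f' = "\<lambda>n x h. h *\<^sub>R J x (\<rho> n)"])
    show "(I (\<rho> n) has_derivative (\<lambda>h. h *\<^sub>R J x (\<rho> n))) (at x within ball \<epsilon> d)" if "x \<in> ball \<epsilon> d" for n x
    proof -
      have "x \<in> {-r<..<r}"
        using that d(2) by (auto simp del: greaterThanLessThan_iff)
      then show ?thesis
        using deriv_I[OF _ \<rho>, of x n] by (simp add: has_vector_derivative_def has_derivative_at_withinI)
    qed
    fix \<eta> :: real assume "\<eta> > 0"
    then obtain \<delta> where \<delta>: "\<delta> > 0" "\<And>p q. p \<in> cball \<epsilon> d \<times> {0..1} \<Longrightarrow> q \<in> cball \<epsilon> d \<times> {0..1} \<Longrightarrow>
        dist q p < \<delta> \<Longrightarrow> dist (J (fst q) (snd q)) (J (fst p) (snd p)) < \<eta>"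
      using unif unfolding uniformly_continuous_on_def by metis
    have "\<forall>\<^sub>F n in sequentially. dist (\<rho> n) 1 < \<delta>"
      by (rule tendstoD[OF \<rho>_lim \<delta>(1)])
    then show "\<forall>\<^sub>F n in sequentially. \<forall>x\<in>ball \<epsilon> d. \<forall>h. norm (h *\<^sub>R J x (\<rho> n) - h *\<^sub>R J x 1) \<le> \<eta> * norm h"
    proof eventually_elim
      case (elim n)
      show ?case
      proof (intro ballI allI)
        fix x h :: real assume "x \<in> ball \<epsilon> d"
        then have "dist (J x (\<rho> n)) (J x 1) < \<eta>"
          using \<delta>(2)[of "(x, 1)" "(x, \<rho> n)"] elim \<rho>[of n] by (auto simp: dist_Pair_Pair less_imp_le)
        then have "norm h * norm (J x (\<rho> n) - J x 1) \<le> norm h * \<eta>"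
          by (intro mult_left_mono) (auto simp: dist_norm)
        then show "norm (h *\<^sub>R J x (\<rho> n) - h *\<^sub>R J x 1) \<le> \<eta> * norm h"
          by (simp add: scaleR_diff_right[symmetric] mult.commute)
      qed
    qed
  next
    show "\<epsilon> \<in> ball \<epsilon> d"
      using d by simp
    show "(\<lambda>n. I (\<rho> n) \<epsilon>) \<longlonglongrightarrow> I 1 \<epsilon>"
      by (rule lim_I[OF \<epsilon>])
  qed simp
  then obtain g where g: "\<And>x. x \<in> ball \<epsilon> d \<Longrightarrow> (\<lambda>n. I (\<rho> n) x) \<longlonglongrightarrow> g x"
    "\<And>x. x \<in> ball \<epsilon> d \<Longrightarrow> (g has_derivative (\<lambda>h. h *\<^sub>R J x 1)) (at x within ball \<epsilon> d)"
    by blast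
  have g_eq: "g x = I 1 x" if "x \<in> ball \<epsilon> d" for x
    using that d(2) by (intro LIMSEQ_unique[OF g(1) lim_I]) (auto simp del: greaterThanLessThan_iff)
  have "(g has_vector_derivative J \<epsilon> 1) (at \<epsilon>)"
    using g(2)[of \<epsilon>] d at_within_open[of \<epsilon> "ball \<epsilon> d"] by (simp add: has_vector_derivative_def)
  then have "(I 1 has_vector_derivative J \<epsilon> 1) (at \<epsilon>)"
    by (rule has_vector_derivative_transform_within_open[of _ _ _ "ball \<epsilon> d"]) (use d g_eq in auto)
  then show ?thesis
    by (simp add: I_def[abs_def] J_def)
qed

section \<open>The variation of the pulled back form\<close>

text \<open>Linearity passes to the limit along the contraction of \<open>q\<close> toward an
  interior point. It is needed on the boundary circle, where the velocity is decomposed into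
  coordinate directions.\<close>

lemma linear_extend_closure:
  fixes \<theta> :: "'a::locally_convex_space \<Rightarrow> 'a \<Rightarrow> 'b::locally_convex_space"
  assumes S: "convex S" "interior S \<noteq> {}" and cont: "continuous_on (S \<times> UNIV) (\<lambda>(q, u). \<theta> q u)"
    and lin: "\<And>q. q \<in> interior S \<Longrightarrow> linear (\<theta> q)" and q: "q \<in> S"
  shows "linear (\<theta> q)"
proof -
  obtain z where z: "z \<in> interior S"
    using S by blast
  define c where "c e = (1 - e) *\<^sub>R q + e *\<^sub>R z" for e
  have "(c \<longlongrightarrow> (1 - 0) *\<^sub>R q + 0 *\<^sub>R z) (at_right 0)"
    unfolding c_def by (intro tendsto_intros)
  then have c: "(c \<longlongrightarrow> q) (at_right 0)"
    by simp
  have "\<forall>\<^sub>F e in at_right (0::real). 0 < e \<and> e < 1"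
    unfolding eventually_at_right_field by (intro exI[of _ 1]) auto
  then have int: "\<forall>\<^sub>F e in at_right 0. c e \<in> interior S"
    by eventually_elim (use convex_shrink_interior[OF S(1) q z] in \<open>auto simp: c_def\<close>)
  have lim: "((\<lambda>e. \<theta> (c e) u) \<longlongrightarrow> \<theta> q u) (at_right 0)" for u
  proof -
    have "((\<lambda>e. (\<lambda>(q, u). \<theta> q u) (c e, u)) \<longlongrightarrow> (\<lambda>(q, u). \<theta> q u) (q, u)) (at_right 0)"
    proof (rule continuous_on_tendsto_compose[OF cont])
      show "((\<lambda>e. (c e, u)) \<longlongrightarrow> (q, u)) (at_right 0)"
        by (intro tendsto_Pair c tendsto_const)
      show "\<forall>\<^sub>F e in at_right 0. (c e, u) \<in> S \<times> UNIV"
        using int by eventually_elim (use interior_subset in auto)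
    qed (use q in auto)
    then show ?thesis by simp
  qed
  show ?thesis
  proof (rule linearI)
    fix u v
    show "\<theta> q (u + v) = \<theta> q u + \<theta> q v"
    proof (rule tendsto_unique[OF _ lim])
      show "((\<lambda>e. \<theta> (c e) (u + v)) \<longlongrightarrow> \<theta> q u + \<theta> q v) (at_right 0)"
        by (rule Lim_transform_eventually[OF tendsto_add[OF lim[of u] lim[of v]]])
          (use int in eventually_elim, simp add: linear_add[OF lin])
    qed simp
  next
    fix k u
    show "\<theta> q (k *\<^sub>R u) = k *\<^sub>R \<theta> q u"
    proof (rule tendsto_unique[OF _ lim])
      show "((\<lambda>e. \<theta> (c e) (k *\<^sub>R u)) \<longlongrightarrow> k *\<^sub>R \<theta> q u) (at_right 0)"
        by (rule Lim_transform_eventually[OF tendsto_scaleR_lcs[OF tendsto_const lim[of u]]])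
          (use int in eventually_elim, simp add: linear_scale[OF lin])
    qed simp
  qed
qed

text \<open>Bridge from the difference quotients used in the model space to the normed derivative
  used for the integrals.\<close>

lemma has_vector_derivative_quotient:
  fixes f :: "real \<Rightarrow> 'b::real_normed_vector"
  shows "(f has_vector_derivative d) (at x) \<longleftrightarrow> ((\<lambda>t. (1 / t) *\<^sub>R (f (x + t) - f x)) \<longlongrightarrow> d) (at 0)"
proof -
  have "norm (f (x + t) - f x - t *\<^sub>R d) / norm t = norm ((1 / t) *\<^sub>R (f (x + t) - f x) - d)" if "t \<noteq> 0" for t
  proof -
    have "(1 / t) *\<^sub>R (f (x + t) - f x) - d = (1 / t) *\<^sub>R (f (x + t) - f x - t *\<^sub>R d)"
      using that by (simp add: scaleR_diff_right)
    then show ?thesis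
      by (simp add: divide_inverse mult.commute)
  qed
  then have "((\<lambda>t. norm (f (x + t) - f x - t *\<^sub>R d) / norm t) \<longlongrightarrow> 0) (at 0) \<longleftrightarrow>
      ((\<lambda>t. norm ((1 / t) *\<^sub>R (f (x + t) - f x) - d)) \<longlongrightarrow> 0) (at 0)"
    by (intro filterlim_cong) (auto simp: eventually_at_filter)
  then show ?thesis
    by (simp add: has_vector_derivative_def has_derivative_at bounded_linear_scaleR_left
        tendsto_norm_zero_iff LIM_zero_iff)
qed

text \<open>The usual splitting for the product rule, with \<open>g t\<close> kept in the first
  term. Joint continuity of \<open>w\<close> replaces a norm bound, and continuity of
  \<open>g\<close> at 0 is recovered by multiplying its quotient by t.\<close>

lemma bilinear_directional:
  fixes w :: "'e::locally_convex_space \<Rightarrow> 'e \<Rightarrow> complex" and f g :: "real \<Rightarrow> 'e"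
  assumes w: "bilinear w" "continuous_on UNIV (\<lambda>(x, y). w x y)"
    and f: "((\<lambda>t. (1 / t) *\<^sub>R (f t - f 0)) \<longlongrightarrow> f') (at 0)"
    and g: "((\<lambda>t. (1 / t) *\<^sub>R (g t - g 0)) \<longlongrightarrow> g') (at 0)"
  shows "((\<lambda>t. (1 / t) *\<^sub>R (w (f t) (g t) - w (f 0) (g 0))) \<longlongrightarrow> w f' (g 0) + w (f 0) g') (at 0)"
proof -
  have w_lim: "((\<lambda>t. w (a t) (b t)) \<longlongrightarrow> w x y) F" if "(a \<longlongrightarrow> x) F" "(b \<longlongrightarrow> y) F"
    for a b x y and F :: "real filter"
    using continuous_on_tendsto_compose[OF w(2) tendsto_Pair[OF that]] by simp
  have nz: "\<forall>\<^sub>F t in at (0::real). t \<noteq> 0"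
    by (auto simp: eventually_at_filter)
  have "((\<lambda>t. t *\<^sub>R (1 / t) *\<^sub>R (g t - g 0) + g 0) \<longlongrightarrow> 0 *\<^sub>R g' + g 0) (at 0)"
    by (intro tendsto_intros g)
  then have g_lim: "(g \<longlongrightarrow> 0 *\<^sub>R g' + g 0) (at 0)"
    by (rule Lim_transform_eventually) (use nz in eventually_elim, simp)
  have "((\<lambda>t. w ((1 / t) *\<^sub>R (f t - f 0)) (g t) + w (f 0) ((1 / t) *\<^sub>R (g t - g 0))) \<longlongrightarrow>
      w f' (0 *\<^sub>R g' + g 0) + w (f 0) g') (at 0)"
    by (intro tendsto_add w_lim f g g_lim tendsto_const)
  moreover have "w ((1 / t) *\<^sub>R (f t - f 0)) (g t) + w (f 0) ((1 / t) *\<^sub>R (g t - g 0)) =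
      (1 / t) *\<^sub>R (w (f t) (g t) - w (f 0) (g 0))" for t
    by (simp add: bilinear_lmul[OF w(1)] bilinear_rmul[OF w(1)] bilinear_lsub[OF w(1)]
        bilinear_rsub[OF w(1)] scaleR_diff_right)
  ultimately show ?thesis
    by simp
qed

text \<open>Strictly inside the parameter interval the derivative within it is two-sided. The
  velocity is then a limit of chords divided by t, the form in which it can serve as moving
  direction of a strict derivative.\<close>

lemma positive_circle_param_derivative:
  assumes "positive_circle_param a b \<gamma>"
  obtains \<theta> \<theta>' where "a < b" "continuous_on {a..b} \<theta>"
    "\<theta> b = \<theta> a + 2 * pi"
    "\<forall>s\<in>{a..b}. (\<theta> has_real_derivative \<theta>' s) (at s within {a..b})"
    "\<forall>s\<in>{a..b}. \<gamma> s = (cos (\<theta> s), sin (\<theta> s))"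
    "\<forall>s\<in>{a<..<b}. ((\<lambda>t. (1 / t) *\<^sub>R (\<gamma> (s + t) - \<gamma> s)) \<longlongrightarrow> \<theta>' s *\<^sub>R (- sin (\<theta> s), cos (\<theta> s))) (at 0)"
proof -
  obtain \<theta> \<theta>' where ab: "a < b" and d: "\<forall>s\<in>{a..b}. (\<theta> has_real_derivative \<theta>' s) (at s within {a..b})"
    and *: "\<theta> b = \<theta> a + 2 * pi" "\<forall>s\<in>{a..b}. \<gamma> s = (cos (\<theta> s), sin (\<theta> s))"
    using assms unfolding positive_circle_param_def by blast
  have cont: "continuous_on {a..b} \<theta>"
    by (rule DERIV_continuous_on) (use d in blast)
  have "((\<lambda>t. (1 / t) *\<^sub>R (\<gamma> (s + t) - \<gamma> s)) \<longlongrightarrow> \<theta>' s *\<^sub>R (- sin (\<theta> s), cos (\<theta> s))) (at 0)"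
    if s: "s \<in> {a<..<b}" for s
  proof -
    have "at s within {a..b} = at s"
      using s by (intro at_within_interior) simp
    then have ds: "(\<theta> has_real_derivative \<theta>' s) (at s)"
      using d s by (metis greaterThanLessThan_subseteq_atLeastAtMost_iff order_refl subsetD)
    have "((\<lambda>s. cos (\<theta> s)) has_vector_derivative \<theta>' s * - sin (\<theta> s)) (at s)"
      "((\<lambda>s. sin (\<theta> s)) has_vector_derivative \<theta>' s * cos (\<theta> s)) (at s)"
      unfolding has_real_derivative_iff_has_vector_derivative[symmetric]
      by (auto intro!: derivative_eq_intros ds)
    then have "((\<lambda>t. ((1 / t) *\<^sub>R (cos (\<theta> (s + t)) - cos (\<theta> s)), (1 / t) *\<^sub>R (sin (\<theta> (s + t)) - sin (\<theta> s)))) \<longlongrightarrow>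
        (\<theta>' s * - sin (\<theta> s), \<theta>' s * cos (\<theta> s))) (at 0)"
      unfolding has_vector_derivative_quotient by (rule tendsto_Pair)
    then have "((\<lambda>t. ((1 / t) *\<^sub>R (cos (\<theta> (s + t)) - cos (\<theta> s)), (1 / t) *\<^sub>R (sin (\<theta> (s + t)) - sin (\<theta> s)))) \<longlongrightarrow>
        \<theta>' s *\<^sub>R (- sin (\<theta> s), cos (\<theta> s))) (at 0)"
      by simp
    then show ?thesis
    proof (rule Lim_transform_eventually)
      have "s \<in> interior {a..b}"
        using s by simp
      from interior_directional_eventually[OF this, of 1]
      have "\<forall>\<^sub>F t in at 0. s + t \<in> {a..b}"
        by (auto elim!: eventually_mono)
      then show "\<forall>\<^sub>F t in at 0. ((1 / t) *\<^sub>R (cos (\<theta> (s + t)) - cos (\<theta> s)), (1 / t) *\<^sub>R (sin (\<theta> (s + t)) - sin (\<theta> s))) =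
          (1 / t) *\<^sub>R (\<gamma> (s + t) - \<gamma> s)"
        by eventually_elim (use *(2) s in simp)
    qed
  qed
  then show ?thesis
    using that[OF ab cont *(1) d *(2)] by blast
qed

theorem theorem3p4:
  fixes L :: "('l, 'e::locally_convex_space) lie_data"
    and Lp Lm :: "'l set"
    and w :: "'e \<Rightarrow> 'e \<Rightarrow> complex"
    and r \<epsilon> a b :: real
    and h :: "real \<times> (real \<times> real) \<Rightarrow> 'l"
    and \<gamma> :: "real \<Rightarrow> real \<times> real"
  assumes "lie_group L"
    and "splitting L Lp Lm"
    and "two_cocycle L w"
    and "integral_cocycle L w"
    and "compatible L w Lp Lm"
    and "r > 0"
    and "smooth_into L ({-r<..<r} \<times> cball 0 1) h"
    and "positive_circle_param a b \<gamma>"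
    and "\<epsilon> \<in> {-r<..<r}"
  shows "((\<lambda>e. integral_pullback L w (cball 0 1) (\<lambda>p. h (e, p))) has_vector_derivative
      integral {a..b} (\<lambda>s.
        w (log_deriv L {-r<..<r} (\<lambda>e. h (e, \<gamma> s)) \<epsilon> 1)
          (log_deriv L {a..b} (\<lambda>\<sigma>. h (\<epsilon>, \<gamma> \<sigma>)) s 1))) (at \<epsilon>)"
proof -
  interpret lie_group L by (rule assms(1))
  have w: "bilinear w" "continuous_on UNIV (\<lambda>(x, y). w x y)"
    and skew: "\<And>x y. w x y = - w y x"
    and cocycle: "\<And>x y z. w (lie_bracket L x y) z + w (lie_bracket L y z) x + w (lie_bracket L z x) y = 0"
    using assms(3) unfolding two_cocycle_def by blast+
  define S where "S = {-r<..<r} \<times> cball (0 :: real \<times> real) 1"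
  have intS: "interior S = {-r<..<r} \<times> ball 0 1"
    by (simp add: S_def interior_Times interior_open)
  have S: "convex S" "interior S \<noteq> {}"
    unfolding intS using \<open>r > 0\<close> by (auto simp: S_def intro: convex_Times)
  have h: "smooth_into L S h"
    using assms(7) by (simp add: S_def)
  from log_deriv_form[OF h S] obtain \<theta> \<theta>' where
    cont: "continuous_on (S \<times> UNIV) (\<lambda>(q, u). \<theta> q u)" and
    C1: "C1_on (interior S \<times> UNIV) (\<lambda>(q, u). \<theta> q u) \<theta>'" and
    strict: "\<forall>q\<in>S. \<forall>u. strict_deriv (\<lambda>q'. uchart (inv\<^bsub>L\<^esub> h q \<otimes>\<^bsub>L\<^esub> h q')) S q u (\<theta> q u)" and
    MC: "\<forall>p\<in>interior S. \<forall>u v. \<theta>' (p, u) (v, 0) - \<theta>' (p, v) (u, 0) = - lie_bracket L (\<theta> p v) (\<theta> p u)" .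
  \<comment> \<open>At interior points the strict derivative is unconstrained and hence linear;
    boundary points follow by continuity.\<close>
  have lin: "linear (\<theta> q)" if "q \<in> S" for q
  proof (rule linear_extend_closure[OF S cont _ that])
    fix q assume q: "q \<in> interior S"
    have st: "strict_deriv (\<lambda>q'. uchart (inv\<^bsub>L\<^esub> h q \<otimes>\<^bsub>L\<^esub> h q')) UNIV q u (\<theta> q u)" for u
    proof -
      have "strict_deriv (\<lambda>q'. uchart (inv\<^bsub>L\<^esub> h q \<otimes>\<^bsub>L\<^esub> h q')) (UNIV \<inter> interior S) q u (\<theta> q u)"
        using interior_subset[of S] by (intro strict_deriv_subset[OF strict[rule_format, OF subsetD[OF interior_subset q]]]) auto
      then show ?thesis
        by (rule strict_deriv_neighbourhood[OF _ open_interior q])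
    qed
    show "linear (\<theta> q)"
      by (intro linearI strict_deriv_additive[OF st st st] strict_deriv_scaleR[OF st st])
  qed
  have w_lim: "((\<lambda>t. w (f t) (g t)) \<longlongrightarrow> w x y) F" if "(f \<longlongrightarrow> x) F" "(g \<longlongrightarrow> y) F"
    for f g x y and F :: "'z filter"
    using continuous_on_tendsto_compose[OF w(2) tendsto_Pair[OF that]] by simp
  have w_cont: "continuous_on T (\<lambda>z. w (f z) (g z))" if "continuous_on T f" "continuous_on T g"
    for f g and T :: "'z::topological_space set"
    using that by (auto simp: continuous_on_def intro: w_lim)

  \<comment> \<open>Unit directions of the parameters e, x and y; \<open>W e0 e1\<close> is then the
    coefficient W_01, and so on.\<close>
  define e0 e1 e2 :: "real \<times> real \<times> real" where "e0 = (1, 0, 0)" and "e1 = (0, 1, 0)" and "e2 = (0, 0, 1)"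
  define W where "W u v q = w (\<theta> q u) (\<theta> q v)" for u v q
  \<comment> \<open>Product rule for \<open>W u v\<close> in direction \<open>d\<close>; the 0 in
    \<open>(d, 0)\<close> keeps the vector argument of \<open>\<theta>\<close> fixed.\<close>
  define W' where "W' u v d q = w (\<theta>' (q, u) (d, 0)) (\<theta> q v) + w (\<theta> q u) (\<theta>' (q, v) (d, 0))" for u v d q
  have \<theta>_cont: "continuous_on S (\<lambda>q. \<theta> q u)" for u
  proof -
    have "continuous_on S (\<lambda>q. (\<lambda>(q, u). \<theta> q u) (q, u))"
      by (intro continuous_on_compose2[OF cont] continuous_intros) auto
    then show ?thesis by simp
  qed
  have \<theta>'_cont: "continuous_on (interior S) (\<lambda>q. \<theta>' (q, u) (v, 0))" for u v
  proof -
    have "continuous_on (interior S) (\<lambda>q. (\<lambda>(p, z). \<theta>' p z) ((q, u), (v, 0)))"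
      by (intro continuous_on_compose2[OF C1_onD(2)[OF C1]] continuous_intros) auto
    then show ?thesis by simp
  qed
  have W_cont: "continuous_on S (W u v)" for u v
    unfolding W_def by (intro w_cont \<theta>_cont)
  have W'_cont: "continuous_on (interior S) (W' u v d)" for u v d
    unfolding W'_def
    by (intro continuous_on_add w_cont \<theta>'_cont continuous_on_subset[OF \<theta>_cont] interior_subset)
  have W_deriv: "((\<lambda>t. (1 / t) *\<^sub>R (W u v (q + t *\<^sub>R d) - W u v q)) \<longlongrightarrow> W' u v d q) (at 0)"
    if q: "q \<in> interior S" for u v d q
  proof -
    have "((\<lambda>t. (1 / t) *\<^sub>R (\<theta> (q + t *\<^sub>R d) u - \<theta> (q + 0 *\<^sub>R d) u)) \<longlongrightarrow> \<theta>' (q, u) (d, 0)) (at 0)" for u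
      using C1_onD(3)[OF C1, of "(q, u)" "(d, 0)"] q by (simp add: interior_Times)
    from bilinear_directional[OF w this this] show ?thesis
      by (simp add: W_def W'_def)
  qed
  \<comment> \<open>After the Maurer-Cartan relation has exchanged directions, the remaining first
    derivatives match by skew symmetry, and the three bracket terms cancel by the cocycle
    identity.\<close>
  have closed: "W' e1 e2 e0 q = W' e0 e2 e1 q - W' e0 e1 e2 q" if q: "q \<in> interior S" for q
  proof -
    have MC': "\<theta>' (q, u) (v, 0) = \<theta>' (q, v) (u, 0) - lie_bracket L (\<theta> q v) (\<theta> q u)" for u v
      using MC[rule_format, OF q, of u v] by (simp add: algebra_simps)
    have anti: "lie_bracket L x y = - lie_bracket L y x" for x y
      by (simp add: lie_bracket_def split_beta)
    have "w (lie_bracket L (\<theta> q e0) (\<theta> q e1)) (\<theta> q e2) + w (\<theta> q e1) (lie_bracket L (\<theta> q e0) (\<theta> q e2)) =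
        w (\<theta> q e0) (lie_bracket L (\<theta> q e1) (\<theta> q e2))"
    proof -
      have "w (\<theta> q e1) (lie_bracket L (\<theta> q e0) (\<theta> q e2)) = w (lie_bracket L (\<theta> q e2) (\<theta> q e0)) (\<theta> q e1)"
        unfolding anti[of "\<theta> q e0" "\<theta> q e2"]
        using skew[of "\<theta> q e1" "lie_bracket L (\<theta> q e2) (\<theta> q e0)"] by (simp add: bilinear_rneg[OF w(1)])
      moreover have "x + z = - y" if "x + y + z = 0" for x y z :: complex
        using that by (simp add: eq_neg_iff_add_eq_0 ac_simps)
      ultimately show ?thesis
        using cocycle[of "\<theta> q e0" "\<theta> q e1" "\<theta> q e2"]
          skew[of "\<theta> q e0" "lie_bracket L (\<theta> q e1) (\<theta> q e2)"]
        by metis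
    qed
    then show ?thesis
      unfolding W'_def MC'[of e1 e0] MC'[of e2 e0] MC'[of e2 e1]
        bilinear_lsub[OF w(1)] bilinear_rsub[OF w(1)]
      using skew[of "\<theta> q e1" "\<theta>' (q, e0) (e2, 0)"]
      by (simp add: algebra_simps)
  qed

  have interior_eval: "(e, x, y) \<in> interior S" if "e \<in> {-r<..<r}" "(x, y) \<in> ball 0 1" for e x y
    using that by (simp add: intS del: mem_ball mem_ball_0)
  have disk: "((\<lambda>e. integral (cball 0 1) (\<lambda>(x, y). W e1 e2 (e, x, y))) has_vector_derivative
    integral {-pi..pi} (\<lambda>t. cos t *\<^sub>R W e0 e2 (\<epsilon>, cos t, sin t) - sin t *\<^sub>R W e0 e1 (\<epsilon>, cos t, sin t))) (at \<epsilon>)"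
  \<comment> \<open>Here P, Q and R are W_01, W_02 and W_12; \<open>closed\<close> provides the
    required derivative of R.\<close>
  proof (rule closed_form_disk_derivative[OF assms(9), where Qx = "\<lambda>e x y. W' e0 e2 e1 (e, x, y)"
        and Py = "\<lambda>e x y. W' e0 e1 e2 (e, x, y)"])
    show "continuous_on ({-r<..<r} \<times> cball 0 1) (\<lambda>(e, x, y). W e0 e1 (e, x, y))"
      "continuous_on ({-r<..<r} \<times> cball 0 1) (\<lambda>(e, x, y). W e0 e2 (e, x, y))"
      "continuous_on ({-r<..<r} \<times> cball 0 1) (\<lambda>(e, x, y). W e1 e2 (e, x, y))"
      using W_cont by (simp_all add: S_def case_prod_unfold)
    show "continuous_on ({-r<..<r} \<times> ball 0 1) (\<lambda>(e, x, y). W' e0 e1 e2 (e, x, y))"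
      "continuous_on ({-r<..<r} \<times> ball 0 1) (\<lambda>(e, x, y). W' e0 e2 e1 (e, x, y))"
      using W'_cont by (simp_all add: intS case_prod_unfold)
    fix e x y :: real assume e: "e \<in> {-r<..<r}" "(x, y) \<in> ball 0 1"
    note q = interior_eval[OF this]
    show "((\<lambda>y. W e0 e1 (e, x, y)) has_vector_derivative W' e0 e1 e2 (e, x, y)) (at y)"
      using W_deriv[OF q, of e0 e1 e2] by (simp add: has_vector_derivative_quotient e2_def)
    show "((\<lambda>x. W e0 e2 (e, x, y)) has_vector_derivative W' e0 e2 e1 (e, x, y)) (at x)"
      using W_deriv[OF q, of e0 e2 e1] by (simp add: has_vector_derivative_quotient e1_def)
    show "((\<lambda>e. W e1 e2 (e, x, y)) has_vector_derivative W' e0 e2 e1 (e, x, y) - W' e0 e1 e2 (e, x, y)) (at e)"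
      using W_deriv[OF q, of e1 e2 e0] unfolding closed[OF q]
      by (simp add: has_vector_derivative_quotient e0_def)
  qed

  have pullback: "integral_pullback L w (cball 0 1) (\<lambda>p. h (e, p)) = integral (cball 0 1) (\<lambda>(x, y). W e1 e2 (e, x, y))"
    if e: "e \<in> {-r<..<r}" for e
    unfolding integral_pullback_def
  \<comment> \<open>On the circle \<open>dir_deriv\<close> may be one-sided or unspecified; the
    circle is negligible, and off it the integrands agree.\<close>
  proof (rule integral_spike[OF negligible_sphere])
    fix p :: "real \<times> real" assume "p \<in> cball 0 1 - sphere 0 1"
    then have p: "p \<in> ball 0 1"
      by auto
    then have q: "(e, p) \<in> interior S"
      using e by (simp add: intS)
    have "log_deriv L (cball 0 1) (\<lambda>p. h (e, p)) p u = \<theta> (e, p) (0, u)" for u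
      unfolding log_deriv_def
    proof (rule dir_deriv_eqI)
      have "((\<lambda>t. (1 / t) *\<^sub>R (uchart (inv\<^bsub>L\<^esub> h (e, p) \<otimes>\<^bsub>L\<^esub> h ((e, p) + t *\<^sub>R (0, u))) -
          uchart (inv\<^bsub>L\<^esub> h (e, p) \<otimes>\<^bsub>L\<^esub> h (e, p)))) \<longlongrightarrow> \<theta> (e, p) (0, u)) (at 0)"
      proof (rule strict_deriv_compose)
        show "strict_deriv (\<lambda>q'. uchart (inv\<^bsub>L\<^esub> h (e, p) \<otimes>\<^bsub>L\<^esub> h q')) S (e, p) (0, u) (\<theta> (e, p) (0, u))"
          using strict q interior_subset by blast
        show "\<forall>\<^sub>F t in at 0. (e, p) \<in> S \<and> (e, p) + t *\<^sub>R (0, u) \<in> S"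
          using interior_directional_eventually[OF q, of "(0, u)"] q interior_subset[of S]
          by (auto elim!: eventually_mono)
      qed (auto simp: filterlim_ident)
      then show "((\<lambda>t. (1 / t) *\<^sub>R (snd (unit_chart L) (inv\<^bsub>L\<^esub> h (e, p) \<otimes>\<^bsub>L\<^esub> h (e, p + t *\<^sub>R u)) -
          snd (unit_chart L) (inv\<^bsub>L\<^esub> h (e, p) \<otimes>\<^bsub>L\<^esub> h (e, p)))) \<longlongrightarrow> \<theta> (e, p) (0, u)) (at 0)"
        by (simp add: uchart_def)
      show "p \<in> interior (cball 0 1)"
        using p by simp
    qed
    then show "(case p of (x, y) \<Rightarrow> W e1 e2 (e, x, y)) = pullback_form L w (cball 0 1) (\<lambda>p. h (e, p)) p"
      by (simp add: pullback_form_def W_def e1_def e2_def case_prod_unfold)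
  qed

  define G where "G t = cos t *\<^sub>R W e0 e2 (\<epsilon>, cos t, sin t) - sin t *\<^sub>R W e0 e1 (\<epsilon>, cos t, sin t)" for t
  have circle: "(\<epsilon>, cos t, sin t) \<in> S" for t
    using assms(9) by (simp add: S_def norm_Pair)
  have G_cont: "continuous_on UNIV G"
    unfolding G_def
    by (intro continuous_intros continuous_on_compose2[OF W_cont]) (use circle in auto)
  obtain \<phi> \<phi>' where ab: "a < b" and \<phi>: "continuous_on {a..b} \<phi>" "\<phi> b = \<phi> a + 2 * pi"
    "\<forall>s\<in>{a..b}. (\<phi> has_real_derivative \<phi>' s) (at s within {a..b})"
    "\<forall>s\<in>{a..b}. \<gamma> s = (cos (\<phi> s), sin (\<phi> s))"
    "\<forall>s\<in>{a<..<b}. ((\<lambda>t. (1 / t) *\<^sub>R (\<gamma> (s + t) - \<gamma> s)) \<longlongrightarrow> \<phi>' s *\<^sub>R (- sin (\<phi> s), cos (\<phi> s))) (at 0)"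
    by (rule positive_circle_param_derivative[OF assms(8)])
  have boundary: "w (log_deriv L {-r<..<r} (\<lambda>e. h (e, \<gamma> s)) \<epsilon> 1)
      (log_deriv L {a..b} (\<lambda>\<sigma>. h (\<epsilon>, \<gamma> \<sigma>)) s 1) = \<phi>' s *\<^sub>R G (\<phi> s)" if s: "s \<in> {a<..<b}" for s
  proof -
    define q where "q = (\<epsilon>, \<gamma> s)"
    have q_eq: "q = (\<epsilon>, cos (\<phi> s), sin (\<phi> s))"
      using \<phi>(4) s by (simp add: q_def)
    have q: "q \<in> S"
      using circle by (simp add: q_eq)
    \<comment> \<open>The direction \<open>v t\<close> is allowed to vary with t, because a fixed
      tangent direction would lead out of \<open>S\<close>.\<close>
    have quotient: "((\<lambda>t. (1 / t) *\<^sub>R (uchart (inv\<^bsub>L\<^esub> h q \<otimes>\<^bsub>L\<^esub> h (q + t *\<^sub>R v t)) -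
          uchart (inv\<^bsub>L\<^esub> h q \<otimes>\<^bsub>L\<^esub> h q))) \<longlongrightarrow> \<theta> q u) (at 0)"
      if "(v \<longlongrightarrow> u) (at 0)" "\<forall>\<^sub>F t in at 0. q + t *\<^sub>R v t \<in> S" for u v
      by (rule strict_deriv_compose[OF strict[rule_format, OF q]])
        (use that q in \<open>auto simp: filterlim_ident\<close>)
    have "log_deriv L {-r<..<r} (\<lambda>e. h (e, \<gamma> s)) \<epsilon> 1 = \<theta> q e0"
      unfolding log_deriv_def
    proof (rule dir_deriv_eqI)
      have "\<forall>\<^sub>F t in at 0. \<epsilon> + t *\<^sub>R 1 \<in> interior {-r<..<r}"
        using assms(9) by (intro interior_directional_eventually) (simp add: interior_open)
      then have "\<forall>\<^sub>F t in at 0. q + t *\<^sub>R e0 \<in> S"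
        by eventually_elim (use q in \<open>simp add: q_def S_def e0_def interior_open zero_prod_def[symmetric]\<close>)
      from quotient[OF tendsto_const this]
      show "((\<lambda>t. (1 / t) *\<^sub>R (snd (unit_chart L) (inv\<^bsub>L\<^esub> h (\<epsilon>, \<gamma> s) \<otimes>\<^bsub>L\<^esub> h (\<epsilon> + t *\<^sub>R 1, \<gamma> s)) -
          snd (unit_chart L) (inv\<^bsub>L\<^esub> h (\<epsilon>, \<gamma> s) \<otimes>\<^bsub>L\<^esub> h (\<epsilon>, \<gamma> s)))) \<longlongrightarrow> \<theta> q e0) (at 0)"
        by (simp add: uchart_def q_def e0_def zero_prod_def[symmetric])
      show "\<epsilon> \<in> interior {-r<..<r}"
        using assms(9) by (simp add: interior_open)
    qed
    moreover have "log_deriv L {a..b} (\<lambda>\<sigma>. h (\<epsilon>, \<gamma> \<sigma>)) s 1 = \<theta> q (0, \<phi>' s *\<^sub>R (- sin (\<phi> s), cos (\<phi> s)))"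
      unfolding log_deriv_def
    proof (rule dir_deriv_eqI)
      show s_int: "s \<in> interior {a..b}"
        using s by simp
      have nz: "\<forall>\<^sub>F t in at (0::real). t \<noteq> 0"
        by (auto simp: eventually_at_filter)
      \<comment> \<open>The chord of the circle divided by t is the moving direction, so the end of
        the segment lies on the circle and hence in \<open>S\<close>.\<close>
      have step: "q + t *\<^sub>R (0, (1 / t) *\<^sub>R (\<gamma> (s + t) - \<gamma> s)) = (\<epsilon>, \<gamma> (s + t))" if "t \<noteq> 0" for t
        using that by (simp add: q_def)
      have lim: "((\<lambda>t. (0::real, (1 / t) *\<^sub>R (\<gamma> (s + t) - \<gamma> s))) \<longlongrightarrow> (0, \<phi>' s *\<^sub>R (- sin (\<phi> s), cos (\<phi> s)))) (at 0)"
        using \<phi>(5) s by (intro tendsto_Pair tendsto_const) blast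
      have "\<forall>\<^sub>F t in at 0. s + t *\<^sub>R 1 \<in> interior {a..b}"
        by (rule interior_directional_eventually[OF s_int])
      with nz have "\<forall>\<^sub>F t in at 0. q + t *\<^sub>R (0, (1 / t) *\<^sub>R (\<gamma> (s + t) - \<gamma> s)) \<in> S"
      proof eventually_elim
        case (elim t)
        then show ?case
          unfolding step[OF elim(1)] using \<phi>(4) circle by simp
      qed
      from quotient[OF lim this]
      show "((\<lambda>t. (1 / t) *\<^sub>R (snd (unit_chart L) (inv\<^bsub>L\<^esub> h (\<epsilon>, \<gamma> s) \<otimes>\<^bsub>L\<^esub> h (\<epsilon>, \<gamma> (s + t *\<^sub>R 1))) -
          snd (unit_chart L) (inv\<^bsub>L\<^esub> h (\<epsilon>, \<gamma> s) \<otimes>\<^bsub>L\<^esub> h (\<epsilon>, \<gamma> s)))) \<longlongrightarrow> \<theta> q (0, \<phi>' s *\<^sub>R (- sin (\<phi> s), cos (\<phi> s)))) (at 0)"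
        by (rule Lim_transform_eventually) (use nz in eventually_elim, simp only: step not_False_eq_True, simp add: uchart_def q_def)
    qed
    \<comment> \<open>Here \<open>q\<close> is a boundary point of \<open>S\<close>, so this is
      where linearity beyond the interior enters.\<close>
    moreover have "\<theta> q (0, \<phi>' s *\<^sub>R (- sin (\<phi> s), cos (\<phi> s))) =
        \<phi>' s *\<^sub>R (cos (\<phi> s) *\<^sub>R \<theta> q e2 - sin (\<phi> s) *\<^sub>R \<theta> q e1)"
    proof -
      interpret linear "\<theta> q" by (rule lin[OF q])
      have "(0, \<phi>' s *\<^sub>R (- sin (\<phi> s), cos (\<phi> s))) = \<phi>' s *\<^sub>R (cos (\<phi> s) *\<^sub>R e2 - sin (\<phi> s) *\<^sub>R e1)"
        by (simp add: e1_def e2_def)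
      then show ?thesis
        by (simp only: scaleR diff)
    qed
    ultimately show ?thesis
      by (simp add: G_def W_def q_eq bilinear_rmul[OF w(1)] bilinear_rsub[OF w(1)])
  qed
  have "integral {a..b} (\<lambda>s. w (log_deriv L {-r<..<r} (\<lambda>e. h (e, \<gamma> s)) \<epsilon> 1)
      (log_deriv L {a..b} (\<lambda>\<sigma>. h (\<epsilon>, \<gamma> \<sigma>)) s 1)) = integral {a..b} (\<lambda>s. \<phi>' s *\<^sub>R G (\<phi> s))"
    by (rule integral_spike[of "{a, b}"]) (use boundary in auto)
  also have "\<dots> = integral {\<phi> a..\<phi> b} G"
  proof -
    obtain c d where cd: "\<phi> ` {a..b} \<subseteq> {c..d}"
      using compact_imp_bounded[OF compact_continuous_image[OF \<phi>(1) compact_Icc]]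
        bounded_subset_cbox_symmetric by (metis interval_cbox)
    have "((\<lambda>s. \<phi>' s *\<^sub>R G (\<phi> s)) has_integral integral {\<phi> a..\<phi> b} G) {a..b}"
      using ab \<phi>(2,3) by (intro has_integral_substitution[OF _ _ cd] continuous_on_subset[OF G_cont]) auto
    then show ?thesis
      by (rule integral_unique)
  qed
  \<comment> \<open>The angle covers one full turn beginning at \<open>\<phi> a\<close>, and
    \<open>G\<close> has period 2 pi, so the starting angle can be moved to -pi.\<close>
  also have "\<dots> = integral {-pi..-pi + 2 * pi} G"
    unfolding \<phi>(2) by (rule integral_periodic_shift[OF G_cont]) (auto simp: G_def)
  finally have rhs: "integral {a..b} (\<lambda>s. w (log_deriv L {-r<..<r} (\<lambda>e. h (e, \<gamma> s)) \<epsilon> 1)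
      (log_deriv L {a..b} (\<lambda>\<sigma>. h (\<epsilon>, \<gamma> \<sigma>)) s 1)) = integral {-pi..pi} G"
    by simp
  show ?thesis
    unfolding rhs
    by (rule has_vector_derivative_transform_within_open[OF disk[folded G_def], of "{-r<..<r}"])
      (use assms(9) pullback in auto)
qed

end
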